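(* Let $M=\mathbb R^n\#\mathbb R^n$ with $n\ge2$. Then for every $1\le p<n$ there is a constant $C$ such that $$\left(\int_M |f|^{\frac{np}{n-p}}\,dx\right)^{\frac{n-p}{np}}\le C\left(\int_M|\nabla f|^p\,dx\right)^{1/p}\quad\text{for all } f\in C_c^\infty(M).$$
   Context: $\mathbb R^n\#\mathbb R^n$ denotes the connected sum of two copies of $\mathbb R^n$: a complete connected smooth $n$-dimensional Riemannian manifold obtained by gluing two copies of $\mathbb R^n\setminus B(0,1)$ along a smooth compact set, i.e. there is a compact set $K\subset M$ with smooth boundary such that $M\setminus K$ is the disjoint union of two open sets, each isometric to the complement of the closed unit ball in Euclidean $\mathbb R^n$. $dx$ is the Riemannian measure and $\nabla$ the Riemannian gradient. *)

theory Defs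
  imports "HOL-Analysis.Analysis"
begin

section \<open>Smooth maps between open subsets of normed spaces\<close>

text \<open>On an open subset of a Euclidean space these are the usual \<open>C\<^sup>k\<close> and \<open>C\<^sup>\<infinity>\<close>
  functions; both notions are only meant for open \<open>S\<close>.\<close>

primrec Ck_on :: "nat \<Rightarrow> 'a::real_normed_vector set \<Rightarrow> ('a \<Rightarrow> 'b::real_normed_vector) \<Rightarrow> bool" where
  "Ck_on 0 S f \<longleftrightarrow> continuous_on S f"
| "Ck_on (Suc k) S f \<longleftrightarrow>
     (\<forall>x\<in>S. f differentiable (at x)) \<and> (\<forall>v. Ck_on k S (\<lambda>x. frechet_derivative f (at x) v))"

definition smooth_on :: "'a::real_normed_vector set \<Rightarrow> ('a \<Rightarrow> 'b::real_normed_vector) \<Rightarrow> bool" where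
  "smooth_on S f \<longleftrightarrow> (\<forall>k. Ck_on k S f)"


section \<open>Smooth manifolds\<close>

text \<open>The underlying topological space is a whole type \<open>'m\<close>, Hausdorff and second countable.
  A chart is a pair of a domain and a coordinate map; the values of the coordinate map outside
  the domain are irrelevant. The dimension is \<open>CARD('n)\<close>.\<close>

type_synonym ('m, 'n) chart = "'m set \<times> ('m \<Rightarrow> real ^ 'n)"

abbreviation chart_dom :: "('m, 'n::finite) chart \<Rightarrow> 'm set" where
  "chart_dom c \<equiv> fst c"

abbreviation coord :: "('m, 'n::finite) chart \<Rightarrow> 'm \<Rightarrow> real ^ 'n" where
  "coord c \<equiv> snd c"

definition coord_inv :: "('m, 'n::finite) chart \<Rightarrow> real ^ 'n \<Rightarrow> 'm" where
  "coord_inv c = inv_into (chart_dom c) (coord c)"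

definition is_chart :: "('m::topological_space, 'n::finite) chart \<Rightarrow> bool" where
  "is_chart c \<longleftrightarrow>
     open (chart_dom c) \<and> open (coord c ` chart_dom c) \<and>
     homeomorphism (chart_dom c) (coord c ` chart_dom c) (coord c) (coord_inv c)"

definition smoothly_compatible ::
    "('m::topological_space, 'n::finite) chart \<Rightarrow> ('m, 'n) chart \<Rightarrow> bool" where
  "smoothly_compatible c d \<longleftrightarrow>
     smooth_on (coord c ` (chart_dom c \<inter> chart_dom d)) (coord d \<circ> coord_inv c) \<and>
     smooth_on (coord d ` (chart_dom c \<inter> chart_dom d)) (coord c \<circ> coord_inv d)"

definition smooth_manifold ::
    "('m::{t2_space, second_countable_topology}, 'n::finite) chart set \<Rightarrow> bool" where
  "smooth_manifold A \<longleftrightarrow>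
     (\<forall>c\<in>A. is_chart c) \<and> (\<Union>c\<in>A. chart_dom c) = UNIV \<and>
     (\<forall>c\<in>A. \<forall>d\<in>A. smoothly_compatible c d)"

text \<open>The charts of the maximal atlas generated by \<open>A\<close>.\<close>

definition admissible_chart ::
    "('m::topological_space, 'n::finite) chart set \<Rightarrow> ('m, 'n) chart \<Rightarrow> bool" where
  "admissible_chart A c \<longleftrightarrow> is_chart c \<and> (\<forall>d\<in>A. smoothly_compatible c d)"

text \<open>Some chart of the atlas around a point. Tangent vectors at \<open>x\<close> are represented by their
  coordinates in this chart; the scalar quantities defined from it below do not depend on the
  choice.\<close>

definition chart_at :: "('m, 'n::finite) chart set \<Rightarrow> 'm \<Rightarrow> ('m, 'n) chart" where
  "chart_at A x = (SOME c. c \<in> A \<and> x \<in> chart_dom c)"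

definition smooth_compactly_supported ::
    "('m::topological_space, 'n::finite) chart set \<Rightarrow> ('m \<Rightarrow> real) \<Rightarrow> bool" where
  "smooth_compactly_supported A f \<longleftrightarrow>
     (\<forall>c\<in>A. smooth_on (coord c ` chart_dom c) (f \<circ> coord_inv c)) \<and>
     compact (closure {x. f x \<noteq> 0})"

text \<open>\<open>K\<close> is a domain with smooth boundary: near each boundary point it is a closed half space
  in a suitable chart of the maximal atlas.\<close>

definition has_smooth_boundary ::
    "('m::topological_space, 'n::finite) chart set \<Rightarrow> 'm set \<Rightarrow> bool" where
  "has_smooth_boundary A K \<longleftrightarrow>
     (\<forall>x\<in>frontier K. \<exists>c i. admissible_chart A c \<and> x \<in> chart_dom c \<and>
        (\<forall>y\<in>chart_dom c. y \<in> K \<longleftrightarrow> coord c y $ i \<le> 0))"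


section \<open>Riemannian metrics\<close>

text \<open>A Riemannian metric is given by its coefficient matrices: \<open>g c x $ i $ j\<close> is
  \<open>g\<^sub>x(\<partial>\<^sub>i, \<partial>\<^sub>j)\<close> for the coordinate vector fields of the chart \<open>c\<close>. The last clause is the
  transformation law of a covariant 2-tensor.\<close>

type_synonym ('m, 'n) metric_coeffs = "('m, 'n) chart \<Rightarrow> 'm \<Rightarrow> real ^ 'n ^ 'n"

definition transition_jacobian ::
    "('m, 'n::finite) chart \<Rightarrow> ('m, 'n) chart \<Rightarrow> 'm \<Rightarrow> real ^ 'n ^ 'n" where
  "transition_jacobian c d x = jacobian (coord d \<circ> coord_inv c) (at (coord c x))"

definition riemannian_metric ::
    "('m::topological_space, 'n::finite) chart set \<Rightarrow> ('m, 'n) metric_coeffs \<Rightarrow> bool" where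
  "riemannian_metric A g \<longleftrightarrow>
     (\<forall>c\<in>A. smooth_on (coord c ` chart_dom c) (g c \<circ> coord_inv c)) \<and>
     (\<forall>c\<in>A. \<forall>x\<in>chart_dom c.
        transpose (g c x) = g c x \<and> (\<forall>v. v \<noteq> 0 \<longrightarrow> v \<bullet> (g c x *v v) > 0)) \<and>
     (\<forall>c\<in>A. \<forall>d\<in>A. \<forall>x\<in>chart_dom c \<inter> chart_dom d.
        g c x = transpose (transition_jacobian c d x) ** g d x ** transition_jacobian c d x)"

text \<open>The length of the tangent vector at \<open>x\<close> with coordinates \<open>v\<close> in the chart
  \<open>chart_at A x\<close>.\<close>

definition tangent_norm ::
    "('m, 'n::finite) chart set \<Rightarrow> ('m, 'n) metric_coeffs \<Rightarrow> 'm \<Rightarrow> real ^ 'n \<Rightarrow> real" where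
  "tangent_norm A g x v = sqrt (v \<bullet> (g (chart_at A x) x *v v))"

text \<open>The gradient, in the coordinates of \<open>chart_at A x\<close>: its components are
  \<open>\<Sum>j. g\<^sup>i\<^sup>j \<partial>\<^sub>j f\<close>.\<close>

definition gradient ::
    "('m, 'n::finite) chart set \<Rightarrow> ('m, 'n) metric_coeffs \<Rightarrow> ('m \<Rightarrow> real) \<Rightarrow> 'm \<Rightarrow> real ^ 'n" where
  "gradient A g f x =
     (let c = chart_at A x in
      matrix_inv (g c x) *v
        (\<chi> j. frechet_derivative (f \<circ> coord_inv c) (at (coord c x)) (axis j 1)))"

definition gradient_norm ::
    "('m, 'n::finite) chart set \<Rightarrow> ('m, 'n) metric_coeffs \<Rightarrow> ('m \<Rightarrow> real) \<Rightarrow> 'm \<Rightarrow> real" where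
  "gradient_norm A g f x = tangent_norm A g x (gradient A g f x)"

text \<open>The Riemannian measure is the unique Borel measure which has density
  \<open>\<surd>(det (g\<^sub>i\<^sub>j))\<close> with respect to Lebesgue measure in every chart.\<close>

definition riemannian_measure ::
    "('m::topological_space, 'n::finite) chart set \<Rightarrow> ('m, 'n) metric_coeffs \<Rightarrow> 'm measure \<Rightarrow> bool" where
  "riemannian_measure A g \<mu> \<longleftrightarrow>
     sets \<mu> = sets borel \<and>
     (\<forall>c\<in>A. \<forall>B\<in>sets borel. B \<subseteq> chart_dom c \<longrightarrow>
        emeasure \<mu> B =
          (\<integral>\<^sup>+ u\<in>coord c ` B. ennreal (sqrt (det (g c (coord_inv c u)))) \<partial>lborel))"


section \<open>Riemannian distance and completeness\<close>

definition piecewise_C1_curve ::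
    "('m::topological_space, 'n::finite) chart set \<Rightarrow> (real \<Rightarrow> 'm) \<Rightarrow> bool" where
  "piecewise_C1_curve A \<gamma> \<longleftrightarrow>
     continuous_on {0..1} \<gamma> \<and>
     (\<forall>c\<in>A. \<forall>a b. 0 \<le> a \<and> a \<le> b \<and> b \<le> 1 \<and> \<gamma> ` {a..b} \<subseteq> chart_dom c \<longrightarrow>
        (coord c \<circ> \<gamma>) piecewise_C1_differentiable_on {a..b})"

definition curve_speed ::
    "('m, 'n::finite) chart set \<Rightarrow> ('m, 'n) metric_coeffs \<Rightarrow> (real \<Rightarrow> 'm) \<Rightarrow> real \<Rightarrow> real" where
  "curve_speed A g \<gamma> t =
     tangent_norm A g (\<gamma> t) (vector_derivative (coord (chart_at A (\<gamma> t)) \<circ> \<gamma>) (at t))"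

definition curve_length ::
    "('m, 'n::finite) chart set \<Rightarrow> ('m, 'n) metric_coeffs \<Rightarrow> (real \<Rightarrow> 'm) \<Rightarrow> ennreal" where
  "curve_length A g \<gamma> = (\<integral>\<^sup>+ t\<in>{0..1}. ennreal (curve_speed A g \<gamma> t) \<partial>lborel)"

definition riemannian_dist ::
    "('m::topological_space, 'n::finite) chart set \<Rightarrow> ('m, 'n) metric_coeffs \<Rightarrow> 'm \<Rightarrow> 'm \<Rightarrow> ennreal" where
  "riemannian_dist A g x y =
     (INF \<gamma>\<in>{\<gamma>. piecewise_C1_curve A \<gamma> \<and> \<gamma> 0 = x \<and> \<gamma> 1 = y}. curve_length A g \<gamma>)"

definition riemannian_complete ::
    "('m::topological_space, 'n::finite) chart set \<Rightarrow> ('m, 'n) metric_coeffs \<Rightarrow> bool" where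
  "riemannian_complete A g \<longleftrightarrow>
     (\<forall>X :: nat \<Rightarrow> 'm.
        (\<forall>e>0. \<exists>N. \<forall>k\<ge>N. \<forall>l\<ge>N. riemannian_dist A g (X k) (X l) < e) \<longrightarrow>
        (\<exists>x. (\<lambda>k. riemannian_dist A g (X k) x) \<longlonglongrightarrow> 0))"


section \<open>The connected sum of two copies of Euclidean space\<close>

text \<open>A Riemannian isometry from the open set \<open>E\<close> onto an open set \<open>\<Omega>\<close> of Euclidean space is a
  diffeomorphism, that is, a chart of the maximal atlas, which pulls the Euclidean metric
  back to \<open>g\<close>.\<close>

definition isometric_to_euclidean ::
    "('m::topological_space, 'n::finite) chart set \<Rightarrow> ('m, 'n) metric_coeffs \<Rightarrow>
     'm set \<Rightarrow> (real ^ 'n) set \<Rightarrow> bool" where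
  "isometric_to_euclidean A g E \<Omega> \<longleftrightarrow>
     (\<exists>\<phi>. admissible_chart A (E, \<phi>) \<and> \<phi> ` E = \<Omega> \<and>
        (\<forall>d\<in>A. \<forall>x\<in>E \<inter> chart_dom d.
           g d x = transpose (transition_jacobian d (E, \<phi>) x) ** transition_jacobian d (E, \<phi>) x))"

definition euclidean_connected_sum ::
    "('m::{t2_space, second_countable_topology}, 'n::finite) chart set \<Rightarrow> ('m, 'n) metric_coeffs \<Rightarrow> bool" where
  "euclidean_connected_sum A g \<longleftrightarrow>
     smooth_manifold A \<and> riemannian_metric A g \<and>
     connected (UNIV :: 'm set) \<and> riemannian_complete A g \<and>
     (\<exists>K E\<^sub>1 E\<^sub>2. compact K \<and> has_smooth_boundary A K \<and>
        - K = E\<^sub>1 \<union> E\<^sub>2 \<and> E\<^sub>1 \<inter> E\<^sub>2 = {} \<and> open E\<^sub>1 \<and> open E\<^sub>2 \<and>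
        isometric_to_euclidean A g E\<^sub>1 (- cball 0 1) \<and>
        isometric_to_euclidean A g E\<^sub>2 (- cball 0 1))"

end

theory Submission
  imports Defs
begin

text \<open>Write \<open>q = np / (n - p)\<close> and \<open>\<gamma> = p (n - 1) / (n - p)\<close>, so that \<open>q (n - 1) = \<gamma> n\<close>. The
  inequality is proved piece by piece: \<open>M\<close> is covered by the two ends and finitely many coordinate
  cubes, and the integrals of \<open>|f|\<^sup>q\<close> over the pieces are added. The Gagliardo--Nirenberg argument
  works directly on both kinds of pieces, without cutting off \<open>f\<close> near their boundaries.

  That argument only uses integrals along coordinate lines. In dimension \<open>m + 1\<close>, if \<open>v\<^sup>m\<close> is at
  most the product over all coordinate directions of the integrals of \<open>G\<close> along the lines through
  the point, then \<open>(\<integral>v) ^ m \<le> (\<integral>G) ^ (m + 1)\<close> (\<open>nn_integral_power_le_lines\<close>). With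
  \<open>v = |f|\<^sup>q\<close> and \<open>G = \<gamma> |f| powr (\<gamma> - 1) * H\<close>, Hoelder's inequality turns this into a bound of the
  \<open>L\<^sup>q\<close> norm of \<open>f\<close> by the \<open>L\<^sup>p\<close> norm of \<open>H\<close>, whenever \<open>|f| powr \<gamma>\<close> is bounded at each point by the
  line integrals of \<open>G\<close> (\<open>sobolev_of_line_bounds\<close>). On the exterior of the unit ball one of the two
  half lines in each coordinate direction moves away from the origin, hence stays in the exterior,
  and \<open>f\<close> vanishes far out on it; so \<open>H = |\<nabla>f|\<close> will do whatever \<open>f\<close> does near the unit sphere
  (\<open>sobolev_exterior\<close>). On a cube, averaging over the line adds a term in \<open>|f|\<close> to \<open>H\<close>
  (\<open>sobolev_cube\<close>).

  Hence each end satisfies the full inequality by itself, and on cubes it remains to bound the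
  \<open>L\<^sup>p\<close> norm of \<open>f\<close> by that of \<open>\<nabla>f\<close>. Near the points of an end such a bound follows from the
  inequality of the end. It propagates: contracting a cube to a small neighbourhood of one of its
  points bounds the \<open>L\<^sup>p\<close> norm on the cube by the one on that neighbourhood and the gradient
  (\<open>poincare_contraction\<close>). So the set of points near which the bound holds is open and closed, and
  connectedness gives all of \<open>M\<close> (\<open>controlled_everywhere\<close>). Compactness of \<open>K\<close> leaves finitely
  many cubes.

  To use the Euclidean inequalities in a chart one compares gradients and measures
  (\<open>comparable_chart\<close>). On small cubes this is continuity of the metric coefficients. On the ends it
  needs two facts: the Riemannian measure is Lebesgue measure in the isometric coordinates
  (\<open>emeasure_end\<close>), and a compact subset of \<open>M\<close> meets an end in a set that is bounded in these
  coordinates (\<open>end_bounded_near\<close>).\<close>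

section \<open>Multilinear Hoelder inequality and the Loomis--Whitney argument\<close>

text \<open>The arithmetic-geometric mean inequality for the normalised factors \<open>k i / a i\<close>. It is linear in
  the \<open>k i\<close>, so that it can be integrated when \<open>a i\<close> is the integral of \<open>k i\<close>.\<close>
lemma power_le_amgm:
  fixes w C :: real and a k :: "'i \<Rightarrow> real"
  assumes T: "finite T" "T \<noteq> {}" and w: "0 \<le> w" and C: "0 \<le> C"
    and a: "\<And>i. i \<in> T \<Longrightarrow> 0 < a i" and k: "\<And>i. i \<in> T \<Longrightarrow> 0 \<le> k i"
    and le: "w ^ card T \<le> C * (\<Prod>i\<in>T. k i)"
  shows "w \<le> root (card T) (C * (\<Prod>i\<in>T. a i)) * (\<Sum>i\<in>T. k i / a i) / card T"
proof -
  let ?m = "card T" and ?D = "C * (\<Prod>i\<in>T. a i)"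
  have m: "?m > 0" using T by (simp add: card_gt_0_iff)
  have apos: "(\<Prod>i\<in>T. a i) > 0" using a by (intro prod_pos) auto
  have P0: "0 \<le> (\<Prod>i\<in>T. k i / a i)" using a k by (intro prod_nonneg ballI divide_nonneg_pos) auto
  have "w ^ ?m \<le> ?D * (\<Prod>i\<in>T. k i / a i)"
    using le apos by (simp add: prod_dividef)
  then have "root ?m (w ^ ?m) \<le> root ?m (?D * (\<Prod>i\<in>T. k i / a i))"
    using m by (simp add: real_root_le_mono)
  then have "w \<le> root ?m ?D * root ?m (\<Prod>i\<in>T. k i / a i)"
    using m w by (simp add: real_root_power_cancel real_root_mult)
  also have "root ?m (\<Prod>i\<in>T. k i / a i) = (\<Prod>i\<in>T. k i / a i) powr (1 / ?m)"
    using m P0 by (simp add: root_powr_inverse)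
  also have "\<dots> \<le> (\<Sum>i\<in>T. (k i / a i) / ?m)"
    using a k by (intro arith_geom_mean T divide_nonneg_pos)
  also have "\<dots> = (\<Sum>i\<in>T. k i / a i) / ?m" by (simp add: sum_divide_distrib)
  finally show ?thesis
    using C apos m by (simp add: mult_left_mono real_root_ge_zero)
qed

text \<open>Hoelder's inequality for \<open>card T\<close> factors with equal exponents. Natural powers in place of roots
  keep the statement meaningful when some of the integrals are infinite. If all of them are positive
  and finite, integrate the pointwise bound given by the arithmetic-geometric mean inequality.\<close>
lemma nn_integral_power_le_prod:
  fixes v :: "'a \<Rightarrow> ennreal" and h :: "'i \<Rightarrow> 'a \<Rightarrow> ennreal"
  assumes T: "finite T" "T \<noteq> {}"
    and v[measurable]: "v \<in> borel_measurable M"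
    and h[measurable]: "\<And>i. i \<in> T \<Longrightarrow> h i \<in> borel_measurable M"
    and le: "\<And>x. x \<in> space M \<Longrightarrow> v x ^ card T \<le> c * (\<Prod>i\<in>T. h i x)"
  shows "(\<integral>\<^sup>+x. v x \<partial>M) ^ card T \<le> c * (\<Prod>i\<in>T. \<integral>\<^sup>+x. h i x \<partial>M)"
proof -
  let ?m = "card T" and ?J = "\<lambda>i. \<integral>\<^sup>+x. h i x \<partial>M"
  have m: "?m > 0" using T by (simp add: card_gt_0_iff)
  consider (zero) "c = 0 \<or> (\<exists>i\<in>T. ?J i = 0)"
    | (top) "c \<noteq> 0" "\<forall>i\<in>T. ?J i \<noteq> 0" "c = \<infinity> \<or> (\<exists>i\<in>T. ?J i = \<infinity>)"
    | (fin) "c \<noteq> 0" "\<forall>i\<in>T. ?J i \<noteq> 0" "c \<noteq> \<infinity>" "\<forall>i\<in>T. ?J i \<noteq> \<infinity>" by blast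
  then show ?thesis
  proof cases
    case zero
    have "AE x in M. v x = 0"
    proof (cases "c = 0")
      case True
      have "v x = 0" if "x \<in> space M" for x using le[OF that] True m by simp
      then show ?thesis by (intro AE_I2)
    next
      case False
      then obtain i where i: "i \<in> T" "?J i = 0" using zero by auto
      then have "AE x in M. h i x = 0" by (subst (asm) nn_integral_0_iff_AE) auto
      then show ?thesis
      proof (rule AE_mp, intro AE_I2 impI)
        fix x assume x: "x \<in> space M" "h i x = 0"
        then have "(\<Prod>i\<in>T. h i x) = 0" using i T by (auto intro: prod_zero)
        with le[OF x(1)] have "v x ^ ?m \<le> c * 0" by (simp only:)
        then show "v x = 0" by simp
      qed
    qed
    then have "(\<integral>\<^sup>+x. v x \<partial>M) = 0" by (subst nn_integral_0_iff_AE) auto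
    then show ?thesis using m by (simp add: zero_power)
  next
    case top
    have "(\<Prod>i\<in>T. ?J i) \<noteq> 0" using top T by simp
    then have "c * (\<Prod>i\<in>T. ?J i) = \<infinity>"
    proof (cases "c = \<infinity>")
      case False
      then obtain i where i: "i \<in> T" "?J i = \<infinity>" using top by auto
      have "(\<Prod>i\<in>T. ?J i) = ?J i * (\<Prod>i\<in>T - {i}. ?J i)"
        using i T by (simp add: prod.remove)
      also have "\<dots> = \<infinity>" using i top T by (auto simp: ennreal_top_mult)
      finally show ?thesis using top by (simp add: ennreal_mult_top)
    qed (simp add: ennreal_top_mult)
    then show ?thesis by simp
  next
    case fin
    define C where "C = enn2real c"
    define a where "a i = enn2real (?J i)" for i
    have c: "c = ennreal C" using fin by (simp add: C_def less_top)
    have J: "?J i = ennreal (a i)" if "i \<in> T" for i using fin that by (simp add: a_def less_top)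
    have a: "a i > 0" if "i \<in> T" for i
      using fin(2) J[OF that] that by (cases "a i > 0") (auto simp: ennreal_eq_0_iff not_less)
    have C: "C \<ge> 0" by (simp add: C_def)
    have A: "AE x in M. \<forall>i\<in>T. h i x \<noteq> \<infinity>"
      using T by (intro AE_finite_allI nn_integral_noteq_infinite) (use fin in auto)
    define R where "R = root ?m (C * (\<Prod>i\<in>T. a i))"
    have R: "R \<ge> 0" unfolding R_def using C a m
      by (intro real_root_ge_zero mult_nonneg_nonneg prod_nonneg) (auto intro: less_imp_le)
    have "AE x in M. v x \<le> ennreal (R / ?m) * (\<Sum>i\<in>T. h i x * ennreal (1 / a i))"
      using A
    proof (rule AE_mp, intro AE_I2 impI)
      fix x assume x: "x \<in> space M" "\<forall>i\<in>T. h i x \<noteq> \<infinity>"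
      define k where "k i = enn2real (h i x)" for i
      have k: "h i x = ennreal (k i)" "0 \<le> k i" if "i \<in> T" for i
        using x that by (auto simp: k_def less_top)
      have p: "c * (\<Prod>i\<in>T. h i x) = ennreal (C * (\<Prod>i\<in>T. k i))"
        using k C by (simp add: c prod_ennreal ennreal_mult prod_nonneg)
      have "v x \<noteq> \<infinity>"
        using le[OF x(1)] m unfolding p by (auto simp: top_power_ennreal top_unique)
      then obtain w where w: "v x = ennreal w" "w \<ge> 0" by (cases "v x") auto
      have "w ^ ?m \<le> C * (\<Prod>i\<in>T. k i)"
        using le[OF x(1)] w k C unfolding p by (simp add: ennreal_power prod_nonneg)
      then have "w \<le> R * (\<Sum>i\<in>T. k i / a i) / ?m"
        unfolding R_def using power_le_amgm[OF T w(2) C a k(2)] by simp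
      then have "v x \<le> ennreal ((R / ?m) * (\<Sum>i\<in>T. k i * (1 / a i)))"
        unfolding w by (intro ennreal_leI) simp
      also have "\<dots> = ennreal (R / ?m) * (\<Sum>i\<in>T. h i x * ennreal (1 / a i))"
      proof -
        have "(\<Sum>i\<in>T. h i x * ennreal (1 / a i)) = (\<Sum>i\<in>T. ennreal (k i * (1 / a i)))"
          using k a by (intro sum.cong refl) (simp add: less_imp_le flip: ennreal_mult)
        also have "\<dots> = ennreal (\<Sum>i\<in>T. k i * (1 / a i))"
          using k a by (intro sum_ennreal) (auto intro!: divide_nonneg_pos)
        finally show ?thesis
          using R ennreal_mult'[of "R / ?m" "\<Sum>i\<in>T. k i * (1 / a i)"] by simp
      qed
      finally show "v x \<le> ennreal (R / ?m) * (\<Sum>i\<in>T. h i x * ennreal (1 / a i))" .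
    qed
    then have "(\<integral>\<^sup>+x. v x \<partial>M) \<le> (\<integral>\<^sup>+x. ennreal (R / ?m) * (\<Sum>i\<in>T. h i x * ennreal (1 / a i)) \<partial>M)"
      by (rule nn_integral_mono_AE)
    also have "\<dots> = ennreal (R / ?m) * (\<Sum>i\<in>T. ?J i * ennreal (1 / a i))"
      by (simp add: nn_integral_cmult nn_integral_sum nn_integral_multc)
    also have "(\<Sum>i\<in>T. ?J i * ennreal (1 / a i)) = (\<Sum>i\<in>T. 1)"
    proof (rule sum.cong[OF refl])
      fix i assume i: "i \<in> T"
      show "?J i * ennreal (1 / a i) = 1"
        unfolding J[OF i] using a[OF i] by (simp flip: ennreal_mult)
    qed
    also have "ennreal (R / ?m) * (\<Sum>i\<in>T. 1) = ennreal R"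
      using m R by (simp add: ennreal_of_nat_eq_real_of_nat flip: ennreal_mult')
    finally have "(\<integral>\<^sup>+x. v x \<partial>M) ^ ?m \<le> ennreal R ^ ?m" by (rule power_mono) simp
    also have "\<dots> = ennreal (C * (\<Prod>i\<in>T. a i))"
      using R C a m by (simp add: ennreal_power R_def real_root_pow_pos2 prod_nonneg less_imp_le)
    also have "\<dots> = c * (\<Prod>i\<in>T. ?J i)"
      using a C J by (simp add: c ennreal_mult prod_nonneg less_imp_le flip: prod_ennreal)
    finally show ?thesis .
  qed
qed

text \<open>Adding one coordinate \<open>j\<close> at a time: for a fixed value of this coordinate, the line integral
  of \<open>F j\<close> in direction \<open>j\<close> is a function of the remaining coordinates only and joins the factors
  which are not integrated over a line. Thus the number of factors stays \<open>m + 1\<close>, and in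
  the final integration over coordinate \<open>j\<close> the factor with index \<open>j\<close> is a constant, which leaves \<open>m\<close>
  factors for Hoelder's inequality. This bookkeeping is why the family \<open>F\<close> is indexed by a set \<open>T\<close>
  that may be larger than \<open>I\<close>.\<close>
lemma (in product_sigma_finite) nn_integral_prod_line_integrals_le:
  fixes F :: "'i \<Rightarrow> ('i \<Rightarrow> 'a) \<Rightarrow> ennreal"
  assumes T: "finite T" "card T = Suc m" "m \<ge> 1"
    and "finite I" "I \<subseteq> T"
    and "v \<in> borel_measurable (Pi\<^sub>M I M)"
    and "\<And>i. i \<in> T \<Longrightarrow> F i \<in> borel_measurable (Pi\<^sub>M I M)"
    and "\<And>x. x \<in> space (Pi\<^sub>M I M) \<Longrightarrow>
      v x ^ m \<le> (\<Prod>i\<in>I. \<integral>\<^sup>+t. F i (x(i := t)) \<partial>M i) * (\<Prod>i\<in>T - I. F i x)"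
  shows "(\<integral>\<^sup>+x. v x \<partial>Pi\<^sub>M I M) ^ m \<le> (\<Prod>i\<in>T. \<integral>\<^sup>+x. F i x \<partial>Pi\<^sub>M I M)"
  using assms(4-)
proof (induction I arbitrary: v F rule: finite_induct)
  case empty
  show ?case
    using empty.prems(4)[of "\<lambda>_. undefined"]
    by (simp add: space_PiM PiM_empty nn_integral_count_space_finite)
next
  case (insert j I)
  note vm[measurable] = insert.prems(2) and Fm[measurable] = insert.prems(3)
  interpret I: finite_product_sigma_finite M I by standard (rule insert.hyps)
  have jT: "j \<in> T" and IT: "I \<subseteq> T - {j}" using insert by auto
  define F' where "F' t i = (if i = j then (\<lambda>x. \<integral>\<^sup>+s. F j (x(j := s)) \<partial>M j) else (\<lambda>x. F i (x(j := t))))" for t i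
  have upd[measurable]: "(\<lambda>(x, s). x(j := s)) \<in> measurable (Pi\<^sub>M I M \<Otimes>\<^sub>M M j) (Pi\<^sub>M (insert j I) M)"
    by (rule measurable_add_dim)
  have upd1[measurable]: "(\<lambda>x. x(j := t)) \<in> measurable (Pi\<^sub>M I M) (Pi\<^sub>M (insert j I) M)"
    if "t \<in> space (M j)" for t
    using measurable_compose[OF _ upd, of "\<lambda>x. (x, t)" "Pi\<^sub>M I M"] that by simp
  have Fj[measurable]: "(\<lambda>x. \<integral>\<^sup>+s. F j (x(j := s)) \<partial>M j) \<in> borel_measurable (Pi\<^sub>M I M)"
    using measurable_compose[OF upd Fm[OF jT]]
    by (intro sigma_finite_measure.borel_measurable_nn_integral[OF sigma_finite_measures])
      (simp add: case_prod_beta' del: fun_upd_apply)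
  have IH: "(\<integral>\<^sup>+x. v (x(j := t)) \<partial>Pi\<^sub>M I M) ^ m \<le> (\<Prod>i\<in>T. \<integral>\<^sup>+x. F' t i x \<partial>Pi\<^sub>M I M)"
    if t: "t \<in> space (M j)" for t
  proof (rule insert.IH)
    show "I \<subseteq> T" using insert by auto
    show "(\<lambda>x. v (x(j := t))) \<in> borel_measurable (Pi\<^sub>M I M)"
      using measurable_compose[OF upd1[OF t] vm] .
    show "F' t i \<in> borel_measurable (Pi\<^sub>M I M)" if "i \<in> T" for i
      unfolding F'_def using measurable_compose[OF upd1[OF t] Fm[OF that]] Fj
      by (auto simp del: fun_upd_apply)
    fix x assume x: "x \<in> space (Pi\<^sub>M I M)"
    have xt: "x(j := t) \<in> space (Pi\<^sub>M (insert j I) M)"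
      using x t insert.hyps by (auto simp: space_PiM PiE_iff extensional_def)
    have "v (x(j := t)) ^ m \<le> (\<Prod>i\<in>insert j I. \<integral>\<^sup>+s. F i ((x(j := t))(i := s)) \<partial>M i) * (\<Prod>i\<in>T - insert j I. F i (x(j := t)))"
      by (rule insert.prems(4)[OF xt])
    also have "(\<Prod>i\<in>insert j I. \<integral>\<^sup>+s. F i ((x(j := t))(i := s)) \<partial>M i)
        = F' t j x * (\<Prod>i\<in>I. \<integral>\<^sup>+s. F' t i (x(i := s)) \<partial>M i)"
    proof -
      have "(\<Prod>i\<in>I. \<integral>\<^sup>+s. F i ((x(j := t))(i := s)) \<partial>M i) = (\<Prod>i\<in>I. \<integral>\<^sup>+s. F' t i (x(i := s)) \<partial>M i)"
        using insert.hyps by (intro prod.cong refl) (auto simp: F'_def fun_upd_twist)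
      then show ?thesis using insert.hyps by (simp add: F'_def)
    qed
    also have "(\<Prod>i\<in>T - insert j I. F i (x(j := t))) = (\<Prod>i\<in>T - I - {j}. F' t i x)"
      by (rule prod.cong) (auto simp: F'_def)
    also have "F' t j x * (\<Prod>i\<in>I. \<integral>\<^sup>+s. F' t i (x(i := s)) \<partial>M i) * (\<Prod>i\<in>T - I - {j}. F' t i x)
       = (\<Prod>i\<in>I. \<integral>\<^sup>+s. F' t i (x(i := s)) \<partial>M i) * (\<Prod>i\<in>T - I. F' t i x)"
      using T jT insert.hyps prod.remove[of "T - I" j "\<lambda>i. F' t i x"] by (simp add: mult_ac)
    finally show "v (x(j := t)) ^ m \<le> (\<Prod>i\<in>I. \<integral>\<^sup>+s. F' t i (x(i := s)) \<partial>M i) * (\<Prod>i\<in>T - I. F' t i x)" .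
  qed
  have Tj: "card (T - {j}) = m" "finite (T - {j})" using T jT by auto
  then have Tj': "T - {j} \<noteq> {}" using T(3) by (metis card.empty not_one_le_zero)
  have jI: "j \<notin> I" by (rule insert.hyps)
  have swap: "(\<integral>\<^sup>+x. f x \<partial>Pi\<^sub>M (insert j I) M) = (\<integral>\<^sup>+t. (\<integral>\<^sup>+x. f (x(j := t)) \<partial>Pi\<^sub>M I M) \<partial>M j)"
    if "f \<in> borel_measurable (Pi\<^sub>M (insert j I) M)" for f
    using insert.hyps that by (rule product_nn_integral_insert_rev)
  have slice[measurable]: "(\<lambda>t. \<integral>\<^sup>+x. f (x(j := t)) \<partial>Pi\<^sub>M I M) \<in> borel_measurable (M j)"
    if "f \<in> borel_measurable (Pi\<^sub>M (insert j I) M)" for f :: "_ \<Rightarrow> ennreal"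
  proof (rule I.borel_measurable_nn_integral)
    have "(\<lambda>(t, x). x(j := t)) = (\<lambda>(x, t). x(j := t)) \<circ> (\<lambda>(t, x). (x, t))" by auto
    then have "(\<lambda>(t, x). x(j := t)) \<in> measurable (M j \<Otimes>\<^sub>M Pi\<^sub>M I M) (Pi\<^sub>M (insert j I) M)"
      using measurable_comp[OF measurable_pair_swap' upd] by (simp add: case_prod_beta')
    from measurable_compose[OF this that]
    show "(\<lambda>(t, x). f (x(j := t))) \<in> borel_measurable (M j \<Otimes>\<^sub>M Pi\<^sub>M I M)"
      by (simp add: case_prod_beta')
  qed
  have "(\<integral>\<^sup>+t. (\<integral>\<^sup>+x. v (x(j := t)) \<partial>Pi\<^sub>M I M) \<partial>M j) ^ card (T - {j})
      \<le> (\<integral>\<^sup>+x. F j x \<partial>Pi\<^sub>M (insert j I) M) *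
        (\<Prod>i\<in>T - {j}. \<integral>\<^sup>+t. (\<integral>\<^sup>+x. F i (x(j := t)) \<partial>Pi\<^sub>M I M) \<partial>M j)"
  proof (rule nn_integral_power_le_prod)
    show "(\<integral>\<^sup>+x. v (x(j := t)) \<partial>Pi\<^sub>M I M) ^ card (T - {j})
      \<le> (\<integral>\<^sup>+x. F j x \<partial>Pi\<^sub>M (insert j I) M) * (\<Prod>i\<in>T - {j}. \<integral>\<^sup>+x. F i (x(j := t)) \<partial>Pi\<^sub>M I M)"
      if "t \<in> space (M j)" for t
    proof -
      have "(\<Prod>i\<in>T. \<integral>\<^sup>+x. F' t i x \<partial>Pi\<^sub>M I M) =
        (\<integral>\<^sup>+x. F' t j x \<partial>Pi\<^sub>M I M) * (\<Prod>i\<in>T - {j}. \<integral>\<^sup>+x. F' t i x \<partial>Pi\<^sub>M I M)"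
        using T jT by (simp add: prod.remove)
      also have "(\<integral>\<^sup>+x. F' t j x \<partial>Pi\<^sub>M I M) = (\<integral>\<^sup>+x. F j x \<partial>Pi\<^sub>M (insert j I) M)"
        using product_nn_integral_insert[OF insert.hyps Fm[OF jT]]
        by (simp add: F'_def del: fun_upd_apply)
      also have "(\<Prod>i\<in>T - {j}. \<integral>\<^sup>+x. F' t i x \<partial>Pi\<^sub>M I M) = (\<Prod>i\<in>T - {j}. \<integral>\<^sup>+x. F i (x(j := t)) \<partial>Pi\<^sub>M I M)"
        by (rule prod.cong) (auto simp: F'_def)
      finally show ?thesis using IH[OF that] by (simp add: Tj)
    qed
  qed (use Tj Tj' slice vm Fm in auto)
  also have "\<dots> = (\<Prod>i\<in>T. \<integral>\<^sup>+x. F i x \<partial>Pi\<^sub>M (insert j I) M)"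
    using T jT Fm by (simp add: prod.remove swap)
  finally show ?case unfolding swap[OF vm] by (simp add: Tj)
qed

text \<open>The Loomis--Whitney type inequality behind the Sobolev inequality for \<open>p = 1\<close>: take
  all factors equal to \<open>G\<close> and let all coordinates be integrated.\<close>
theorem nn_integral_power_le_lines:
  fixes v G :: "'a::euclidean_space \<Rightarrow> ennreal"
  assumes dim: "DIM('a) = Suc m" "m \<ge> 1"
    and v[measurable]: "v \<in> borel_measurable borel" and G[measurable]: "G \<in> borel_measurable borel"
    and le: "\<And>x. v x ^ m \<le> (\<Prod>b\<in>Basis. \<integral>\<^sup>+t. G (x + t *\<^sub>R b) \<partial>lborel)"
  shows "(\<integral>\<^sup>+x. v x \<partial>lborel) ^ m \<le> (\<integral>\<^sup>+x. G x \<partial>lborel) ^ Suc m"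
proof -
  interpret product_sigma_finite "\<lambda>_::'a. lborel :: real measure" by standard
  let ?\<iota> = "\<lambda>f. \<Sum>b\<in>Basis. f b *\<^sub>R b :: 'a" and ?P = "Pi\<^sub>M Basis (\<lambda>_::'a. lborel :: real measure)"
  have \<iota>[measurable]: "?\<iota> \<in> measurable ?P borel" by measurable
  have line: "(\<integral>\<^sup>+t. G (?\<iota> (y(b := t))) \<partial>lborel) = (\<integral>\<^sup>+t. G (?\<iota> y + t *\<^sub>R b) \<partial>lborel)"
    if b: "b \<in> Basis" for y b
  proof -
    have *: "?\<iota> (y(b := t)) = ?\<iota> y + (t - y b) *\<^sub>R b" for t
    proof -
      have "?\<iota> (y(b := t)) = t *\<^sub>R b + (\<Sum>c\<in>Basis - {b}. y c *\<^sub>R c)"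
        using b by (simp add: sum.remove[of Basis b])
      moreover have "?\<iota> y = y b *\<^sub>R b + (\<Sum>c\<in>Basis - {b}. y c *\<^sub>R c)"
        using b by (simp add: sum.remove[of Basis b])
      ultimately show ?thesis by (simp add: algebra_simps)
    qed
    have "(\<integral>\<^sup>+t. G (?\<iota> y + t *\<^sub>R b) \<partial>lborel) = (\<integral>\<^sup>+t. G (?\<iota> y + (- y b + 1 * t) *\<^sub>R b) \<partial>lborel)"
      by (subst nn_integral_real_affine[where c=1 and t="- y b"]) auto
    then show ?thesis by (simp only: *) simp
  qed
  have "(\<integral>\<^sup>+y. v (?\<iota> y) \<partial>?P) ^ m \<le> (\<Prod>b\<in>(Basis :: 'a set). \<integral>\<^sup>+y. G (?\<iota> y) \<partial>?P)"
  proof (rule nn_integral_prod_line_integrals_le[where F = "\<lambda>_ y. G (?\<iota> y)"])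
    fix y assume "y \<in> space ?P"
    have "v (?\<iota> y) ^ m \<le> (\<Prod>b\<in>Basis. \<integral>\<^sup>+t. G (?\<iota> y + t *\<^sub>R b) \<partial>lborel)" by (rule le)
    also have "\<dots> = (\<Prod>b\<in>Basis. \<integral>\<^sup>+t. G (?\<iota> (y(b := t))) \<partial>lborel) * (\<Prod>b\<in>Basis - Basis. G (?\<iota> y))"
      using line[of _ y] by (simp cong: prod.cong)
    finally show "v (?\<iota> y) ^ m \<le> (\<Prod>b\<in>Basis. \<integral>\<^sup>+t. G (?\<iota> (y(b := t))) \<partial>lborel) * (\<Prod>b\<in>Basis - Basis. G (?\<iota> y))" .
  qed (use dim in auto)
  then show ?thesis
    unfolding lborel_eq[where 'a='a] by (simp add: nn_integral_distr dim)
qed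

section \<open>Functions whose derivative is dominated by a continuous function\<close>

text \<open>Continuity is asked of the bound \<open>N\<close> and not of the derivative: for a function on a manifold, read
  in a chart, \<open>N\<close> will be a multiple of the Riemannian gradient norm, which is continuous.\<close>
definition upper_gradient :: "'a::real_normed_vector set \<Rightarrow> ('a \<Rightarrow> real) \<Rightarrow> ('a \<Rightarrow> real) \<Rightarrow> bool" where
  "upper_gradient S f N \<longleftrightarrow> continuous_on S N \<and>
     (\<forall>x\<in>S. 0 \<le> N x \<and> (\<exists>f'. (f has_derivative f') (at x) \<and> (\<forall>v. \<bar>f' v\<bar> \<le> N x * norm v)))"

lemma upper_gradient_continuous_on:
  assumes "upper_gradient S f N" shows "continuous_on S f"
  using assms unfolding upper_gradient_def
  by (meson continuous_at_imp_continuous_on has_derivative_continuous)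

lemma upper_gradient_compose:
  assumes f: "upper_gradient S f N"
    and h: "\<And>s. (h has_real_derivative h' s) (at s)" and h': "continuous_on UNIV h'"
  shows "upper_gradient S (\<lambda>x. h (f x)) (\<lambda>x. \<bar>h' (f x)\<bar> * N x)"
  unfolding upper_gradient_def
proof (intro conjI ballI)
  show "continuous_on S (\<lambda>x. \<bar>h' (f x)\<bar> * N x)"
    using upper_gradient_continuous_on[OF f] f h'
    by (auto simp: upper_gradient_def intro!: continuous_intros continuous_on_compose2[OF h'])
  fix x assume x: "x \<in> S"
  then obtain f' where f': "(f has_derivative f') (at x)" "\<And>v. \<bar>f' v\<bar> \<le> N x * norm v" and N: "0 \<le> N x"
    using f by (auto simp: upper_gradient_def)
  show "0 \<le> \<bar>h' (f x)\<bar> * N x" using N by simp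
  have "((\<lambda>x. h (f x)) has_derivative (\<lambda>v. f' v * h' (f x))) (at x)"
    by (rule has_derivative_eq_rhs[OF DERIV_compose_FDERIV[OF h f'(1)]]) auto
  moreover have "\<bar>f' v * h' (f x)\<bar> \<le> \<bar>h' (f x)\<bar> * N x * norm v" for v
    using mult_left_mono[OF f'(2)[of v], of "\<bar>h' (f x)\<bar>"] by (simp add: abs_mult mult_ac)
  ultimately show "\<exists>F. ((\<lambda>x. h (f x)) has_derivative F) (at x) \<and> (\<forall>v. \<bar>F v\<bar> \<le> \<bar>h' (f x)\<bar> * N x * norm v)"
    by blast
qed

text \<open>The derivative need only exist: it is integrable in the sense of Henstock and Kurzweil, with the
  increment as its integral, and the integral of the continuous bound \<open>n\<close> is a Lebesgue integral.\<close>
lemma increment_le_nn_integral: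
  fixes \<phi> n :: "real \<Rightarrow> real"
  assumes ab: "a \<le> b" and n: "continuous_on {a..b} n"
    and d: "\<And>t. t \<in> {a..b} \<Longrightarrow> \<exists>d. (\<phi> has_real_derivative d) (at t within {a..b}) \<and> \<bar>d\<bar> \<le> n t"
  shows "ennreal \<bar>\<phi> b - \<phi> a\<bar> \<le> (\<integral>\<^sup>+t. ennreal (n t) * indicator {a..b} t \<partial>lborel)"
proof -
  obtain \<phi>' where \<phi>': "\<And>t. t \<in> {a..b} \<Longrightarrow> (\<phi> has_real_derivative \<phi>' t) (at t within {a..b})"
      "\<And>t. t \<in> {a..b} \<Longrightarrow> \<bar>\<phi>' t\<bar> \<le> n t"
    using d by metis
  have 1: "(\<phi>' has_integral (\<phi> b - \<phi> a)) {a..b}"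
    using ab \<phi>'(1) by (intro fundamental_theorem_of_calculus)
      (auto simp: has_real_derivative_iff_has_vector_derivative)
  have 2: "(n has_integral integral {a..b} n) {a..b}"
    using n by (simp add: integrable_continuous_real integrable_integral)
  have "norm (\<phi> b - \<phi> a) \<le> integral {a..b} n"
    using 1 2 \<phi>'(2) by (metis integral_norm_bound_integral has_integral_integrable integral_unique real_norm_def)
  also have "ennreal (integral {a..b} n) = (\<integral>\<^sup>+t. ennreal (n t) * indicator {a..b} t \<partial>lborel)"
    using \<phi>'(2) by (intro nn_integral_has_integral_lebesgue'[symmetric] 2) (metis abs_ge_zero order_trans)
  finally show ?thesis by (simp add: ennreal_leI)
qed

lemma upper_gradient_increment:
  fixes f :: "'a::real_normed_vector \<Rightarrow> real"
  assumes f: "upper_gradient S f N" and ab: "a \<le> b"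
    and S: "\<And>t. t \<in> {a..b} \<Longrightarrow> x + t *\<^sub>R v \<in> S"
  shows "ennreal \<bar>f (x + b *\<^sub>R v) - f (x + a *\<^sub>R v)\<bar> \<le>
    (\<integral>\<^sup>+t. ennreal (N (x + t *\<^sub>R v) * norm v) * indicator {a..b} t \<partial>lborel)"
proof (rule increment_le_nn_integral[OF ab])
  show "continuous_on {a..b} (\<lambda>t. N (x + t *\<^sub>R v) * norm v)"
    using f S by (auto simp: upper_gradient_def intro!: continuous_intros continuous_on_compose2[of S N])
  fix t assume t: "t \<in> {a..b}"
  obtain f' where f': "(f has_derivative f') (at (x + t *\<^sub>R v))" "\<And>w. \<bar>f' w\<bar> \<le> N (x + t *\<^sub>R v) * norm w"
    using f S[OF t] by (auto simp: upper_gradient_def)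
  have "((\<lambda>t. f (x + t *\<^sub>R v)) has_derivative (\<lambda>h. f' (h *\<^sub>R v))) (at t within {a..b})"
    by (rule has_derivative_compose[of "\<lambda>t. x + t *\<^sub>R v" "\<lambda>h. h *\<^sub>R v" t "{a..b}" f f', OF _ f'(1)])
      (auto intro!: derivative_eq_intros)
  moreover have "(\<lambda>h. f' (h *\<^sub>R v)) = (*) (f' v)"
    using has_derivative_linear[OF f'(1)] by (auto simp: linear_cmul)
  ultimately show "\<exists>d. ((\<lambda>t. f (x + t *\<^sub>R v)) has_real_derivative d) (at t within {a..b}) \<and> \<bar>d\<bar> \<le> N (x + t *\<^sub>R v) * norm v"
    using f'(2) by (auto simp: has_field_derivative_def)
qed

section \<open>Signed powers\<close>

text \<open>Unlike \<open>|s| powr \<gamma>\<close>, the signed power is continuously differentiable also for \<open>\<gamma> = 1\<close>, which is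
  the case \<open>p = 1\<close>.\<close>
definition spow :: "real \<Rightarrow> real \<Rightarrow> real" where
  "spow \<gamma> s = sgn s * \<bar>s\<bar> powr \<gamma>"

text \<open>The derivative of \<open>spow\<close>. The case distinction is due to the convention \<open>0 powr 0 = 0\<close>.\<close>
definition dpow :: "real \<Rightarrow> real \<Rightarrow> real" where
  "dpow \<gamma> s = (if \<gamma> = 1 then 1 else \<gamma> * \<bar>s\<bar> powr (\<gamma> - 1))"

lemma abs_spow: "\<bar>spow \<gamma> s\<bar> = \<bar>s\<bar> powr \<gamma>"
  by (simp add: spow_def abs_mult sgn_if)

lemma dpow_nonneg: "1 \<le> \<gamma> \<Longrightarrow> 0 \<le> dpow \<gamma> s"
  by (simp add: dpow_def)

lemma continuous_dpow: "1 \<le> \<gamma> \<Longrightarrow> continuous_on UNIV (dpow \<gamma>)"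
  unfolding dpow_def by (cases "\<gamma> = 1") (auto intro!: continuous_intros continuous_on_powr')

lemma powr_le_dpow: "1 \<le> \<gamma> \<Longrightarrow> \<bar>s\<bar> powr \<gamma> \<le> dpow \<gamma> s * \<bar>s\<bar>"
proof (cases "s = 0")
  case False
  assume \<gamma>: "1 \<le> \<gamma>"
  have "\<bar>s\<bar> powr \<gamma> = \<bar>s\<bar> powr (\<gamma> - 1) * \<bar>s\<bar>"
    using False powr_add[of "\<bar>s\<bar>" "\<gamma> - 1" 1] by simp
  also have "\<dots> \<le> dpow \<gamma> s * \<bar>s\<bar>"
    using \<gamma> False by (intro mult_right_mono) (auto simp: dpow_def mult_le_cancel_right1)
  finally show ?thesis .
qed simp

lemma spow_has_derivative:
  assumes \<gamma>: "1 \<le> \<gamma>"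
  shows "(spow \<gamma> has_real_derivative dpow \<gamma> s) (at s)"
proof (cases "\<gamma> = 1")
  case True
  have "spow \<gamma> = (\<lambda>s. s)" by (rule ext) (simp add: spow_def True sgn_mult_abs)
  then show ?thesis using True by (simp add: dpow_def)
next
  case g: False
  consider "s > 0" | "s < 0" | "s = 0" by linarith
  then show ?thesis
  proof cases
    case 1
    have "((\<lambda>s. s powr \<gamma>) has_real_derivative dpow \<gamma> s) (at s)"
      using 1 g by (auto simp: dpow_def intro!: derivative_eq_intros)
    then show ?thesis
      by (rule has_field_derivative_transform_within_open[where S="{0<..}"]) (use 1 in \<open>auto simp: spow_def\<close>)
  next
    case 2
    have "((\<lambda>s. - ((-s) powr \<gamma>)) has_real_derivative dpow \<gamma> s) (at s)"
      using 2 g by (auto simp: dpow_def intro!: derivative_eq_intros)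
    then show ?thesis
      by (rule has_field_derivative_transform_within_open[where S="{..<0}"]) (use 2 in \<open>auto simp: spow_def\<close>)
  next
    case 3
    have "((\<lambda>h. \<bar>h\<bar> powr (\<gamma> - 1)) \<longlongrightarrow> 0) (at 0)"
      using \<gamma> g by (auto intro!: tendsto_eq_intros tendsto_zero_powrI[where b="\<gamma> - 1"] tendsto_rabs_zero)
    then have "((\<lambda>h. (spow \<gamma> (0 + h) - spow \<gamma> 0) / h) \<longlongrightarrow> 0) (at 0)"
    proof (rule Lim_transform_eventually)
      show "\<forall>\<^sub>F h in at 0. \<bar>h\<bar> powr (\<gamma> - 1) = (spow \<gamma> (0 + h) - spow \<gamma> 0) / h"
        using eventually_neq_at_within[of 0]
      proof eventually_elim
        case (elim h)
        have "\<bar>h\<bar> powr \<gamma> = \<bar>h\<bar> powr (\<gamma> - 1) * \<bar>h\<bar>"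
          using elim powr_add[of "\<bar>h\<bar>" "\<gamma> - 1" 1] by simp
        then show ?case using elim by (simp add: spow_def sgn_if abs_if)
      qed
    qed
    then show ?thesis using 3 g by (simp add: DERIV_def dpow_def)
  qed
qed

section \<open>The Hoelder inequality\<close>

text \<open>Hoelder's inequality with conjugate exponents \<open>1 / \<theta>\<close> and \<open>1 / (1 - \<theta>)\<close>, with given real bounds
  for the two integrals, so that no integral occurs as the argument of a real power.\<close>
lemma nn_integral_powr_Holder:
  fixes X Y :: "'a \<Rightarrow> real"
  assumes [measurable]: "X \<in> borel_measurable M" "Y \<in> borel_measurable M"
    and nn: "\<And>x. x \<in> space M \<Longrightarrow> 0 \<le> X x" "\<And>x. x \<in> space M \<Longrightarrow> 0 \<le> Y x"
    and \<theta>: "0 < \<theta>" "\<theta> < 1" and ab: "0 \<le> a" "0 \<le> b"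
    and X: "(\<integral>\<^sup>+x. X x \<partial>M) \<le> ennreal a" and Y: "(\<integral>\<^sup>+x. Y x \<partial>M) \<le> ennreal b"
  shows "(\<integral>\<^sup>+x. X x powr \<theta> * Y x powr (1 - \<theta>) \<partial>M) \<le> ennreal (a powr \<theta> * b powr (1 - \<theta>))"
proof (cases "a = 0 \<or> b = 0")
  case True
  then have "(AE x in M. X x = 0) \<or> (AE x in M. Y x = 0)"
  proof
    assume "a = 0"
    then have "AE x in M. ennreal (X x) = 0" using X nn_integral_0_iff_AE[of "\<lambda>x. ennreal (X x)" M] by simp
    then have "AE x in M. X x = 0" by (rule AE_mp) (intro AE_I2 impI, use nn in \<open>auto simp: ennreal_eq_0_iff intro: antisym\<close>)
    then show ?thesis by simp
  next
    assume "b = 0"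
    then have "AE x in M. ennreal (Y x) = 0" using Y nn_integral_0_iff_AE[of "\<lambda>x. ennreal (Y x)" M] by simp
    then have "AE x in M. Y x = 0" by (rule AE_mp) (intro AE_I2 impI, use nn in \<open>auto simp: ennreal_eq_0_iff intro: antisym\<close>)
    then show ?thesis by simp
  qed
  then have "AE x in M. ennreal (X x powr \<theta> * Y x powr (1 - \<theta>)) = 0" by auto
  then have "(\<integral>\<^sup>+x. X x powr \<theta> * Y x powr (1 - \<theta>) \<partial>M) = 0" by (subst nn_integral_0_iff_AE) auto
  then show ?thesis by simp
next
  case False
  then have pos: "a > 0" "b > 0" using ab by auto
  let ?R = "a powr \<theta> * b powr (1 - \<theta>)"
  have pt: "X x powr \<theta> * Y x powr (1 - \<theta>) \<le> ?R * (\<theta> / a * X x + (1 - \<theta>) / b * Y x)" if x: "x \<in> space M" for x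
  proof (cases "X x = 0 \<or> Y x = 0")
    case True
    then show ?thesis using nn[OF x] pos \<theta> by (auto intro!: mult_nonneg_nonneg add_nonneg_nonneg)
  next
    case False
    then have XY: "X x > 0" "Y x > 0" using nn[OF x] by auto
    have "X x powr \<theta> * Y x powr (1 - \<theta>) = ?R * ((X x / a) powr \<theta> * (Y x / b) powr (1 - \<theta>))"
      using XY pos by (simp add: powr_divide)
    also have "(X x / a) powr \<theta> * (Y x / b) powr (1 - \<theta>) \<le> \<theta> * (X x / a) + (1 - \<theta>) * (Y x / b)"
      using \<theta> XY pos by (intro Youngs_inequality_0) auto
    finally show ?thesis using pos by (simp add: mult_left_mono)
  qed
  have coeff: "0 \<le> ?R * (\<theta> / a)" "0 \<le> ?R * ((1 - \<theta>) / b)" using \<theta> pos by auto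
  have "(\<integral>\<^sup>+x. X x powr \<theta> * Y x powr (1 - \<theta>) \<partial>M)
      \<le> (\<integral>\<^sup>+x. ennreal (?R * (\<theta> / a)) * X x + ennreal (?R * ((1 - \<theta>) / b)) * Y x \<partial>M)"
  proof (rule nn_integral_mono)
    fix x assume x: "x \<in> space M"
    have "ennreal (X x powr \<theta> * Y x powr (1 - \<theta>)) \<le> ennreal (?R * (\<theta> / a) * X x + ?R * ((1 - \<theta>) / b) * Y x)"
      using pt[OF x] by (intro ennreal_leI) (simp add: algebra_simps)
    also have "\<dots> = ennreal (?R * (\<theta> / a)) * X x + ennreal (?R * ((1 - \<theta>) / b)) * Y x"
      using nn[OF x] coeff by (simp only: ennreal_plus ennreal_mult'' mult_nonneg_nonneg)
    finally show "ennreal (X x powr \<theta> * Y x powr (1 - \<theta>)) \<le> \<dots>" .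
  qed
  also have "\<dots> = ennreal (?R * (\<theta> / a)) * (\<integral>\<^sup>+x. X x \<partial>M) + ennreal (?R * ((1 - \<theta>) / b)) * (\<integral>\<^sup>+x. Y x \<partial>M)"
    by (simp add: nn_integral_add nn_integral_cmult)
  also have "\<dots> \<le> ennreal (?R * (\<theta> / a)) * ennreal a + ennreal (?R * ((1 - \<theta>) / b)) * ennreal b"
    by (intro add_mono mult_left_mono X Y) auto
  also have "\<dots> = ennreal (?R * (\<theta> / a) * a + ?R * ((1 - \<theta>) / b) * b)"
    using \<theta> pos by (simp add: ennreal_mult[symmetric] ennreal_plus[symmetric] del: ennreal_plus)
  also have "?R * (\<theta> / a) * a + ?R * ((1 - \<theta>) / b) * b = ?R"
    using pos by (simp add: field_simps)
  finally show ?thesis .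
qed

section \<open>Sobolev inequalities on subsets of Euclidean space\<close>

text \<open>Let \<open>a\<close> be the integral of \<open>|f|\<^sup>q\<close>. Loomis--Whitney gives \<open>a ^ m \<le> (\<integral>G) ^ (m + 1)\<close>,
  where \<open>G\<close> is \<open>H\<close> times the derivative of the signed power, and Hoelder
  bounds \<open>\<integral>G\<close> by \<open>\<gamma>\<close> times a power of \<open>a\<close> times the \<open>L\<^sup>p\<close> norm of \<open>H\<close>. The exponent of \<open>a\<close> on the
  right is the smaller one, so dividing (here the finiteness of \<open>a\<close> enters) gives the claim.\<close>
lemma sobolev_of_line_bounds:
  fixes f H :: "'a::euclidean_space \<Rightarrow> real" and p :: real
  defines "n \<equiv> real (DIM('a))"
  defines "\<gamma> \<equiv> p * (n - 1) / (n - p)" and "q \<equiv> n * p / (n - p)"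
  assumes dim: "2 \<le> DIM('a)" and p: "1 \<le> p" "p < n"
    and S[measurable]: "S \<in> sets borel"
    and f: "continuous_on S f" and H: "continuous_on S H" and H0: "\<And>x. x \<in> S \<Longrightarrow> 0 \<le> H x"
    and le: "\<And>x b. x \<in> S \<Longrightarrow> b \<in> Basis \<Longrightarrow> ennreal (\<bar>f x\<bar> powr \<gamma>) \<le>
      (\<integral>\<^sup>+t. ennreal (dpow \<gamma> (f (x + t *\<^sub>R b)) * H (x + t *\<^sub>R b)) * indicator S (x + t *\<^sub>R b) \<partial>lborel)"
    and fin: "(\<integral>\<^sup>+x\<in>S. ennreal (\<bar>f x\<bar> powr q) \<partial>lborel) < \<infinity>"
    and B: "0 \<le> B" "(\<integral>\<^sup>+x\<in>S. ennreal (H x powr p) \<partial>lborel) \<le> ennreal B"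
  shows "(\<integral>\<^sup>+x\<in>S. ennreal (\<bar>f x\<bar> powr q) \<partial>lborel) \<le> ennreal (\<gamma> powr q * B powr (q / p))"
proof -
  obtain m where m: "DIM('a) = Suc m" "m \<ge> 1" using dim by (cases "DIM('a)") auto
  have n: "n = real m + 1" by (simp add: n_def m)
  have \<gamma>: "1 \<le> \<gamma>" using p m by (simp add: \<gamma>_def n field_simps) (use mult_right_mono[of 1 p "real m + 1"] in \<open>auto simp: algebra_simps\<close>)
  have q: "q > 0" using p m by (simp add: q_def n)
  have fS[measurable]: "(\<lambda>x. indicator S x * f x) \<in> borel_measurable borel"
    using borel_measurable_continuous_on_indicator[OF S f] by simp
  have HS[measurable]: "(\<lambda>x. indicator S x * H x) \<in> borel_measurable borel"
    using borel_measurable_continuous_on_indicator[OF S H] by simp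
  have dm[measurable]: "dpow \<gamma> \<in> borel_measurable borel"
    using continuous_dpow[OF \<gamma>] by (rule borel_measurable_continuous_onI)
  define v where "v x = ennreal (\<bar>f x\<bar> powr q) * indicator S x" for x
  define G where "G x = ennreal (dpow \<gamma> (f x) * H x) * indicator S x" for x
  have v': "v = (\<lambda>x. ennreal (\<bar>indicator S x * f x\<bar> powr q))"
    by (auto simp: v_def indicator_def q)
  have G': "G = (\<lambda>x. ennreal (dpow \<gamma> (indicator S x * f x) * (indicator S x * H x)))"
    by (auto simp: G_def indicator_def)
  have vm[measurable]: "v \<in> borel_measurable borel" unfolding v' by measurable
  have Gm[measurable]: "G \<in> borel_measurable borel" unfolding G' by measurable
  obtain a where a: "(\<integral>\<^sup>+x. v x \<partial>lborel) = ennreal a" "0 \<le> a"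
    using fin unfolding v_def by (metis enn2real_nonneg ennreal_enn2real_if infinity_ennreal_def order_less_irrefl)
  show ?thesis
  proof (cases "a = 0")
    case True
    then show ?thesis using a by (simp add: v_def)
  next
    case False
    then have a0: "a > 0" using a by simp
  have "(\<integral>\<^sup>+x. v x \<partial>lborel) ^ m \<le> (\<integral>\<^sup>+x. G x \<partial>lborel) ^ Suc m"
  proof (rule nn_integral_power_le_lines[OF m(1,2) vm Gm])
    fix x :: 'a
    show "v x ^ m \<le> (\<Prod>b\<in>Basis. \<integral>\<^sup>+t. G (x + t *\<^sub>R b) \<partial>lborel)"
    proof (cases "x \<in> S")
      case False
      then show ?thesis using m by (simp add: v_def zero_power)
    next
      case True
      have "v x ^ m = ennreal (\<bar>f x\<bar> powr \<gamma>) ^ Suc m"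
      proof (cases "f x = 0")
        case True
        then show ?thesis using m \<gamma> by (simp add: v_def zero_power)
      next
        case False
        \<comment> \<open>This relation determines the exponent \<open>\<gamma>\<close>.\<close>
        have "q * m = \<gamma> * Suc m" by (simp add: q_def \<gamma>_def n)
        then have "(\<bar>f x\<bar> powr q) ^ m = (\<bar>f x\<bar> powr \<gamma>) ^ Suc m"
          using False by (simp only: powr_realpow[symmetric] powr_powr powr_gt_zero abs_eq_0 not_False_eq_True zero_less_abs_iff)
        then show ?thesis using \<open>x \<in> S\<close> by (simp add: v_def ennreal_power del: power_Suc)
      qed
      also have "\<dots> = (\<Prod>b\<in>(Basis::'a set). ennreal (\<bar>f x\<bar> powr \<gamma>))" by (simp add: m)
      also have "\<dots> \<le> (\<Prod>b\<in>Basis. \<integral>\<^sup>+t. G (x + t *\<^sub>R b) \<partial>lborel)"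
        unfolding G_def using le[OF True] by (intro prod_mono_ennreal) auto
      finally show ?thesis .
    qed
  qed
  moreover have "(\<integral>\<^sup>+x. G x \<partial>lborel) \<le> ennreal (\<gamma> * (a powr ((p - 1) / p) * B powr (1 / p)))"
  proof (cases "p = 1")
    case True
    have "\<gamma> = 1" using True m by (simp add: \<gamma>_def n)
    then have "(\<integral>\<^sup>+x. G x \<partial>lborel) = (\<integral>\<^sup>+x\<in>S. ennreal (H x powr p) \<partial>lborel)"
      using H0 True by (intro nn_integral_cong) (auto simp: G_def dpow_def indicator_def)
    also have "\<dots> \<le> ennreal B" by (rule B)
    finally have "(\<integral>\<^sup>+x. G x \<partial>lborel) \<le> ennreal B" .
    then show ?thesis using \<open>\<gamma> = 1\<close> True a0 B by simp
  next
    case False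
    then have p1: "p > 1" using p by simp
    have g1: "\<gamma> \<noteq> 1"
    proof
      assume "\<gamma> = 1"
      then have "p * real m = n - p" using p by (simp add: \<gamma>_def n)
      then have "(p - 1) * n = 0" by (simp add: n algebra_simps)
      then show False using p1 n by simp
    qed
    \<comment> \<open>The exponents fit: \<open>\<gamma> - 1 = q (p - 1) / p\<close>.\<close>
    let ?X = "\<lambda>x. \<bar>indicator S x * f x\<bar> powr q" and ?Y = "\<lambda>x. \<bar>indicator S x * H x\<bar> powr p"
    let ?\<theta> = "(p - 1) / p"
    have \<theta>: "1 - ?\<theta> = 1 / p" using p by (simp add: field_simps)
    have "\<gamma> - 1 = (p * (n - 1) - (n - p)) / (n - p)" using p by (simp add: \<gamma>_def diff_divide_distrib)
    also have "p * (n - 1) - (n - p) = n * (p - 1)" by (simp add: algebra_simps)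
    finally have e: "q * ?\<theta> = \<gamma> - 1" using p by (simp add: q_def)
    have "(\<integral>\<^sup>+x. G x \<partial>lborel) = (\<integral>\<^sup>+x. ennreal \<gamma> * ennreal (?X x powr ?\<theta> * ?Y x powr (1 - ?\<theta>)) \<partial>lborel)"
      unfolding \<theta> using H0 g1 p \<gamma>
      by (intro nn_integral_cong) (auto simp: G_def dpow_def indicator_def powr_powr e[unfolded times_divide_eq_right] ennreal_mult mult_ac)
    also have "\<dots> = ennreal \<gamma> * (\<integral>\<^sup>+x. ennreal (?X x powr ?\<theta> * ?Y x powr (1 - ?\<theta>)) \<partial>lborel)"
      by (rule nn_integral_cmult) measurable
    also have "\<dots> \<le> ennreal \<gamma> * ennreal (a powr ?\<theta> * B powr (1 - ?\<theta>))"
    proof (intro mult_left_mono nn_integral_powr_Holder)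
      have "(\<integral>\<^sup>+x. ennreal (?Y x) \<partial>lborel) = (\<integral>\<^sup>+x\<in>S. ennreal (H x powr p) \<partial>lborel)"
        using H0 p by (intro nn_integral_cong) (auto simp: indicator_def)
      then show "(\<integral>\<^sup>+x. ennreal (?Y x) \<partial>lborel) \<le> ennreal B" using B by simp
    qed (use p1 a B in \<open>auto simp: v'\<close>)
    finally show ?thesis unfolding \<theta> using \<gamma> by (simp add: ennreal_mult')
  qed
  ultimately have "ennreal a ^ m \<le> ennreal (\<gamma> * (a powr ((p - 1) / p) * B powr (1 / p))) ^ Suc m"
    unfolding a by (meson order_trans power_mono zero_le)
  then have key: "a ^ m \<le> (\<gamma> * (a powr ((p - 1) / p) * B powr (1 / p))) ^ Suc m"
    using a \<gamma> B by (simp add: ennreal_power del: power_Suc)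
  have "a \<le> \<gamma> powr q * B powr (q / p)"
  proof -
    have "a powr m \<le> \<gamma> powr n * (a powr ((p - 1) / p * n) * B powr (n / p))"
    proof (cases "B = 0")
      case True
      then show ?thesis using key zero_less_power[OF a0, of m] by simp
    next
      case False
      then have "(\<gamma> * (a powr ((p - 1) / p) * B powr (1 / p))) ^ Suc m =
          \<gamma> powr n * (a powr ((p - 1) / p * n) * B powr (n / p))"
        using \<gamma> a0 B by (simp add: powr_realpow[symmetric] powr_mult powr_powr n add.commute[of 1] del: power_Suc)
      then show ?thesis using key a0 by (simp add: powr_realpow)
    qed
    then have "a powr m * a powr (- ((p - 1) / p * n)) \<le>
        \<gamma> powr n * (a powr ((p - 1) / p * n) * B powr (n / p)) * a powr (- ((p - 1) / p * n))"
      by (rule mult_right_mono) simp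
    also have "\<dots> = \<gamma> powr n * B powr (n / p)"
      using a0 by (simp add: powr_minus)
    finally have "a powr (n / q) \<le> \<gamma> powr n * B powr (n / p)"
    proof -
      have "n / q = (n - p) / p" using p by (simp add: q_def)
      moreover have "real m - (p - 1) / p * n = (n - p) / p" using p by (simp add: n field_simps)
      ultimately have "real m - (p - 1) / p * n = n / q" by simp
      moreover assume "a powr m * a powr (- ((p - 1) / p * n)) \<le> \<gamma> powr n * B powr (n / p)"
      ultimately show ?thesis by (simp only: powr_add[symmetric] add_uminus_conv_diff)
    qed
    then have "(a powr (n / q)) powr (q / n) \<le> (\<gamma> powr n * B powr (n / p)) powr (q / n)"
      using q n by (intro powr_mono2) auto
    then show ?thesis using q n a0 \<gamma> B by (simp add: powr_powr powr_mult)
  qed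
  then show ?thesis using a by (simp add: v_def ennreal_leI)
  qed
qed

lemma nn_integral_line_reflect:
  fixes G :: "'a::euclidean_space \<Rightarrow> ennreal"
  assumes "G \<in> borel_measurable borel"
  shows "(\<integral>\<^sup>+t. G (x + t *\<^sub>R (- b)) \<partial>lborel) = (\<integral>\<^sup>+t. G (x + t *\<^sub>R b) \<partial>lborel)"
  using nn_integral_real_affine[of "\<lambda>t. G (x + t *\<^sub>R b)" "-1" 0] assms by simp

lemma borel_indicator_ennreal:
  fixes N :: "'a::topological_space \<Rightarrow> real"
  assumes "S \<in> sets borel" "continuous_on S N"
  shows "(\<lambda>x. ennreal (N x) * indicator S x) \<in> borel_measurable borel"
proof -
  have "(\<lambda>x. ennreal (indicator S x *\<^sub>R N x)) \<in> borel_measurable borel"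
    using borel_measurable_continuous_on_indicator[OF assms] by measurable
  also have "(\<lambda>x. ennreal (indicator S x *\<^sub>R N x)) = (\<lambda>x. ennreal (N x) * indicator S x)"
    by (auto simp: indicator_def)
  finally show ?thesis .
qed

text \<open>On the half line from \<open>x\<close> in that one of the directions \<open>b\<close>, \<open>-b\<close> which makes an angle of at most 90
  degrees with \<open>x\<close>, the norm does not decrease below that of \<open>x\<close> and tends to infinity.\<close>
lemma exterior_line_bound:
  fixes f :: "'a::euclidean_space \<Rightarrow> real"
  assumes f: "upper_gradient (- cball 0 1) f N"
    and R: "\<And>x. R \<le> norm x \<Longrightarrow> 1 < norm x \<Longrightarrow> f x = 0"
    and x: "x \<in> - cball 0 1" and b: "b \<in> Basis"
  shows "ennreal \<bar>f x\<bar> \<le>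
    (\<integral>\<^sup>+t. ennreal (N (x + t *\<^sub>R b)) * indicator (- cball 0 1) (x + t *\<^sub>R b) \<partial>lborel)"
proof -
  let ?S = "- cball 0 1 :: 'a set" and ?G = "\<lambda>x. ennreal (N x) * indicator (- cball 0 1) x"
  have Gm: "?G \<in> borel_measurable borel"
    using f by (intro borel_indicator_ennreal) (auto simp: upper_gradient_def)
  \<comment> \<open>The outward one of the two directions.\<close>
  define c where "c = (if 0 \<le> x \<bullet> b then b else - b)"
  have c: "norm c = 1" "0 \<le> x \<bullet> c" using b by (auto simp: c_def)
  then have cc: "c \<bullet> c = 1" by (simp add: norm_eq_1)
  define T where "T = max R 2"
  have S: "x + t *\<^sub>R c \<in> ?S" if "t \<in> {0..T}" for t
  proof -
    have "norm x ^ 2 \<le> norm (x + t *\<^sub>R c) ^ 2"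
      using that c cc by (simp add: power2_norm_eq_inner inner_simps inner_commute)
    then show ?thesis using x by (auto dest: power2_le_imp_le)
  qed
  have "T \<le> x \<bullet> c + T" using c by simp
  also have "\<dots> = (x + T *\<^sub>R c) \<bullet> c" using cc by (simp add: inner_simps)
  also have "\<dots> \<le> norm (x + T *\<^sub>R c)" using norm_cauchy_schwarz[of "x + T *\<^sub>R c" c] c by simp
  finally have "f (x + T *\<^sub>R c) = 0" by (intro R) (auto simp: T_def)
  then have "ennreal \<bar>f x\<bar> = ennreal \<bar>f (x + T *\<^sub>R c) - f (x + 0 *\<^sub>R c)\<bar>" by simp
  also have "\<dots> \<le> (\<integral>\<^sup>+t. ennreal (N (x + t *\<^sub>R c) * norm c) * indicator {0..T} t \<partial>lborel)"
    by (rule upper_gradient_increment[OF f]) (use S in \<open>auto simp: T_def\<close>)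
  also have "\<dots> \<le> (\<integral>\<^sup>+t. ?G (x + t *\<^sub>R c) \<partial>lborel)"
    by (intro nn_integral_mono) (use S c in \<open>auto simp: indicator_def\<close>)
  also have "\<dots> = (\<integral>\<^sup>+t. ?G (x + t *\<^sub>R b) \<partial>lborel)"
    using nn_integral_line_reflect[OF Gm, of x b] by (auto simp: c_def)
  finally show ?thesis .
qed

theorem sobolev_exterior:
  fixes f N :: "'a::euclidean_space \<Rightarrow> real" and p :: real
  defines "n \<equiv> real (DIM('a))"
  defines "\<gamma> \<equiv> p * (n - 1) / (n - p)" and "q \<equiv> n * p / (n - p)"
  assumes dim: "2 \<le> DIM('a)" and p: "1 \<le> p" "p < n"
    and f: "upper_gradient (- cball 0 1) f N"
    and R: "\<And>x. R \<le> norm x \<Longrightarrow> 1 < norm x \<Longrightarrow> f x = 0"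
    and fin: "(\<integral>\<^sup>+x\<in>- cball 0 1. ennreal (\<bar>f x\<bar> powr q) \<partial>lborel) < \<infinity>"
    and B: "0 \<le> B" "(\<integral>\<^sup>+x\<in>- cball 0 1. ennreal (N x powr p) \<partial>lborel) \<le> ennreal B"
  shows "(\<integral>\<^sup>+x\<in>- cball 0 1. ennreal (\<bar>f x\<bar> powr q) \<partial>lborel) \<le> ennreal (\<gamma> powr q * B powr (q / p))"
  unfolding \<gamma>_def q_def n_def
proof (rule sobolev_of_line_bounds[OF dim p(1) p(2)[unfolded n_def]])
  show "continuous_on (- cball 0 1) f" "continuous_on (- cball 0 1) N" "\<And>x. x \<in> - cball 0 1 \<Longrightarrow> 0 \<le> N x"
    using f upper_gradient_continuous_on by (auto simp: upper_gradient_def)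
  have \<gamma>: "1 \<le> \<gamma>" unfolding \<gamma>_def using p mult_right_mono[of 1 p n] by (simp add: field_simps)
  fix x b :: 'a assume x: "x \<in> - cball 0 1" and b: "b \<in> Basis"
  have "ennreal \<bar>spow \<gamma> (f x)\<bar> \<le> (\<integral>\<^sup>+t. ennreal (\<bar>dpow \<gamma> (f (x + t *\<^sub>R b))\<bar> * N (x + t *\<^sub>R b))
      * indicator (- cball 0 1) (x + t *\<^sub>R b) \<partial>lborel)"
    by (rule exterior_line_bound[OF upper_gradient_compose[OF f spow_has_derivative[OF \<gamma>] continuous_dpow[OF \<gamma>]] _ x b])
      (use R in \<open>auto simp: spow_def\<close>)
  then show "ennreal (\<bar>f x\<bar> powr (p * (real DIM('a) - 1) / (real DIM('a) - p)))
    \<le> (\<integral>\<^sup>+t. ennreal (dpow (p * (real DIM('a) - 1) / (real DIM('a) - p)) (f (x + t *\<^sub>R b)) * N (x + t *\<^sub>R b))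
      * indicator (- cball 0 1) (x + t *\<^sub>R b) \<partial>lborel)"
    unfolding abs_spow \<gamma>_def[unfolded n_def, symmetric] using dpow_nonneg[OF \<gamma>] by simp
qed (use fin B in \<open>auto simp: q_def n_def\<close>)

definition cube :: "'a::euclidean_space \<Rightarrow> real \<Rightarrow> 'a set" where
  "cube c r = box (c - r *\<^sub>R One) (c + r *\<^sub>R One)"

lemma mem_cube: "x \<in> cube c r \<longleftrightarrow> (\<forall>b\<in>Basis. \<bar>(x - c) \<bullet> b\<bar> < r)"
  unfolding cube_def mem_box by (rule ball_cong) (auto simp: inner_simps abs_less_iff)

lemma open_cube [simp]: "open (cube c r)" and convex_cube: "convex (cube c r)"
  by (auto simp: cube_def open_box convex_box)

text \<open>Compare \<open>f x\<close> with the value at each other point of the line inside the cube and average over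
  that segment, which has length \<open>2 r\<close>.\<close>
lemma cube_line_bound:
  fixes f :: "'a::euclidean_space \<Rightarrow> real"
  assumes f: "upper_gradient (cube c r) f N" and r: "0 < r"
    and x: "x \<in> cube c r" and b: "b \<in> Basis"
  shows "ennreal \<bar>f x\<bar> \<le>
    (\<integral>\<^sup>+t. ennreal (\<bar>f (x + t *\<^sub>R b)\<bar> / (2 * r) + N (x + t *\<^sub>R b)) * indicator (cube c r) (x + t *\<^sub>R b) \<partial>lborel)"
proof -
  let ?S = "cube c r"
  let ?G = "\<lambda>t. ennreal (N (x + t *\<^sub>R b)) * indicator ?S (x + t *\<^sub>R b)"
  let ?F = "\<lambda>t. ennreal \<bar>f (x + t *\<^sub>R b)\<bar> * indicator ?S (x + t *\<^sub>R b)"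
  have N0: "0 \<le> N y" if "y \<in> ?S" for y using f that by (auto simp: upper_gradient_def)
  have [measurable]: "?G \<in> borel_measurable borel"
    by (rule measurable_compose[of "\<lambda>t. x + t *\<^sub>R b" _ borel, OF _ borel_indicator_ennreal])
      (use f in \<open>auto simp: upper_gradient_def\<close>)
  have [measurable]: "?F \<in> borel_measurable borel"
    by (rule measurable_compose[of "\<lambda>t. x + t *\<^sub>R b" _ borel, OF _ borel_indicator_ennreal])
      (use upper_gradient_continuous_on[OF f] in \<open>auto intro: continuous_intros\<close>)
  define u w where "u = - r - (x - c) \<bullet> b" and "w = r - (x - c) \<bullet> b"
  have uw: "u < 0" "0 < w" "w - u = 2 * r" using x b r by (auto simp: mem_cube u_def w_def abs_less_iff)
  have line: "x + t *\<^sub>R b \<in> ?S \<longleftrightarrow> t \<in> {u<..<w}" for t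
  proof -
    have "x + t *\<^sub>R b \<in> ?S \<longleftrightarrow> (\<forall>i\<in>Basis. \<bar>(x - c) \<bullet> i + (if i = b then t else 0)\<bar> < r)"
      unfolding mem_cube using b
      by (intro ball_cong refl) (auto simp: inner_simps inner_Basis algebra_simps)
    also have "\<dots> \<longleftrightarrow> \<bar>(x - c) \<bullet> b + t\<bar> < r"
      using x b by (auto simp: mem_cube)
    finally show ?thesis by (auto simp: u_def w_def abs_less_iff)
  qed
  have inc: "ennreal \<bar>f x\<bar> \<le> ennreal \<bar>f (x + t *\<^sub>R b)\<bar> + (\<integral>\<^sup>+t. ?G t \<partial>lborel)" if t: "t \<in> {u<..<w}" for t
  proof -
    have "ennreal \<bar>f x - f (x + t *\<^sub>R b)\<bar> \<le> (\<integral>\<^sup>+t. ?G t \<partial>lborel)"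
    proof (cases "0 \<le> t")
      case True
      have "ennreal \<bar>f (x + t *\<^sub>R b) - f (x + 0 *\<^sub>R b)\<bar> \<le>
        (\<integral>\<^sup>+s. ennreal (N (x + s *\<^sub>R b) * norm b) * indicator {0..t} s \<partial>lborel)"
        using f True by (rule upper_gradient_increment) (use t uw in \<open>auto simp: line\<close>)
      also have "\<dots> \<le> (\<integral>\<^sup>+t. ?G t \<partial>lborel)"
        by (intro nn_integral_mono) (use t uw b in \<open>auto simp: indicator_def line\<close>)
      finally show ?thesis by (simp add: abs_minus_commute)
    next
      case False
      then have "t \<le> 0" by simp
      with f have "ennreal \<bar>f (x + 0 *\<^sub>R b) - f (x + t *\<^sub>R b)\<bar> \<le>
        (\<integral>\<^sup>+s. ennreal (N (x + s *\<^sub>R b) * norm b) * indicator {t..0} s \<partial>lborel)"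
        by (rule upper_gradient_increment) (use t uw in \<open>auto simp: line\<close>)
      also have "\<dots> \<le> (\<integral>\<^sup>+t. ?G t \<partial>lborel)"
        by (intro nn_integral_mono) (use t uw b in \<open>auto simp: indicator_def line\<close>)
      finally show ?thesis by simp
    qed
    moreover have "ennreal \<bar>f x\<bar> \<le> ennreal \<bar>f (x + t *\<^sub>R b)\<bar> + ennreal \<bar>f x - f (x + t *\<^sub>R b)\<bar>"
      by (simp add: ennreal_plus[symmetric] ennreal_leI del: ennreal_plus)
    ultimately show ?thesis by (meson add_left_mono order_trans)
  qed
  have len: "emeasure lborel {u<..<w} = ennreal (2 * r)" using uw by simp
  have "ennreal (2 * r) * ennreal \<bar>f x\<bar> = (\<integral>\<^sup>+t. ennreal \<bar>f x\<bar> * indicator {u<..<w} t \<partial>lborel)"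
    unfolding len[symmetric] by (simp add: nn_integral_cmult_indicator mult.commute del: emeasure_lborel_Ioo)
  also have "\<dots> \<le> (\<integral>\<^sup>+t. ?F t + (\<integral>\<^sup>+s. ?G s \<partial>lborel) * indicator {u<..<w} t \<partial>lborel)"
    by (intro nn_integral_mono) (use inc in \<open>auto simp: indicator_def line\<close>)
  also have "\<dots> = (\<integral>\<^sup>+t. ?F t \<partial>lborel) + (\<integral>\<^sup>+s. ?G s \<partial>lborel) * ennreal (2 * r)"
    by (simp add: nn_integral_add nn_integral_cmult_indicator len del: emeasure_lborel_Ioo)
  finally have *: "ennreal (2 * r) * ennreal \<bar>f x\<bar> \<le> (\<integral>\<^sup>+t. ?F t \<partial>lborel) + (\<integral>\<^sup>+s. ?G s \<partial>lborel) * ennreal (2 * r)" .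
  have inv: "ennreal (1 / (2 * r)) * ennreal (2 * r) = 1" using r by (simp flip: ennreal_mult)
  have "ennreal \<bar>f x\<bar> = ennreal (1 / (2 * r)) * (ennreal (2 * r) * ennreal \<bar>f x\<bar>)"
    by (simp only: mult.assoc[symmetric] inv mult_1)
  also have "\<dots> \<le> ennreal (1 / (2 * r)) * ((\<integral>\<^sup>+t. ?F t \<partial>lborel) + (\<integral>\<^sup>+s. ?G s \<partial>lborel) * ennreal (2 * r))"
    by (intro mult_left_mono *) simp
  also have "\<dots> = (\<integral>\<^sup>+t. ennreal (1 / (2 * r)) * ?F t \<partial>lborel) + (\<integral>\<^sup>+s. ?G s \<partial>lborel)"
  proof -
    have "(\<integral>\<^sup>+t. ennreal (1 / (2 * r)) * ?F t \<partial>lborel) = ennreal (1 / (2 * r)) * (\<integral>\<^sup>+t. ?F t \<partial>lborel)"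
      by (rule nn_integral_cmult) measurable
    moreover have "ennreal (1 / (2 * r)) * (z * ennreal (2 * r)) = z" for z
      using inv by (metis mult.commute mult.left_commute mult_1_right)
    ultimately show ?thesis by (simp only: distrib_left)
  qed
  also have "\<dots> = (\<integral>\<^sup>+t. ennreal (1 / (2 * r)) * ?F t + ?G t \<partial>lborel)"
    by (simp add: nn_integral_add)
  also have "\<dots> = (\<integral>\<^sup>+t. ennreal (\<bar>f (x + t *\<^sub>R b)\<bar> / (2 * r) + N (x + t *\<^sub>R b)) * indicator (cube c r) (x + t *\<^sub>R b) \<partial>lborel)"
  proof (rule nn_integral_cong)
    fix t
    have "ennreal (1 / (2 * r)) * ennreal \<bar>f (x + t *\<^sub>R b)\<bar> = ennreal (\<bar>f (x + t *\<^sub>R b)\<bar> / (2 * r))"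
      using r by (simp flip: ennreal_mult)
    then show "ennreal (1 / (2 * r)) * ?F t + ?G t =
      ennreal (\<bar>f (x + t *\<^sub>R b)\<bar> / (2 * r) + N (x + t *\<^sub>R b)) * indicator (cube c r) (x + t *\<^sub>R b)"
      using N0[of "x + t *\<^sub>R b"] r by (auto simp: indicator_def)
  qed
  finally show ?thesis .
qed

lemma powr_add_le:
  fixes a b :: real
  assumes "0 \<le> a" "0 \<le> b" "0 \<le> p"
  shows "(a + b) powr p \<le> 2 powr p * (a powr p + b powr p)"
proof -
  have "(a + b) powr p \<le> (2 * max a b) powr p" using assms by (intro powr_mono2) auto
  also have "\<dots> = 2 powr p * max a b powr p" using assms by (simp add: powr_mult)
  also have "\<dots> \<le> 2 powr p * (a powr p + b powr p)" by (intro mult_left_mono) (auto simp: max_def)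
  finally show ?thesis .
qed

theorem sobolev_cube:
  fixes f N :: "'a::euclidean_space \<Rightarrow> real" and p :: real
  defines "n \<equiv> real (DIM('a))"
  defines "\<gamma> \<equiv> p * (n - 1) / (n - p)" and "q \<equiv> n * p / (n - p)"
  assumes dim: "2 \<le> DIM('a)" and p: "1 \<le> p" "p < n" and r: "0 < r"
    and f: "upper_gradient (cube c r) f N"
    and fin: "(\<integral>\<^sup>+x\<in>cube c r. ennreal (\<bar>f x\<bar> powr q) \<partial>lborel) < \<infinity>"
    and A: "0 \<le> A" "(\<integral>\<^sup>+x\<in>cube c r. ennreal (\<bar>f x\<bar> powr p) \<partial>lborel) \<le> ennreal A"
    and B: "0 \<le> B" "(\<integral>\<^sup>+x\<in>cube c r. ennreal (N x powr p) \<partial>lborel) \<le> ennreal B"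
  shows "(\<integral>\<^sup>+x\<in>cube c r. ennreal (\<bar>f x\<bar> powr q) \<partial>lborel) \<le>
    ennreal (\<gamma> powr q * (2 powr p * (A / (2 * r) powr p + B)) powr (q / p))"
  unfolding \<gamma>_def q_def n_def
proof (rule sobolev_of_line_bounds[OF dim p(1) p(2)[unfolded n_def], where H = "\<lambda>x. \<bar>f x\<bar> / (2 * r) + N x"])
  let ?S = "cube c r"
  have fc: "continuous_on ?S f" and Nc: "continuous_on ?S N" and N0: "\<And>x. x \<in> ?S \<Longrightarrow> 0 \<le> N x"
    using f upper_gradient_continuous_on by (auto simp: upper_gradient_def)
  have [measurable]: "(\<lambda>x. ennreal (\<bar>f x\<bar> powr p) * indicator ?S x) \<in> borel_measurable borel"
    "(\<lambda>x. ennreal (N x powr p) * indicator ?S x) \<in> borel_measurable borel"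
    using N0 p by (auto intro!: borel_indicator_ennreal continuous_on_powr' continuous_on_rabs continuous_on_const fc Nc)
  show "continuous_on ?S f" "continuous_on ?S (\<lambda>x. \<bar>f x\<bar> / (2 * r) + N x)"
    using fc Nc r by (auto intro!: continuous_intros)
  show "\<And>x. x \<in> ?S \<Longrightarrow> 0 \<le> \<bar>f x\<bar> / (2 * r) + N x" using N0 r by simp
  have \<gamma>: "1 \<le> \<gamma>" unfolding \<gamma>_def using p mult_right_mono[of 1 p n] by (simp add: field_simps)
  show "ennreal (\<bar>f x\<bar> powr (p * (real DIM('a) - 1) / (real DIM('a) - p)))
    \<le> (\<integral>\<^sup>+t. ennreal (dpow (p * (real DIM('a) - 1) / (real DIM('a) - p)) (f (x + t *\<^sub>R b)) *
        (\<bar>f (x + t *\<^sub>R b)\<bar> / (2 * r) + N (x + t *\<^sub>R b))) * indicator ?S (x + t *\<^sub>R b) \<partial>lborel)"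
    if x: "x \<in> ?S" and b: "b \<in> Basis" for x b
  proof -
    have "ennreal \<bar>spow \<gamma> (f x)\<bar> \<le> (\<integral>\<^sup>+t. ennreal (\<bar>spow \<gamma> (f (x + t *\<^sub>R b))\<bar> / (2 * r) +
        \<bar>dpow \<gamma> (f (x + t *\<^sub>R b))\<bar> * N (x + t *\<^sub>R b)) * indicator ?S (x + t *\<^sub>R b) \<partial>lborel)"
      by (rule cube_line_bound[OF upper_gradient_compose[OF f spow_has_derivative[OF \<gamma>] continuous_dpow[OF \<gamma>]] r x b])
    also have "\<dots> \<le> (\<integral>\<^sup>+t. ennreal (dpow \<gamma> (f (x + t *\<^sub>R b)) * (\<bar>f (x + t *\<^sub>R b)\<bar> / (2 * r) + N (x + t *\<^sub>R b)))
        * indicator ?S (x + t *\<^sub>R b) \<partial>lborel)"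
    proof (intro nn_integral_mono mult_right_mono ennreal_leI)
      fix t
      show "\<bar>spow \<gamma> (f (x + t *\<^sub>R b))\<bar> / (2 * r) + \<bar>dpow \<gamma> (f (x + t *\<^sub>R b))\<bar> * N (x + t *\<^sub>R b)
        \<le> dpow \<gamma> (f (x + t *\<^sub>R b)) * (\<bar>f (x + t *\<^sub>R b)\<bar> / (2 * r) + N (x + t *\<^sub>R b))"
        using dpow_nonneg[OF \<gamma>] r divide_right_mono[OF powr_le_dpow[OF \<gamma>, of "f (x + t *\<^sub>R b)"], of "2 * r"]
        by (simp add: abs_spow distrib_left)
    qed simp
    finally show ?thesis
      unfolding abs_spow \<gamma>_def[unfolded n_def, symmetric] .
  qed
  let ?C = "2 powr p * (A / (2 * r) powr p + B)"
  show "0 \<le> ?C" using A B by simp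
  have "(\<integral>\<^sup>+x\<in>?S. ennreal ((\<bar>f x\<bar> / (2 * r) + N x) powr p) \<partial>lborel) \<le>
    (\<integral>\<^sup>+x. ennreal (2 powr p / (2 * r) powr p) * (ennreal (\<bar>f x\<bar> powr p) * indicator ?S x) +
      ennreal (2 powr p) * (ennreal (N x powr p) * indicator ?S x) \<partial>lborel)"
  proof (rule nn_integral_mono)
    fix x
    show "ennreal ((\<bar>f x\<bar> / (2 * r) + N x) powr p) * indicator ?S x \<le>
      ennreal (2 powr p / (2 * r) powr p) * (ennreal (\<bar>f x\<bar> powr p) * indicator ?S x) +
      ennreal (2 powr p) * (ennreal (N x powr p) * indicator ?S x)"
    proof (cases "x \<in> ?S")
      case True
      have "(\<bar>f x\<bar> / (2 * r) + N x) powr p \<le> 2 powr p * ((\<bar>f x\<bar> / (2 * r)) powr p + N x powr p)"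
        using r p N0[OF True] by (intro powr_add_le) auto
      also have "\<dots> = 2 powr p / (2 * r) powr p * \<bar>f x\<bar> powr p + 2 powr p * N x powr p"
        using r by (simp add: powr_divide distrib_left)
      finally have "ennreal ((\<bar>f x\<bar> / (2 * r) + N x) powr p) \<le>
          ennreal (2 powr p / (2 * r) powr p * \<bar>f x\<bar> powr p + 2 powr p * N x powr p)" by (rule ennreal_leI)
      also have "\<dots> = ennreal (2 powr p / (2 * r) powr p) * ennreal (\<bar>f x\<bar> powr p) + ennreal (2 powr p) * ennreal (N x powr p)"
        using r by (simp only: ennreal_plus ennreal_mult'' mult_nonneg_nonneg powr_ge_zero divide_nonneg_nonneg)
      finally show ?thesis using True by simp
    qed simp
  qed
  also have "\<dots> = ennreal (2 powr p / (2 * r) powr p) * (\<integral>\<^sup>+x\<in>?S. ennreal (\<bar>f x\<bar> powr p) \<partial>lborel) +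
      ennreal (2 powr p) * (\<integral>\<^sup>+x\<in>?S. ennreal (N x powr p) \<partial>lborel)"
    by (simp add: nn_integral_add nn_integral_cmult)
  also have "\<dots> \<le> ennreal (2 powr p / (2 * r) powr p) * ennreal A + ennreal (2 powr p) * ennreal B"
    by (intro add_mono mult_left_mono A B) auto
  also have "\<dots> = ennreal (2 powr p / (2 * r) powr p * A + 2 powr p * B)"
    using A B by (simp only: ennreal_plus ennreal_mult'' mult_nonneg_nonneg powr_ge_zero divide_nonneg_nonneg)
  also have "2 powr p / (2 * r) powr p * A + 2 powr p * B = ?C" by (simp add: algebra_simps)
  finally show "(\<integral>\<^sup>+x\<in>?S. ennreal ((\<bar>f x\<bar> / (2 * r) + N x) powr p) \<partial>lborel) \<le> ennreal ?C" .
qed (use fin in \<open>auto simp: q_def n_def\<close>)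

section \<open>A Poincare inequality by contraction\<close>

lemma nn_integral_contraction:
  fixes h :: "'a::euclidean_space \<Rightarrow> ennreal"
  assumes [measurable]: "h \<in> borel_measurable borel" and t: "0 < t"
  shows "(\<integral>\<^sup>+x. h (c + t *\<^sub>R (x - c)) \<partial>lborel) = ennreal (1 / t ^ DIM('a)) * (\<integral>\<^sup>+x. h x \<partial>lborel)"
proof -
  have "(\<integral>\<^sup>+x. h x \<partial>lborel) = ennreal (t ^ DIM('a)) * (\<integral>\<^sup>+x. h ((c - t *\<^sub>R c) + t *\<^sub>R x) \<partial>lborel)"
    using t by (subst lborel_affine[of t "c - t *\<^sub>R c"])
      (auto simp: nn_integral_density nn_integral_distr nn_integral_cmult)
  then have "ennreal (1 / t ^ DIM('a)) * (\<integral>\<^sup>+x. h x \<partial>lborel) =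
      (ennreal (1 / t ^ DIM('a)) * ennreal (t ^ DIM('a))) * (\<integral>\<^sup>+x. h ((c - t *\<^sub>R c) + t *\<^sub>R x) \<partial>lborel)"
    by (simp add: mult.assoc)
  also have "ennreal (1 / t ^ DIM('a)) * ennreal (t ^ DIM('a)) = 1" using t by (simp flip: ennreal_mult)
  finally show ?thesis by (simp add: algebra_simps)
qed

lemma nn_integral_le_Lp_unit_interval:
  fixes n :: "real \<Rightarrow> real"
  assumes p: "1 \<le> p" and s: "0 \<le> s" "s \<le> 1" and n: "continuous_on {s..1} n" and n0: "\<And>t. t \<in> {s..1} \<Longrightarrow> 0 \<le> n t"
    and B: "0 \<le> B" "(\<integral>\<^sup>+t\<in>{s..1}. ennreal (n t powr p) \<partial>lborel) \<le> ennreal B"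
  shows "(\<integral>\<^sup>+t\<in>{s..1}. ennreal (n t) \<partial>lborel) \<le> ennreal (B powr (1 / p))"
proof (cases "p = 1")
  case True
  have "(\<integral>\<^sup>+t\<in>{s..1}. ennreal (n t) \<partial>lborel) = (\<integral>\<^sup>+t\<in>{s..1}. ennreal (n t powr p) \<partial>lborel)"
    by (rule nn_integral_cong) (use n0 True in \<open>auto simp: indicator_def\<close>)
  then show ?thesis using B True by simp
next
  case False
  then have p1: "p > 1" using p by simp
  have [measurable]: "(\<lambda>t. indicator {s..1} t * n t) \<in> borel_measurable borel"
    using borel_measurable_continuous_on_indicator[OF _ n] by simp
  let ?\<theta> = "(p - 1) / p" and ?Y = "\<lambda>t. \<bar>indicator {s..1} t * n t\<bar> powr p"
  have \<theta>: "1 - ?\<theta> = 1 / p" using p by (simp add: field_simps)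
  have "(\<integral>\<^sup>+t\<in>{s..1}. ennreal (n t) \<partial>lborel) =
      (\<integral>\<^sup>+t. ennreal (indicator {s..1} t powr ?\<theta> * ?Y t powr (1 - ?\<theta>)) \<partial>lborel)"
    unfolding \<theta> by (rule nn_integral_cong) (use n0 p in \<open>auto simp: indicator_def powr_powr\<close>)
  also have "\<dots> \<le> ennreal (1 powr ?\<theta> * B powr (1 - ?\<theta>))"
  proof (rule nn_integral_powr_Holder)
    have "(\<integral>\<^sup>+t. ennreal (?Y t) \<partial>lborel) = (\<integral>\<^sup>+t\<in>{s..1}. ennreal (n t powr p) \<partial>lborel)"
      by (rule nn_integral_cong) (use n0 p in \<open>auto simp: indicator_def\<close>)
    then show "(\<integral>\<^sup>+t. ennreal (?Y t) \<partial>lborel) \<le> ennreal B" using B by simp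
    have "(\<integral>\<^sup>+t. ennreal (indicator {s..1} t) \<partial>lborel) = ennreal (1 - s)"
      using s by (simp add: ennreal_indicator)
    then show "(\<integral>\<^sup>+t. ennreal (indicator {s..1} t) \<partial>lborel) \<le> ennreal 1"
      using s by (simp add: ennreal_leI)
  qed (use p1 B in auto)
  finally show ?thesis unfolding \<theta> by simp
qed

text \<open>Integrate \<open>f\<close> along the segment from \<open>c + s (x - c)\<close>, which lies in \<open>V\<close>, to \<open>x\<close>. For \<open>t \<ge> s\<close> the
  substitution \<open>x \<mapsto> c + t (x - c)\<close> costs at most the factor \<open>1 / s\<close> to the power of the dimension.\<close>
theorem poincare_contraction:
  fixes f N :: "'a::euclidean_space \<Rightarrow> real"
  assumes Q: "open Q" "convex Q" "c \<in> Q" and D: "\<And>x. x \<in> Q \<Longrightarrow> norm (x - c) \<le> D"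
    and f: "upper_gradient Q f N" and p: "1 \<le> p" and s: "0 < s" "s \<le> 1"
    and V: "open V" "V \<subseteq> Q" "\<And>x. x \<in> Q \<Longrightarrow> c + s *\<^sub>R (x - c) \<in> V"
  shows "(\<integral>\<^sup>+x\<in>Q. ennreal (\<bar>f x\<bar> powr p) \<partial>lborel) \<le>
    ennreal (2 powr p / s ^ DIM('a)) * (\<integral>\<^sup>+x\<in>V. ennreal (\<bar>f x\<bar> powr p) \<partial>lborel) +
    ennreal (2 powr p * D powr p / s ^ DIM('a)) * (\<integral>\<^sup>+x\<in>Q. ennreal (N x powr p) \<partial>lborel)"
proof -
  have fc: "continuous_on Q f" and Nc: "continuous_on Q N" and N0: "\<And>x. x \<in> Q \<Longrightarrow> 0 \<le> N x"
    using f upper_gradient_continuous_on by (auto simp: upper_gradient_def)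
  have D0: "0 \<le> D" using D[OF Q(3)] by simp
  let ?F = "\<lambda>x. ennreal (\<bar>f x\<bar> powr p) * indicator V x"
  let ?G = "\<lambda>x. ennreal (N x powr p) * indicator Q x"
  have [measurable]: "?F \<in> borel_measurable borel" "?G \<in> borel_measurable borel"
    using N0 p Q V by (auto intro!: borel_indicator_ennreal continuous_on_powr' continuous_on_rabs
        continuous_on_const continuous_on_subset[OF fc] Nc)
  have pt: "ennreal (\<bar>f x\<bar> powr p) * indicator Q x \<le> ennreal (2 powr p) * ?F (c + s *\<^sub>R (x - c)) +
      ennreal (2 powr p * D powr p) * (\<integral>\<^sup>+t. ?G (c + t *\<^sub>R (x - c)) * indicator {s..1} t \<partial>lborel)" for x
  proof (cases "x \<in> Q")
    case x: True
    have seg: "c + t *\<^sub>R (x - c) \<in> Q" if "t \<in> {s..1}" for t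
    proof -
      have "(1 - t) *\<^sub>R c + t *\<^sub>R x \<in> Q"
        using Q x that s by (intro convexD) auto
      then show ?thesis by (simp add: algebra_simps)
    qed
    let ?I = "\<integral>\<^sup>+t. ?G (c + t *\<^sub>R (x - c)) * indicator {s..1} t \<partial>lborel"
    have I: "?I = (\<integral>\<^sup>+t\<in>{s..1}. ennreal (N (c + t *\<^sub>R (x - c)) powr p) \<partial>lborel)"
      by (rule nn_integral_cong) (use seg in \<open>auto simp: indicator_def\<close>)
    show ?thesis
    proof (cases "?I = \<infinity>")
      case True
      show ?thesis
      proof (cases "D = 0")
        case False
        then show ?thesis using D0 True by (simp add: ennreal_mult_top)
      next
        case D00: True
        then have "x = c" using D[OF x] by simp
        have "\<bar>f c\<bar> powr p \<le> 2 powr p * \<bar>f c\<bar> powr p"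
          using p ge_one_powr_ge_zero[of 2 p] by (simp add: mult_le_cancel_right1)
        then show ?thesis using V(3)[OF x] x D00 \<open>x = c\<close>
          by (simp add: ennreal_leI flip: ennreal_mult)
      qed
    next
      case False
      then obtain B where B: "?I = ennreal B" "0 \<le> B" by (cases ?I) auto
      let ?y = "c + s *\<^sub>R (x - c)"
      have Nl: "continuous_on {s..1} (\<lambda>t. N (c + t *\<^sub>R (x - c)))"
        using seg by (intro continuous_on_compose2[OF Nc] continuous_intros) auto
      have "ennreal \<bar>f (c + 1 *\<^sub>R (x - c)) - f ?y\<bar> \<le>
          (\<integral>\<^sup>+t. ennreal (N (c + t *\<^sub>R (x - c)) * norm (x - c)) * indicator {s..1} t \<partial>lborel)"
        by (rule upper_gradient_increment[OF f s(2) seg])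
      also have "\<dots> = (\<integral>\<^sup>+t. ennreal (norm (x - c)) * (ennreal (N (c + t *\<^sub>R (x - c))) * indicator {s..1} t) \<partial>lborel)"
        by (rule nn_integral_cong) (auto simp: indicator_def ennreal_mult' mult.commute)
      also have "\<dots> = ennreal (norm (x - c)) * (\<integral>\<^sup>+t\<in>{s..1}. ennreal (N (c + t *\<^sub>R (x - c))) \<partial>lborel)"
        by (rule nn_integral_cmult) (use borel_indicator_ennreal[OF _ Nl] in auto)
      also have "\<dots> \<le> ennreal D * ennreal (B powr (1 / p))"
        by (intro mult_mono nn_integral_le_Lp_unit_interval p Nl N0 seg)
          (use x D s B I in \<open>auto intro: ennreal_leI\<close>)
      also have "\<dots> = ennreal (D * B powr (1 / p))" using D0 by (simp add: ennreal_mult)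
      finally have "\<bar>f x - f ?y\<bar> \<le> D * B powr (1 / p)" using D0 by simp
      then have "\<bar>f x\<bar> powr p \<le> (\<bar>f ?y\<bar> + D * B powr (1 / p)) powr p"
        using p by (intro powr_mono2) auto
      also have "\<dots> \<le> 2 powr p * (\<bar>f ?y\<bar> powr p + (D * B powr (1 / p)) powr p)"
        using D0 p by (intro powr_add_le) auto
      also have "(D * B powr (1 / p)) powr p = D powr p * B"
        using D0 B p by (simp add: powr_mult powr_powr)
      finally have "ennreal (\<bar>f x\<bar> powr p) \<le> ennreal (2 powr p * \<bar>f ?y\<bar> powr p + 2 powr p * D powr p * B)"
        by (intro ennreal_leI) (simp add: algebra_simps)
      also have "\<dots> = ennreal (2 powr p) * ennreal (\<bar>f ?y\<bar> powr p) + ennreal (2 powr p * D powr p) * ?I"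
        unfolding B(1) using B(2) by (simp only: ennreal_plus ennreal_mult'' mult_nonneg_nonneg powr_ge_zero)
      finally show ?thesis using V(3)[OF x] x by simp
    qed
  qed simp
  have [measurable]: "(\<lambda>(x, t). ?G (c + t *\<^sub>R (x - c)) * indicator {s..1} t) \<in> borel_measurable (lborel \<Otimes>\<^sub>M lborel)"
    by measurable
  have 1: "(\<integral>\<^sup>+x. ?F (c + s *\<^sub>R (x - c)) \<partial>lborel) = ennreal (1 / s ^ DIM('a)) * (\<integral>\<^sup>+x. ?F x \<partial>lborel)"
    using s by (intro nn_integral_contraction) auto
  have "(\<integral>\<^sup>+x. (\<integral>\<^sup>+t. ?G (c + t *\<^sub>R (x - c)) * indicator {s..1} t \<partial>lborel) \<partial>lborel) =
    (\<integral>\<^sup>+t. (\<integral>\<^sup>+x. ?G (c + t *\<^sub>R (x - c)) * indicator {s..1} t \<partial>lborel) \<partial>lborel)"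
    by (rule lborel_pair.Fubini'[symmetric]) measurable
  also have "\<dots> \<le> (\<integral>\<^sup>+t. ennreal (1 / s ^ DIM('a)) * (\<integral>\<^sup>+x. ?G x \<partial>lborel) * indicator {s..1} t \<partial>lborel)"
  proof (rule nn_integral_mono)
    fix t :: real
    show "(\<integral>\<^sup>+x. ?G (c + t *\<^sub>R (x - c)) * indicator {s..1} t \<partial>lborel) \<le>
      ennreal (1 / s ^ DIM('a)) * (\<integral>\<^sup>+x. ?G x \<partial>lborel) * indicator {s..1} t"
    proof (cases "t \<in> {s..1}")
      case True
      have "(\<integral>\<^sup>+x. ?G (c + t *\<^sub>R (x - c)) \<partial>lborel) = ennreal (1 / t ^ DIM('a)) * (\<integral>\<^sup>+x. ?G x \<partial>lborel)"
        using s True by (intro nn_integral_contraction) auto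
      also have "\<dots> \<le> ennreal (1 / s ^ DIM('a)) * (\<integral>\<^sup>+x. ?G x \<partial>lborel)"
        using s True by (intro mult_right_mono ennreal_leI divide_left_mono power_mono) auto
      finally show ?thesis using True by simp
    qed simp
  qed
  also have "\<dots> = ennreal (1 / s ^ DIM('a)) * (\<integral>\<^sup>+x. ?G x \<partial>lborel) * ennreal (1 - s)"
    using s by (simp add: nn_integral_cmult_indicator)
  also have "\<dots> \<le> ennreal (1 / s ^ DIM('a)) * (\<integral>\<^sup>+x. ?G x \<partial>lborel) * 1"
    using s by (intro mult_left_mono) auto
  finally have 2: "(\<integral>\<^sup>+x. (\<integral>\<^sup>+t. ?G (c + t *\<^sub>R (x - c)) * indicator {s..1} t \<partial>lborel) \<partial>lborel) \<le>
      ennreal (1 / s ^ DIM('a)) * (\<integral>\<^sup>+x. ?G x \<partial>lborel)" by simp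
  have "(\<integral>\<^sup>+x\<in>Q. ennreal (\<bar>f x\<bar> powr p) \<partial>lborel) \<le> (\<integral>\<^sup>+x. ennreal (2 powr p) * ?F (c + s *\<^sub>R (x - c)) +
      ennreal (2 powr p * D powr p) * (\<integral>\<^sup>+t. ?G (c + t *\<^sub>R (x - c)) * indicator {s..1} t \<partial>lborel) \<partial>lborel)"
    by (intro nn_integral_mono pt)
  also have "\<dots> = ennreal (2 powr p) * (\<integral>\<^sup>+x. ?F (c + s *\<^sub>R (x - c)) \<partial>lborel) +
      ennreal (2 powr p * D powr p) * (\<integral>\<^sup>+x. (\<integral>\<^sup>+t. ?G (c + t *\<^sub>R (x - c)) * indicator {s..1} t \<partial>lborel) \<partial>lborel)"
    by (subst nn_integral_add) (auto simp: nn_integral_cmult)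
  also have "\<dots> \<le> ennreal (2 powr p) * (ennreal (1 / s ^ DIM('a)) * (\<integral>\<^sup>+x. ?F x \<partial>lborel)) +
      ennreal (2 powr p * D powr p) * (ennreal (1 / s ^ DIM('a)) * (\<integral>\<^sup>+x. ?G x \<partial>lborel))"
    unfolding 1 by (intro add_left_mono mult_left_mono 2) simp
  finally show ?thesis using s by (simp add: mult.assoc[symmetric] ennreal_mult[symmetric])
qed

section \<open>Change of variables over an arbitrary finite index type\<close>

text \<open>The change of variables theorem is stated for index types which are well-ordered. A general finite
  type is replaced by an initial segment of the natural numbers of the same cardinality, and
  measures and determinants are transported along a relabelling of the coordinates.\<close>
typedef 'n fin_index = "{..<CARD('n::finite)}"
  by (rule exI[of _ 0]) simp

instantiation fin_index :: (finite) wellorder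
begin

definition less_eq_fin_index :: "'a fin_index \<Rightarrow> 'a fin_index \<Rightarrow> bool" where
  "x \<le> y \<longleftrightarrow> Rep_fin_index x \<le> Rep_fin_index y"

definition less_fin_index :: "'a fin_index \<Rightarrow> 'a fin_index \<Rightarrow> bool" where
  "x < y \<longleftrightarrow> Rep_fin_index x < Rep_fin_index y"

instance
proof
  fix P :: "'a fin_index \<Rightarrow> bool" and a
  assume step: "\<And>x. (\<And>y. y < x \<Longrightarrow> P y) \<Longrightarrow> P x"
  show "P a"
    by (induction a rule: measure_induct_rule[of Rep_fin_index]) (auto intro: step simp: less_fin_index_def)
qed (auto simp: less_eq_fin_index_def less_fin_index_def Rep_fin_index_inject)

end

instance fin_index :: (finite) finite
proof
  have "(UNIV :: 'a fin_index set) = Abs_fin_index ` {..<CARD('a)}"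
    by (metis type_definition.Abs_image type_definition_fin_index)
  then show "finite (UNIV :: 'a fin_index set)" by (metis finite_imageI finite_lessThan)
qed

lemma ex_bij_fin_index: "\<exists>\<sigma> :: 'n::finite fin_index \<Rightarrow> 'n. bij \<sigma>"
proof -
  have "(UNIV :: 'n fin_index set) = Abs_fin_index ` {..<CARD('n)}"
    by (metis type_definition.Abs_image type_definition_fin_index)
  moreover have "inj_on (Abs_fin_index :: nat \<Rightarrow> 'n fin_index) {..<CARD('n)}"
    by (auto simp: inj_on_def Abs_fin_index_inject)
  ultimately have "card (UNIV :: 'n fin_index set) = CARD('n)" by (metis card_image card_lessThan)
  then show ?thesis using finite_same_card_bij[of "UNIV :: 'n fin_index set" "UNIV :: 'n set"] by auto
qed

definition reindex :: "('m \<Rightarrow> 'n) \<Rightarrow> real ^ 'n \<Rightarrow> real ^ 'm" where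
  "reindex \<sigma> y = (\<chi> i. y $ \<sigma> i)"

lemma reindex_inverse:
  assumes "bij \<sigma>"
  shows "reindex \<sigma> (reindex (inv \<sigma>) x) = x" "reindex (inv \<sigma>) (reindex \<sigma> y) = y"
  using assms by (simp_all add: reindex_def vec_eq_iff bij_is_inj bij_is_surj surj_f_inv_f)

lemma linear_reindex: "linear (reindex \<sigma> :: real ^ 'n::finite \<Rightarrow> real ^ 'm::finite)"
  by (rule linearI) (simp_all add: reindex_def vec_eq_iff)

lemma bounded_linear_reindex: "bounded_linear (reindex \<sigma> :: real ^ 'n::finite \<Rightarrow> real ^ 'm::finite)"
  by (simp add: linear_reindex linear_linear)

lemma reindex_measurable[measurable]: "(reindex \<sigma> :: real ^ 'n::finite \<Rightarrow> real ^ 'm::finite) \<in> borel_measurable borel"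
  by (intro borel_measurable_continuous_onI linear_continuous_on bounded_linear_reindex)

lemma prod_Basis_cart: "(\<Prod>b\<in>Basis. f (x \<bullet> b)) = (\<Prod>i\<in>UNIV. f (x $ i))" for x :: "real ^ 'n::finite"
proof -
  have B: "(Basis :: (real ^ 'n) set) = (\<lambda>i. axis i 1) ` UNIV" by (auto simp: Basis_vec_def)
  have "inj (\<lambda>i::'n. axis i (1::real))" by (auto simp: inj_on_def axis_eq_axis)
  then show ?thesis unfolding B by (simp add: prod.reindex inner_axis)
qed

lemma distr_lborel_reindex:
  fixes \<sigma> :: "'m::finite \<Rightarrow> 'n::finite"
  assumes \<sigma>: "bij \<sigma>"
  shows "distr lborel borel (reindex \<sigma>) = (lborel :: (real ^ 'm) measure)"
proof (rule lborel_eqI[symmetric])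
  fix l u :: "real ^ 'm"
  assume lu: "\<And>b. b \<in> Basis \<Longrightarrow> l \<bullet> b \<le> u \<bullet> b"
  let ?R = "reindex (inv \<sigma>) :: real ^ 'm \<Rightarrow> real ^ 'n"
  have iv: "\<And>i. inv \<sigma> (\<sigma> i) = i" "\<And>j. \<sigma> (inv \<sigma> j) = j"
    using \<sigma> by (auto simp: bij_is_inj bij_is_surj surj_f_inv_f)
  have lu': "l $ i \<le> u $ i" for i using lu[of "axis i 1"] by (simp add: axis_in_Basis_iff inner_axis)
  have "reindex \<sigma> -` box l u = box (?R l) (?R u)"
    unfolding set_eq_iff vimage_eq mem_box_cart reindex_def vec_lambda_beta by (metis iv)
  then have "emeasure (distr lborel borel (reindex \<sigma>)) (box l u) = emeasure lborel (box (?R l) (?R u))"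
    by (simp add: emeasure_distr)
  also have "\<dots> = (\<Prod>b\<in>Basis. (?R u - ?R l) \<bullet> b)"
    by (rule emeasure_lborel_box) (auto simp: Basis_vec_def inner_axis reindex_def lu')
  also have "(\<Prod>b\<in>Basis. (?R u - ?R l) \<bullet> b) = (\<Prod>j\<in>UNIV. (u - l) $ inv \<sigma> j)"
    using prod_Basis_cart[of "\<lambda>x. x" "?R u - ?R l"] by (simp add: reindex_def)
  also have "\<dots> = (\<Prod>i\<in>UNIV. (u - l) $ i)"
    using \<sigma> by (intro prod.reindex_bij_betw bij_imp_bij_inv)
  also have "\<dots> = (\<Prod>b\<in>Basis. (u - l) \<bullet> b)"
    using prod_Basis_cart[of "\<lambda>x. x" "u - l"] by simp
  finally show "emeasure (distr lborel borel (reindex \<sigma>)) (box l u) = (\<Prod>b\<in>Basis. (u - l) \<bullet> b)" .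
qed simp

text \<open>In the Leibniz formula, conjugation with \<open>\<sigma>\<close> is a sign preserving bijection between the permutations
  of the two index types.\<close>
lemma det_reindex:
  fixes A :: "real ^ 'n::finite ^ 'n" and \<sigma> :: "'m::finite \<Rightarrow> 'n"
  assumes \<sigma>: "bij \<sigma>"
  shows "det (\<chi> i j. A $ \<sigma> i $ \<sigma> j) = det A"
proof -
  let ?T = "map_permutation UNIV \<sigma>" and ?U = "map_permutation UNIV (inv \<sigma>)"
  have iv: "\<And>i. inv \<sigma> (\<sigma> i) = i" "\<And>j. \<sigma> (inv \<sigma> j) = j"
    using \<sigma> by (auto simp: bij_is_inj bij_is_surj surj_f_inv_f)
  have inj: "inj \<sigma>" "surj \<sigma>" using \<sigma> by (auto simp: bij_is_inj bij_is_surj)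
  have ii: "inj (inv \<sigma>)" "surj (inv \<sigma>)" using bij_imp_bij_inv[OF \<sigma>] by (auto simp: bij_is_inj bij_is_surj)
  have invinv: "inv (inv \<sigma>) = \<sigma>" using \<sigma> by (rule inv_inv_eq)
  have T: "?T p j = \<sigma> (p (inv \<sigma> j))" for p j using inj by (simp add: map_permutation_def restrict_id_def)
  have U: "?U p i = inv \<sigma> (p (\<sigma> i))" for p i using ii invinv by (simp add: map_permutation_def restrict_id_def)
  have bij: "bij_betw ?T {p. p permutes UNIV} {p. p permutes UNIV}"
    by (rule bij_betw_byWitness[where f' = ?U])
      (auto simp: T U iv intro!: ext map_permutation_permutes[of _ UNIV] \<sigma> bij_imp_bij_inv)
  have "det A = (\<Sum>p | p permutes UNIV. of_int (sign (?T p)) * (\<Prod>j\<in>UNIV. A $ j $ ?T p j))"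
    unfolding det_def by (rule sum.reindex_bij_betw[OF bij, symmetric])
  also have "\<dots> = (\<Sum>p | p permutes UNIV. of_int (sign p) * (\<Prod>i\<in>UNIV. A $ \<sigma> i $ \<sigma> (p i)))"
  proof (rule sum.cong[OF refl])
    fix p :: "'m \<Rightarrow> 'm" assume "p \<in> {p. p permutes UNIV}"
    then have "sign (?T p) = sign p" using inj by (intro sign_map_permutation) auto
    moreover have "(\<Prod>j\<in>UNIV. A $ j $ ?T p j) = (\<Prod>i\<in>UNIV. A $ \<sigma> i $ ?T p (\<sigma> i))"
      by (rule prod.reindex_bij_betw[OF \<sigma>, symmetric])
    ultimately show "of_int (sign (?T p)) * (\<Prod>j\<in>UNIV. A $ j $ ?T p j) =
      of_int (sign p) * (\<Prod>i\<in>UNIV. A $ \<sigma> i $ \<sigma> (p i))" by (simp add: T iv)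
  qed
  finally show ?thesis by (simp add: det_def)
qed

lemma emeasure_differentiable_image_wellorder:
  fixes h :: "real ^ 'n::{finite,wellorder} \<Rightarrow> real ^ 'n::_"
  assumes S: "S \<in> sets borel" "h ` S \<in> sets borel"
    and h: "\<And>x. x \<in> S \<Longrightarrow> (h has_derivative h' x) (at x within S)" and inj: "inj_on h S"
    and m: "(\<lambda>x. \<bar>det (matrix (h' x))\<bar> * indicator S x) \<in> borel_measurable borel"
  shows "emeasure lborel (h ` S) = (\<integral>\<^sup>+x\<in>S. ennreal \<bar>det (matrix (h' x))\<bar> \<partial>lborel)" (is "_ = ?I")
proof -
  have SL: "S \<in> sets lebesgue" using S by simp
  have iff: "h ` S \<in> lmeasurable \<and> measure lebesgue (h ` S) = m \<longleftrightarrow>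
      ((\<lambda>x. \<bar>det (matrix (h' x))\<bar>) has_integral m) S" for m
    by (rule has_measure_differentiable_image[OF SL _ inj]) (rule h)
  have eq: "emeasure lborel (h ` S) = emeasure lebesgue (h ` S)" using S by simp
  have I: "?I = (\<integral>\<^sup>+x. ennreal (\<bar>det (matrix (h' x))\<bar> * indicator S x) \<partial>lborel)"
    by (rule nn_integral_cong) (auto simp: indicator_def)
  show ?thesis
  proof (cases ?I)
    case (real r)
    have "((\<lambda>x. \<bar>det (matrix (h' x))\<bar> * indicator S x) has_integral r) UNIV"
      using real m I by (intro nn_integral_has_integral) auto
    also have "(\<lambda>x. \<bar>det (matrix (h' x))\<bar> * indicator S x) = (\<lambda>x. if x \<in> S then \<bar>det (matrix (h' x))\<bar> else 0)"
      by (auto simp: indicator_def)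
    finally have "h ` S \<in> lmeasurable \<and> measure lebesgue (h ` S) = r"
      unfolding has_integral_restrict_UNIV by (rule iff[THEN iffD2])
    then show ?thesis unfolding eq real by (simp add: emeasure_eq_measure2 fmeasurableD2)
  next
    case top
    show ?thesis
    proof (rule ccontr)
      assume "emeasure lborel (h ` S) \<noteq> ?I"
      then have "emeasure lebesgue (h ` S) < \<infinity>"
        unfolding eq[symmetric] top by (simp add: less_top)
      then have "h ` S \<in> lmeasurable" using S by (intro fmeasurableI) auto
      then have "((\<lambda>x. \<bar>det (matrix (h' x))\<bar>) has_integral measure lebesgue (h ` S)) S"
        using iff[of "measure lebesgue (h ` S)"] by simp
      from nn_integral_has_integral_lebesgue'[OF _ this] show False using top by simp
    qed
  qed
qed

text \<open>Conjugating \<open>h\<close> with the relabelling of coordinates does not change the measures or the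
  Jacobian determinant.\<close>
theorem emeasure_differentiable_image:
  fixes h :: "real ^ 'n::finite \<Rightarrow> real ^ 'n"
  assumes S: "S \<in> sets borel" "h ` S \<in> sets borel"
    and h: "\<And>x. x \<in> S \<Longrightarrow> (h has_derivative h' x) (at x within S)" and inj: "inj_on h S"
    and m: "(\<lambda>x. \<bar>det (matrix (h' x))\<bar> * indicator S x) \<in> borel_measurable borel"
  shows "emeasure lborel (h ` S) = (\<integral>\<^sup>+x\<in>S. ennreal \<bar>det (matrix (h' x))\<bar> \<partial>lborel)"
proof -
  obtain \<sigma> :: "'n fin_index \<Rightarrow> 'n" where \<sigma>: "bij \<sigma>" using ex_bij_fin_index by blast
  have iv: "\<And>i. inv \<sigma> (\<sigma> i) = i" "\<And>j. \<sigma> (inv \<sigma> j) = j"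
    using \<sigma> by (auto simp: bij_is_inj bij_is_surj surj_f_inv_f)
  let ?P = "reindex \<sigma> :: real ^ 'n \<Rightarrow> real ^ 'n fin_index" and ?Q = "reindex (inv \<sigma>) :: real ^ 'n fin_index \<Rightarrow> real ^ 'n"
  have PQ: "?P (?Q x) = x" "?Q (?P y) = y" for x y by (rule reindex_inverse[OF \<sigma>])+
  have imP: "?P ` X = ?Q -` X" for X by (auto simp: PQ image_iff) (metis PQ(1))?
  let ?h = "?P \<circ> h \<circ> ?Q" and ?h' = "\<lambda>x. ?P \<circ> h' (?Q x) \<circ> ?Q"
  have lebP: "emeasure lborel (?P ` X) = emeasure lborel X" if "X \<in> sets borel" for X
  proof -
    have "emeasure lborel X = emeasure (distr lborel borel ?Q) X"
      using distr_lborel_reindex[OF bij_imp_bij_inv[OF \<sigma>]] by simp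
    then show ?thesis unfolding imP using that by (simp add: emeasure_distr)
  qed
  have det: "det (matrix (?h' x)) = det (matrix (h' (?Q x)))" for x
  proof -
    have "matrix (?h' x) = (\<chi> i j. matrix (h' (?Q x)) $ \<sigma> i $ \<sigma> j)"
    proof -
      have "?Q (axis j 1) = axis (\<sigma> j) 1" for j
        by (auto simp: reindex_def axis_def vec_eq_iff iv)
      then show ?thesis by (simp add: matrix_def vec_eq_iff reindex_def)
    qed
    then show ?thesis by (simp add: det_reindex[OF \<sigma>])
  qed
  have him: "?h ` (?P ` S) = ?P ` (h ` S)" by (auto simp: PQ image_image)
  have "emeasure lborel (h ` S) = emeasure lborel (?h ` (?P ` S))"
    unfolding him by (rule lebP[symmetric, OF S(2)])
  also have "\<dots> = (\<integral>\<^sup>+x\<in>?P ` S. ennreal \<bar>det (matrix (?h' x))\<bar> \<partial>lborel)"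
  proof (rule emeasure_differentiable_image_wellorder)
    show "?P ` S \<in> sets borel" unfolding imP using measurable_sets[OF reindex_measurable S(1), of "inv \<sigma>"] by simp
    show "?h ` ?P ` S \<in> sets borel" 
      using measurable_sets[OF reindex_measurable S(2), of "inv \<sigma>"] by (subst him, subst imP) simp
    show "inj_on ?h (?P ` S)"
    proof (rule inj_onI)
      fix x y assume xy: "x \<in> ?P ` S" "y \<in> ?P ` S" "?h x = ?h y"
      then have "h (?Q x) = h (?Q y)" by (metis PQ(2) comp_apply)
      moreover have "?Q x \<in> S" "?Q y \<in> S" using xy by (auto simp: PQ)
      ultimately show "x = y" using inj by (metis PQ(1) inj_onD)
    qed
    show "(?h has_derivative ?h' x) (at x within ?P ` S)" if x: "x \<in> ?P ` S" for x
    proof -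
      have Qx: "?Q x \<in> S" "?Q ` ?P ` S = S" using x by (auto simp: PQ image_image)
      have 1: "(?Q has_derivative ?Q) (at x within ?P ` S)"
        by (rule bounded_linear_imp_has_derivative[OF bounded_linear_reindex])
      have "((h \<circ> ?Q) has_derivative (h' (?Q x) \<circ> ?Q)) (at x within ?P ` S)"
        using diff_chain_within[OF 1, of h "h' (?Q x)"] h[OF Qx(1)] Qx(2) by simp
      from diff_chain_within[OF this bounded_linear_imp_has_derivative[OF bounded_linear_reindex[of \<sigma>]]]
      show ?thesis by (simp add: comp_assoc)
    qed
    have "(\<lambda>x. \<bar>det (matrix (?h' x))\<bar> * indicator (?P ` S) x) = (\<lambda>x. (\<lambda>y. \<bar>det (matrix (h' y))\<bar> * indicator S y) (?Q x))"
      unfolding det imP by (auto simp: indicator_def)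
    then show "(\<lambda>x. \<bar>det (matrix (?h' x))\<bar> * indicator (?P ` S) x) \<in> borel_measurable borel"
      using measurable_compose[OF reindex_measurable m] by simp
  qed
  also have "\<dots> = (\<integral>\<^sup>+x. (\<lambda>y. ennreal (\<bar>det (matrix (h' y))\<bar> * indicator S y)) (?Q x) \<partial>lborel)"
    unfolding det imP by (rule nn_integral_cong) (auto simp: indicator_def)
  also have "\<dots> = (\<integral>\<^sup>+y. ennreal (\<bar>det (matrix (h' y))\<bar> * indicator S y) \<partial>distr lborel borel ?Q)"
    using m by (subst nn_integral_distr) auto
  also have "\<dots> = (\<integral>\<^sup>+x\<in>S. ennreal \<bar>det (matrix (h' x))\<bar> \<partial>lborel)"
    unfolding distr_lborel_reindex[OF bij_imp_bij_inv[OF \<sigma>]]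
    by (rule nn_integral_cong) (auto simp: indicator_def)
  finally show ?thesis .
qed

section \<open>Positive definite matrices\<close>

lemma continuous_on_det [continuous_intros]:
  fixes M :: "'a::topological_space \<Rightarrow> real ^ 'n::finite ^ 'n"
  assumes "continuous_on S M"
  shows "continuous_on S (\<lambda>x. det (M x))"
  unfolding det_def by (intro continuous_intros assms)

definition pos_def :: "real ^ 'n::finite ^ 'n \<Rightarrow> bool" where
  "pos_def G \<longleftrightarrow> transpose G = G \<and> (\<forall>v. v \<noteq> 0 \<longrightarrow> v \<bullet> (G *v v) > 0)"

lemma pos_def_mat_1: "pos_def (mat 1)"
  by (simp add: pos_def_def)

lemma pos_def_nonneg: "pos_def G \<Longrightarrow> 0 \<le> v \<bullet> (G *v v)"
  by (cases "v = 0") (auto simp: pos_def_def less_imp_le)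

lemma pos_def_det_nonzero:
  assumes "\<And>v. v \<noteq> 0 \<Longrightarrow> v \<bullet> (G *v v) > 0" shows "det (G :: real ^ 'n::finite ^ 'n) \<noteq> 0"
proof -
  have "x = 0" if "G *v x = 0" for x using assms[of x] that by (cases "x = 0") auto
  then have "invertible G" unfolding invertible_left_inverse matrix_left_invertible_ker by blast
  then show ?thesis by (simp add: invertible_det_nz)
qed

text \<open>On the segment from the identity matrix to \<open>G\<close> all matrices are positive definite, hence the
  determinant does not vanish on it.\<close>
lemma pos_def_det_pos:
  fixes G :: "real ^ 'n::finite ^ 'n"
  assumes "pos_def G" shows "det G > 0"
proof (rule ccontr)
  let ?M = "\<lambda>t. t *\<^sub>R G + (1 - t) *\<^sub>R mat 1 :: real ^ 'n ^ 'n"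
  have nz: "det (?M t) \<noteq> 0" if t: "t \<in> {0..1}" for t
  proof (rule pos_def_det_nonzero)
    fix v :: "real ^ 'n" assume v: "v \<noteq> 0"
    have "?M t *v v = t *\<^sub>R (G *v v) + (1 - t) *\<^sub>R v"
      by (simp add: matrix_vector_mult_add_rdistrib scaleR_matrix_vector_assoc[symmetric])
    then have "v \<bullet> (?M t *v v) = t * (v \<bullet> (G *v v)) + (1 - t) * (v \<bullet> v)"
      by (simp add: inner_add_right)
    also have "\<dots> > 0"
    proof (cases "t = 0")
      case False
      then have "t * (v \<bullet> (G *v v)) > 0" using t v assms by (simp add: pos_def_def)
      then show ?thesis using t by (intro add_pos_nonneg) auto
    qed (use v in auto)
    finally show "v \<bullet> (?M t *v v) > 0" .
  qed
  have c: "continuous_on {0..1} (\<lambda>t. det (?M t))" by (intro continuous_intros)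
  assume "\<not> det G > 0"
  then have "det (?M 1) \<le> 0" "0 \<le> det (?M 0)" by auto
  then obtain t where "0 \<le> t" "t \<le> 1" "det (?M t) = 0"
    using IVT2'[of "\<lambda>t. det (?M t)" 1 0 0] c by auto
  then show False using nz by auto
qed

lemma pos_def_cauchy_schwarz:
  assumes G: "pos_def G"
  shows "\<bar>v \<bullet> (G *v w)\<bar> \<le> sqrt (v \<bullet> (G *v v)) * sqrt (w \<bullet> (G *v w))"
proof (cases "w = 0")
  case False
  define b where "b = w \<bullet> (G *v w)"
  have b: "b > 0" using G False by (simp add: pos_def_def b_def)
  define a where "a = v \<bullet> (G *v w)"
  have sym: "w \<bullet> (G *v v) = a"
    using G unfolding a_def pos_def_def by (metis dot_lmul_matrix inner_commute transpose_matrix_vector)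
  have "0 \<le> (v - (a / b) *\<^sub>R w) \<bullet> (G *v (v - (a / b) *\<^sub>R w))" by (rule pos_def_nonneg[OF G])
  also have "\<dots> = v \<bullet> (G *v v) - a / b * a - a / b * a + a / b * (a / b) * b"
    by (simp add: matrix_vector_mult_diff_distrib matrix_vector_mult_scaleR inner_diff_left inner_diff_right sym
        a_def[symmetric] b_def[symmetric] algebra_simps)
  also have "\<dots> = v \<bullet> (G *v v) - a\<^sup>2 / b" using b by (simp add: field_simps power2_eq_square)
  finally have "a\<^sup>2 \<le> (v \<bullet> (G *v v)) * b" using b by (simp add: field_simps)
  then have "sqrt (a\<^sup>2) \<le> sqrt ((v \<bullet> (G *v v)) * b)" by (rule real_sqrt_le_mono)
  then show ?thesis by (simp add: real_sqrt_mult a_def b_def)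
qed simp

section \<open>Charts\<close>

lemma is_chartD:
  assumes "is_chart c"
  shows "open (chart_dom c)" "open (coord c ` chart_dom c)"
    "continuous_on (chart_dom c) (coord c)" "continuous_on (coord c ` chart_dom c) (coord_inv c)"
    "\<And>x. x \<in> chart_dom c \<Longrightarrow> coord_inv c (coord c x) = x"
  using assms unfolding is_chart_def homeomorphism_def by blast+

lemma chart_image_eq_vimage:
  assumes c: "is_chart c" and U: "U \<subseteq> chart_dom c"
  shows "coord c ` U = coord c ` chart_dom c \<inter> coord_inv c -` U"
  using U by (auto simp: is_chartD(5)[OF c] subsetD[OF U])

lemma open_chart_image:
  assumes c: "is_chart c" and U: "open U" "U \<subseteq> chart_dom c"
  shows "open (coord c ` U)"
  unfolding chart_image_eq_vimage[OF c U(2)]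
  by (rule continuous_open_preimage[OF is_chartD(4,2)[OF c] U(1)])

lemma smooth_on_continuous: "smooth_on S f \<Longrightarrow> continuous_on S f"
  unfolding smooth_on_def by (metis Ck_on.simps(1))

lemma smooth_onD:
  assumes "smooth_on S f"
  shows "x \<in> S \<Longrightarrow> f differentiable (at x)" "continuous_on S (\<lambda>x. frechet_derivative f (at x) v)"
proof -
  have "Ck_on (Suc 0) S f" using assms unfolding smooth_on_def by (rule spec)
  then have "(\<forall>x\<in>S. f differentiable (at x)) \<and> (\<forall>v. continuous_on S (\<lambda>x. frechet_derivative f (at x) v))"
    by simp
  then show "x \<in> S \<Longrightarrow> f differentiable (at x)" "continuous_on S (\<lambda>x. frechet_derivative f (at x) v)"
    by blast+
qed

definition differential :: "('m, 'n::finite) chart \<Rightarrow> ('m \<Rightarrow> real) \<Rightarrow> 'm \<Rightarrow> real ^ 'n" where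
  "differential c f x = (\<chi> j. frechet_derivative (f \<circ> coord_inv c) (at (coord c x)) (axis j 1))"

lemma has_derivative_differential:
  assumes "(f \<circ> coord_inv c) differentiable (at (coord c x))"
  shows "((f \<circ> coord_inv c) has_derivative (\<lambda>v. differential c f x \<bullet> v)) (at (coord c x))"
proof -
  let ?F = "frechet_derivative (f \<circ> coord_inv c) (at (coord c x))"
  have F: "((f \<circ> coord_inv c) has_derivative ?F) (at (coord c x))"
    using assms frechet_derivative_works by blast
  interpret linear ?F using has_derivative_linear[OF F] .
  have "?F v = differential c f x \<bullet> v" for v
  proof -
    have "?F v = ?F (\<Sum>j\<in>UNIV. v $ j *\<^sub>R axis j 1)" using basis_expansion[of v] by (simp add: scalar_mult_eq_scaleR)
    also have "\<dots> = (\<Sum>j\<in>UNIV. v $ j * ?F (axis j 1))" by (simp add: sum scaleR)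
    finally show ?thesis by (simp add: differential_def inner_vec_def mult.commute)
  qed
  then have "?F = (\<lambda>v. differential c f x \<bullet> v)" by (rule ext)
  then show ?thesis using F by simp
qed

lemma admissible_of_atlas:
  "smooth_manifold A \<Longrightarrow> c \<in> A \<Longrightarrow> admissible_chart A c"
  unfolding smooth_manifold_def admissible_chart_def by blast

lemma chart_at:
  assumes "smooth_manifold A"
  shows "chart_at A x \<in> A" "x \<in> chart_dom (chart_at A x)"
proof -
  have "\<exists>c. c \<in> A \<and> x \<in> chart_dom c" using assms unfolding smooth_manifold_def by blast
  from someI_ex[OF this] show "chart_at A x \<in> A" "x \<in> chart_dom (chart_at A x)"
    unfolding chart_at_def by blast+
qed

lemma transition_differentiable:
  assumes "admissible_chart A d" "c \<in> A" "x \<in> chart_dom c" "x \<in> chart_dom d"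
  shows "(coord d \<circ> coord_inv c) differentiable (at (coord c x))"
    "(coord c \<circ> coord_inv d) differentiable (at (coord d x))"
proof -
  have "smoothly_compatible d c" using assms by (simp add: admissible_chart_def)
  then have "smooth_on (coord c ` (chart_dom d \<inter> chart_dom c)) (coord d \<circ> coord_inv c)"
    "smooth_on (coord d ` (chart_dom d \<inter> chart_dom c)) (coord c \<circ> coord_inv d)"
    by (simp_all add: smoothly_compatible_def)
  from this[THEN smooth_onD(1)] show "(coord d \<circ> coord_inv c) differentiable (at (coord c x))"
    "(coord c \<circ> coord_inv d) differentiable (at (coord d x))" using assms by auto
qed

lemma has_derivative_transition:
  assumes c: "is_chart c" and d: "is_chart d" and x: "x \<in> chart_dom c" "x \<in> chart_dom d"
    and h: "((coord d \<circ> coord_inv c) has_derivative h) (at (coord c x))"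
    and F: "((f \<circ> coord_inv d) has_derivative F) (at (coord d x))"
  shows "((f \<circ> coord_inv c) has_derivative (F \<circ> h)) (at (coord c x))"
proof -
  let ?W = "coord c ` (chart_dom c \<inter> chart_dom d)"
  have 1: "((f \<circ> coord_inv d) \<circ> (coord d \<circ> coord_inv c) has_derivative (F \<circ> h)) (at (coord c x))"
  proof (rule diff_chain_at[OF h])
    show "((f \<circ> coord_inv d) has_derivative F) (at ((coord d \<circ> coord_inv c) (coord c x)))"
      unfolding comp_apply is_chartD(5)[OF c x(1)] using F by (simp add: comp_def)
  qed
  have 2: "open ?W" using is_chartD(1)[OF c] is_chartD(1)[OF d] by (intro open_chart_image c) auto
  have 3: "((f \<circ> coord_inv d) \<circ> (coord d \<circ> coord_inv c)) u = (f \<circ> coord_inv c) u" if "u \<in> ?W" for u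
    using that by (auto simp: is_chartD(5)[OF c] is_chartD(5)[OF d])
  show ?thesis
    by (rule has_derivative_transform_within_open[OF 1 2 _ 3]) (use x in auto)
qed

section \<open>The gradient norm in an arbitrary chart\<close>

text \<open>\<open>G\<close> is the matrix of the metric at \<open>x\<close> in the chart \<open>d\<close>. The chart need not belong to the atlas:
  for the isometric coordinates of an end \<open>G\<close> is the identity matrix.\<close>
definition metric_matrix_at ::
    "('m::topological_space, 'n::finite) chart set \<Rightarrow> ('m, 'n) metric_coeffs \<Rightarrow> ('m, 'n) chart \<Rightarrow> 'm \<Rightarrow> real ^ 'n ^ 'n \<Rightarrow> bool" where
  "metric_matrix_at A g d x G \<longleftrightarrow> x \<in> chart_dom d \<and> pos_def G \<and>
     (\<forall>c\<in>A. x \<in> chart_dom c \<longrightarrow>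
       g c x = transpose (transition_jacobian c d x) ** G ** transition_jacobian c d x)"

lemma riemannian_metricD:
  assumes "riemannian_metric A g" "c \<in> A"
  shows "smooth_on (coord c ` chart_dom c) (g c \<circ> coord_inv c)"
    and "x \<in> chart_dom c \<Longrightarrow> pos_def (g c x)"
    and "d \<in> A \<Longrightarrow> x \<in> chart_dom c \<Longrightarrow> x \<in> chart_dom d \<Longrightarrow>
      g c x = transpose (transition_jacobian c d x) ** g d x ** transition_jacobian c d x"
  using assms unfolding riemannian_metric_def pos_def_def by blast+

lemma metric_matrix_at_atlas:
  assumes "riemannian_metric A g" "d \<in> A" "x \<in> chart_dom d"
  shows "metric_matrix_at A g d x (g d x)"
  using riemannian_metricD(2)[OF assms] riemannian_metricD(3)[OF assms(1)] assms(2,3)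
  unfolding metric_matrix_at_def by blast

lemma differentiable_in_chart:
  assumes A: "smooth_manifold A" and d: "admissible_chart A d" and f: "smooth_compactly_supported A f"
    and x: "x \<in> chart_dom d"
  shows "((f \<circ> coord_inv d) has_derivative (\<lambda>v. differential d f x \<bullet> v)) (at (coord d x))"
proof (rule has_derivative_differential)
  let ?c = "chart_at A x"
  note c = chart_at[OF A, of x]
  have ch: "is_chart ?c" "is_chart d" using admissible_of_atlas[OF A c(1)] d unfolding admissible_chart_def by blast+
  have "(f \<circ> coord_inv ?c) differentiable (at (coord ?c x))"
    using f c smooth_onD(1) unfolding smooth_compactly_supported_def by blast
  then obtain F where F: "((f \<circ> coord_inv ?c) has_derivative F) (at (coord ?c x))" by (auto simp: differentiable_def)
  obtain k where k: "((coord ?c \<circ> coord_inv d) has_derivative k) (at (coord d x))"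
    using transition_differentiable(2)[OF d c(1) c(2) x] by (auto simp: differentiable_def)
  show "(f \<circ> coord_inv d) differentiable (at (coord d x))"
    using has_derivative_transition[OF ch(2,1) x c(2) k F] by (auto simp: differentiable_def)
qed

text \<open>The gradient norm does not depend on the chart. If \<open>w\<^sub>0\<close> are the coordinates of the gradient in
  the chart \<open>chart_at A x\<close> and \<open>J\<close> is the Jacobian matrix of the transition to \<open>d\<close>, then \<open>w = J w\<^sub>0\<close>
  are its coordinates in \<open>d\<close>: both sides of \<open>G w = df\<close> agree after multiplication with the invertible
  transpose of \<open>J\<close>.\<close>
lemma gradient_norm_in_chart:
  assumes A: "smooth_manifold A" and g: "riemannian_metric A g" and d: "admissible_chart A d"
    and f: "smooth_compactly_supported A f" and G: "metric_matrix_at A g d x G"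
  obtains w where "G *v w = differential d f x" "gradient_norm A g f x = sqrt (w \<bullet> (G *v w))"
proof -
  let ?c = "chart_at A x"
  note c = chart_at[OF A, of x]
  have x: "x \<in> chart_dom d" using G unfolding metric_matrix_at_def by blast
  have ch: "is_chart ?c" "is_chart d" using admissible_of_atlas[OF A c(1)] d unfolding admissible_chart_def by blast+
  define J where "J = transition_jacobian ?c d x"
  have gJ: "g ?c x = transpose J ** G ** J" using G c unfolding metric_matrix_at_def J_def by blast
  define D Dc where "D = differential d f x" and "Dc = differential ?c f x"
  have h: "((coord d \<circ> coord_inv ?c) has_derivative (\<lambda>v. J *v v)) (at (coord ?c x))"
    using transition_differentiable(1)[OF d c(1) c(2) x] unfolding J_def transition_jacobian_def jacobian_works .
  have 1: "((f \<circ> coord_inv ?c) has_derivative ((\<lambda>v. D \<bullet> v) \<circ> (\<lambda>v. J *v v))) (at (coord ?c x))"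
    unfolding D_def
    by (rule has_derivative_transition[OF ch c(2) x h differentiable_in_chart[OF A d f x]])
  have 2: "((f \<circ> coord_inv ?c) has_derivative (\<lambda>v. Dc \<bullet> v)) (at (coord ?c x))"
    unfolding Dc_def by (rule differentiable_in_chart[OF A admissible_of_atlas[OF A c(1)] f c(2)])
  have "Dc \<bullet> v = (transpose J *v D) \<bullet> v" for v
    using has_derivative_unique[OF 1 2] by (metis comp_apply dot_lmul_matrix transpose_matrix_vector)
  then have Dc: "Dc = transpose J *v D" using vector_eq_rdot[of Dc "transpose J *v D"] by blast
  have detg: "det (g ?c x) \<noteq> 0"
    using pos_def_det_pos[OF riemannian_metricD(2)[OF g c]] by simp
  then have detJ: "det (transpose J) \<noteq> 0" unfolding gJ det_mul by auto
  define w0 where "w0 = matrix_inv (g ?c x) *v Dc"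
  have "g ?c x ** matrix_inv (g ?c x) = mat 1"
    using detg unfolding invertible_det_nz[symmetric] invertible_def matrix_inv_def by (metis (mono_tags, lifting) someI_ex)
  then have w0: "g ?c x *v w0 = Dc" by (simp add: w0_def matrix_vector_mul_assoc)
  have "transpose J *v (G *v (J *v w0)) = transpose J *v D"
    using w0 unfolding gJ Dc by (simp add: matrix_vector_mul_assoc matrix_mul_assoc)
  then have GD: "G *v (J *v w0) = D"
    using inj_matrix_vector_mult[OF detJ[folded invertible_det_nz]] by (rule injD[rotated])
  have "gradient_norm A g f x = sqrt (w0 \<bullet> (g ?c x *v w0))"
    by (simp add: gradient_norm_def tangent_norm_def gradient_def Let_def w0_def Dc_def differential_def)
  also have "w0 \<bullet> (g ?c x *v w0) = (J *v w0) \<bullet> (G *v (J *v w0))"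
    unfolding w0 Dc GD transpose_matrix_vector by (subst (1 2) inner_commute) (rule dot_lmul_matrix)
  finally show ?thesis using that GD by (simp add: D_def)
qed

lemma gradient_norm_nonneg:
  assumes "smooth_manifold A" "riemannian_metric A g"
  shows "0 \<le> gradient_norm A g f x"
proof -
  have "pos_def (g (chart_at A x) x)"
    by (rule riemannian_metricD(2)[OF assms(2) chart_at[OF assms(1)]])
  then show ?thesis by (simp add: gradient_norm_def tangent_norm_def pos_def_nonneg)
qed

text \<open>With \<open>w\<close> the gradient, \<open>df(v)\<close> is the inner product of \<open>w\<close> and \<open>v\<close> with respect to the metric,
  so Cauchy--Schwarz yields a bound in which only an upper bound of the metric occurs.\<close>
lemma abs_differential_le:
  assumes A: "smooth_manifold A" and g: "riemannian_metric A g" and d: "admissible_chart A d"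
    and f: "smooth_compactly_supported A f" and G: "metric_matrix_at A g d x G"
    and L: "0 \<le> L" "\<And>v. v \<bullet> (G *v v) \<le> L\<^sup>2 * (norm v)\<^sup>2"
  shows "\<bar>differential d f x \<bullet> v\<bar> \<le> L * gradient_norm A g f x * norm v"
proof -
  obtain w where w: "G *v w = differential d f x" "gradient_norm A g f x = sqrt (w \<bullet> (G *v w))"
    by (rule gradient_norm_in_chart[OF A g d f G])
  have pd: "pos_def G" using G unfolding metric_matrix_at_def by blast
  have "\<bar>differential d f x \<bullet> v\<bar> = \<bar>v \<bullet> (G *v w)\<bar>" by (simp add: w(1) inner_commute)
  also have "\<dots> \<le> sqrt (v \<bullet> (G *v v)) * sqrt (w \<bullet> (G *v w))" by (rule pos_def_cauchy_schwarz[OF pd])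
  also have "\<dots> \<le> (L * norm v) * gradient_norm A g f x"
    unfolding w(2) using L by (intro mult_right_mono real_le_lsqrt) (auto simp: power_mult_distrib pos_def_nonneg pd)
  finally show ?thesis by (simp add: mult_ac)
qed

lemma continuous_on_via_atlas:
  fixes h :: "'m::{t2_space,second_countable_topology} \<Rightarrow> 'b::topological_space"
    and A :: "('m, 'n::finite) chart set"
  assumes A: "smooth_manifold A" and h: "\<And>c. c \<in> A \<Longrightarrow> continuous_on (coord c ` chart_dom c) (h \<circ> coord_inv c)"
  shows "continuous_on UNIV h"
proof -
  have "isCont h x" for x
  proof -
    let ?c = "chart_at A x"
    note c = chart_at[OF A, of x]
    have ch: "is_chart ?c" using A c unfolding smooth_manifold_def by blast
    have "continuous_on (chart_dom ?c) ((h \<circ> coord_inv ?c) \<circ> coord ?c)"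
      by (rule continuous_on_compose[OF is_chartD(3)[OF ch] h[OF c(1)]])
    then have "continuous_on (chart_dom ?c) h"
      by (rule continuous_on_eq) (simp add: is_chartD(5)[OF ch])
    then show ?thesis using c(2) is_chartD(1)[OF ch] by (simp add: continuous_on_eq_continuous_at)
  qed
  then show ?thesis by (simp add: continuous_at_imp_continuous_on)
qed

lemma smooth_compactly_supported_continuous:
  assumes "smooth_manifold A" "smooth_compactly_supported A f"
  shows "continuous_on UNIV f"
  by (rule continuous_on_via_atlas[OF assms(1)])
    (use assms(2) smooth_on_continuous in \<open>unfold smooth_compactly_supported_def, blast\<close>)

lemma continuous_on_differential:
  assumes c: "is_chart c" and f: "smooth_on (coord c ` chart_dom c) (f \<circ> coord_inv c)"
  shows "continuous_on (coord c ` chart_dom c) (\<lambda>u. differential c f (coord_inv c u))"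
proof -
  have "continuous_on (coord c ` chart_dom c) (\<lambda>u. \<chi> j. frechet_derivative (f \<circ> coord_inv c) (at u) (axis j 1))"
    by (intro continuous_on_vec_lambda smooth_onD(2)[OF f])
  then show ?thesis
    by (rule continuous_on_eq) (auto simp: differential_def is_chartD(5)[OF c])
qed

text \<open>In a chart of the atlas the gradient is given by Cramer's rule, whose terms are continuous. In
  particular the gradient norm is a Borel function although \<open>chart_at A\<close> need not depend measurably
  on the point.\<close>
lemma continuous_gradient_norm:
  assumes A: "smooth_manifold A" and g: "riemannian_metric A g" and f: "smooth_compactly_supported A f"
  shows "continuous_on UNIV (gradient_norm A g f)"
proof (rule continuous_on_via_atlas[OF A])
  fix c assume c: "c \<in> A"
  have ch: "is_chart c" using A c unfolding smooth_manifold_def by blast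
  let ?V = "coord c ` chart_dom c" and ?D = "\<lambda>u. differential c f (coord_inv c u)" and ?G = "g c \<circ> coord_inv c"
  let ?w = "\<lambda>u. (\<chi> k. det (\<chi> i j. if j = k then ?D u $ i else ?G u $ i $ j) / det (?G u)) :: real ^ 'b"
  have D: "continuous_on ?V ?D"
    using f c continuous_on_differential[OF ch] unfolding smooth_compactly_supported_def by blast
  have G: "continuous_on ?V ?G" by (rule smooth_on_continuous[OF riemannian_metricD(1)[OF g c]])
  have pd: "metric_matrix_at A g c (coord_inv c u) (?G u)" if "u \<in> ?V" for u
    using that metric_matrix_at_atlas[OF g c, of "coord_inv c u"] by (auto simp: is_chartD(5)[OF ch])
  have det: "det (?G u) \<noteq> 0" if "u \<in> ?V" for u
    using pos_def_det_pos[of "?G u"] pd[OF that] unfolding metric_matrix_at_def by force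
  have W: "continuous_on ?V ?w"
  proof (intro continuous_on_vec_lambda continuous_on_divide continuous_on_det G)
    fix k i j
    show "continuous_on ?V (\<lambda>u. if j = k then ?D u $ i else ?G u $ i $ j)"
      by (cases "j = k") (auto intro!: continuous_intros D G[unfolded comp_def])
  qed (use det in auto)
  have "continuous_on ?V (\<lambda>u. sqrt (?w u \<bullet> ?D u))"
    by (rule continuous_on_real_sqrt[OF continuous_on_inner[OF W D]])
  then show "continuous_on ?V (gradient_norm A g f \<circ> coord_inv c)"
  proof (rule continuous_on_eq)
    fix u assume u: "u \<in> ?V"
    obtain w where w: "?G u *v w = ?D u" "gradient_norm A g f (coord_inv c u) = sqrt (w \<bullet> (?G u *v w))"
      by (rule gradient_norm_in_chart[OF A g admissible_of_atlas[OF A c] f pd[OF u]])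
    have "w = ?w u" using cramer[OF det[OF u], of w "?D u"] w(1) by simp
    then show "sqrt (?w u \<bullet> ?D u) = (gradient_norm A g f \<circ> coord_inv c) u" using w by simp
  qed
qed

lemma gradient_norm_outside_support:
  assumes A: "smooth_manifold A" and x: "x \<notin> closure {x. f x \<noteq> 0}"
  shows "gradient_norm A g f x = 0"
proof -
  let ?c = "chart_at A x" and ?W = "- closure {x. f x \<noteq> 0}"
  note c = chart_at[OF A, of x]
  have ch: "is_chart ?c" using A c unfolding smooth_manifold_def by blast
  let ?V = "coord ?c ` (chart_dom ?c \<inter> ?W)"
  have V: "open ?V" using is_chartD(1)[OF ch] by (intro open_chart_image ch) auto
  have eq: "0 = (f \<circ> coord_inv ?c) u" if u: "u \<in> ?V" for u
  proof -
    obtain y where y: "y \<in> chart_dom ?c" "y \<in> ?W" "u = coord ?c y" using u by blast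
    have "f y = 0" using y(2) closure_subset[of "{x. f x \<noteq> 0}"] by blast
    then show ?thesis by (simp add: y(3) is_chartD(5)[OF ch y(1)])
  qed
  have "coord ?c x \<in> ?V" using c x by blast
  then have "((f \<circ> coord_inv ?c) has_derivative (\<lambda>v. 0)) (at (coord ?c x))"
    by (rule has_derivative_transform_within_open[OF has_derivative_const V _ eq])
  then have "frechet_derivative (f \<circ> coord_inv ?c) (at (coord ?c x)) = (\<lambda>v. 0)"
    by (rule frechet_derivative_at[symmetric])
  then have "gradient A g f x = 0"
    by (simp add: gradient_def Let_def vec_eq_iff matrix_vector_mult_def)
  then show ?thesis by (simp add: gradient_norm_def tangent_norm_def)
qed

lemma upper_gradient_in_chart:
  assumes A: "smooth_manifold A" and g: "riemannian_metric A g" and d: "admissible_chart A d"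
    and f: "smooth_compactly_supported A f" and U: "U \<subseteq> chart_dom d"
    and G: "\<And>x. x \<in> U \<Longrightarrow> metric_matrix_at A g d x (G x)"
    and L: "0 \<le> L" "\<And>x v. x \<in> U \<Longrightarrow> v \<bullet> (G x *v v) \<le> L\<^sup>2 * (norm v)\<^sup>2"
  shows "upper_gradient (coord d ` U) (f \<circ> coord_inv d) (\<lambda>u. L * gradient_norm A g f (coord_inv d u))"
  unfolding upper_gradient_def
proof (intro conjI ballI)
  have ch: "is_chart d" using d by (simp add: admissible_chart_def)
  have "continuous_on (coord d ` U) (coord_inv d)"
    by (rule continuous_on_subset[OF is_chartD(4)[OF ch]]) (use U in auto)
  then show "continuous_on (coord d ` U) (\<lambda>u. L * gradient_norm A g f (coord_inv d u))"
    by (intro continuous_intros continuous_on_compose2[OF continuous_gradient_norm[OF A g f]]) auto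
  fix u assume "u \<in> coord d ` U"
  then obtain x where x: "x \<in> U" "u = coord d x" by auto
  then have xd: "x \<in> chart_dom d" and inv: "coord_inv d u = x" using U by (auto simp: is_chartD(5)[OF ch])
  show "0 \<le> L * gradient_norm A g f (coord_inv d u)" using L gradient_norm_nonneg[OF A g] by simp
  show "\<exists>f'. ((f \<circ> coord_inv d) has_derivative f') (at u) \<and>
      (\<forall>v. \<bar>f' v\<bar> \<le> L * gradient_norm A g f (coord_inv d u) * norm v)"
    unfolding x(2) is_chartD(5)[OF ch xd]
    using differentiable_in_chart[OF A d f xd] abs_differential_le[OF A g d f G[OF x(1)] L(1) L(2)[OF x(1)]] 
    by blast
qed

section \<open>Measures in charts\<close>

lemma borel_preimage_continuous_on:
  fixes f :: "'a::topological_space \<Rightarrow> 'b::topological_space"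
  assumes f: "continuous_on S f" and S: "open S" and B: "B \<in> sets borel"
  shows "S \<inter> f -` B \<in> sets borel"
proof -
  have "f -` B \<inter> space (restrict_space borel S) \<in> sets (restrict_space borel S)"
    by (rule measurable_sets[OF borel_measurable_continuous_on_restrict[OF f] B])
  then show ?thesis using S by (auto simp: space_restrict_space sets_restrict_space_iff Int_commute)
qed

lemma borel_chart_image:
  assumes c: "is_chart c" and B: "B \<in> sets borel" "B \<subseteq> chart_dom c"
  shows "coord c ` B \<in> sets borel"
  unfolding chart_image_eq_vimage[OF c B(2)]
  by (rule borel_preimage_continuous_on[OF is_chartD(4,2)[OF c] B(1)])

text \<open>A comparison of measures of sets is a comparison of measures, and hence of integrals: compare
  the restriction of \<open>\<mu>\<close> to \<open>U\<close> with the image of Lebesgue measure under the inverse of the chart.\<close>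
lemma nn_integral_in_chart:
  fixes d :: "('m::topological_space, 'n::finite) chart"
  assumes \<mu>: "sets \<mu> = sets borel" and d: "is_chart d" and U: "open U" "U \<subseteq> chart_dom d"
    and h: "h \<in> borel_measurable borel"
  shows "(\<And>B. B \<in> sets borel \<Longrightarrow> B \<subseteq> U \<Longrightarrow> emeasure \<mu> B \<le> L * emeasure lborel (coord d ` B)) \<Longrightarrow>
      (\<integral>\<^sup>+x\<in>U. h x \<partial>\<mu>) \<le> L * (\<integral>\<^sup>+u\<in>coord d ` U. h (coord_inv d u) \<partial>lborel)" (is "PROP ?P1 \<Longrightarrow> ?C1")
    and "(\<And>B. B \<in> sets borel \<Longrightarrow> B \<subseteq> U \<Longrightarrow> emeasure lborel (coord d ` B) \<le> L * emeasure \<mu> B) \<Longrightarrow>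
      (\<integral>\<^sup>+u\<in>coord d ` U. h (coord_inv d u) \<partial>lborel) \<le> L * (\<integral>\<^sup>+x\<in>U. h x \<partial>\<mu>)" (is "PROP ?P2 \<Longrightarrow> ?C2")
proof -
  let ?V = "coord d ` U" and ?\<psi> = "coord_inv d"
  have V: "open ?V" by (rule open_chart_image[OF d U])
  have Vb: "?V \<in> sets borel" using V by simp
  have \<psi>c: "continuous_on ?V ?\<psi>" using is_chartD(4)[OF d] U(2) by (rule continuous_on_subset[OF _ image_mono])
  have hm: "h \<in> borel_measurable \<mu>" using h \<mu> by (simp cong: measurable_cong_sets)
  have Um: "U \<in> sets \<mu>" using U \<mu> by simp
  have \<psi>m: "?\<psi> \<in> measurable (restrict_space lborel ?V) borel"
    using borel_measurable_continuous_on_restrict[OF \<psi>c] by (simp add: measurable_def sets_restrict_space space_restrict_space)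
  define N where "N = distr (restrict_space lborel ?V) borel ?\<psi>"
  have N: "emeasure N B = emeasure lborel (coord d ` (B \<inter> U))" if B: "B \<in> sets borel" for B
  proof -
    have "?\<psi> -` B \<inter> space (restrict_space lborel ?V) = coord d ` (B \<inter> U)"
      using U(2) is_chartD(5)[OF d] by (force simp: space_restrict_space)
    then have "emeasure N B = emeasure (restrict_space lborel ?V) (coord d ` (B \<inter> U))"
      unfolding N_def using emeasure_distr[OF \<psi>m B] by simp
    also have "\<dots> = emeasure lborel (coord d ` (B \<inter> U))"
      using Vb by (intro emeasure_restrict_space) auto
    finally show ?thesis .
  qed
  have sN: "sets N = sets borel" by (simp add: N_def)
  have hN: "h \<in> borel_measurable N" using h by (simp add: sN cong: measurable_cong_sets)
  have iN: "(\<integral>\<^sup>+x. h x \<partial>N) = (\<integral>\<^sup>+u\<in>?V. h (?\<psi> u) \<partial>lborel)"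
    unfolding N_def using Vb h by (subst nn_integral_distr[OF \<psi>m]) (auto simp: nn_integral_restrict_space)
  define M where "M = density \<mu> (indicator U)"
  have sM: "sets M = sets borel" by (simp add: M_def \<mu>)
  have M: "emeasure M B = emeasure \<mu> (B \<inter> U)" if "B \<in> sets borel" for B
    unfolding M_def using that \<mu> Um by (subst emeasure_density) (auto simp: indicator_inter_arith[symmetric] Int_commute)
  have hM: "h \<in> borel_measurable M" using h by (simp add: sM cong: measurable_cong_sets)
  have iM: "(\<integral>\<^sup>+x. h x \<partial>M) = (\<integral>\<^sup>+x\<in>U. h x \<partial>\<mu>)"
    unfolding M_def using hm Um by (simp add: nn_integral_density mult.commute)
  have scaled: "(\<integral>\<^sup>+x. h x \<partial>M1) \<le> L * (\<integral>\<^sup>+x. h x \<partial>M2)"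
    if s: "sets M1 = sets borel" "sets M2 = sets borel" and le: "\<And>B. B \<in> sets borel \<Longrightarrow> emeasure M1 B \<le> L * emeasure M2 B"
    for M1 M2
  proof -
    have hM2: "h \<in> borel_measurable M2" using h by (simp add: s cong: measurable_cong_sets)
    have "M1 \<le> density M2 (\<lambda>_. L)"
      using s le by (subst le_measure) (auto simp: emeasure_density_const)
    then have "(\<integral>\<^sup>+x. h x \<partial>M1) \<le> (\<integral>\<^sup>+x. h x \<partial>density M2 (\<lambda>_. L))"
      using s by (intro nn_integral_mono_measure) auto
    also have "\<dots> = L * (\<integral>\<^sup>+x. h x \<partial>M2)"
      using hM2 by (simp add: nn_integral_density nn_integral_cmult)
    finally show ?thesis .
  qed
  show ?C1 if le: "PROP ?P1"
    unfolding iM[symmetric] iN[symmetric] by (rule scaled[OF sM sN]) (use le U in \<open>auto simp: M N\<close>)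
  show ?C2 if le: "PROP ?P2"
    unfolding iM[symmetric] iN[symmetric] by (rule scaled[OF sN sM]) (use le U in \<open>auto simp: M N\<close>)
qed

text \<open>In the coordinates \<open>d\<close> on \<open>U\<close>, the derivative of a test function is at most \<open>L\<close> times its gradient
  norm, and volumes are distorted by at most the factor \<open>L\<close> in either direction; this is what it
  takes to carry over the Euclidean inequalities. The set \<open>U\<close> is kept separate from the chart domain because
  \<open>coord_inv\<close> depends on the domain of the chart.\<close>
definition comparable_chart ::
    "('m::topological_space, 'n::finite) chart set \<Rightarrow> ('m, 'n) metric_coeffs \<Rightarrow> 'm measure \<Rightarrow>
     ('m, 'n) chart \<Rightarrow> 'm set \<Rightarrow> real \<Rightarrow> bool" where
  "comparable_chart A g \<mu> d U L \<longleftrightarrow>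
     is_chart d \<and> open U \<and> U \<subseteq> chart_dom d \<and> 0 < L \<and>
     (\<forall>f. smooth_compactly_supported A f \<longrightarrow>
        upper_gradient (coord d ` U) (f \<circ> coord_inv d) (\<lambda>u. L * gradient_norm A g f (coord_inv d u))) \<and>
     (\<forall>B\<in>sets borel. B \<subseteq> U \<longrightarrow>
        emeasure \<mu> B \<le> ennreal L * emeasure lborel (coord d ` B) \<and>
        emeasure lborel (coord d ` B) \<le> ennreal L * emeasure \<mu> B)"

lemma riemannian_measureD:
  assumes "riemannian_measure A g \<mu>"
  shows "sets \<mu> = sets borel"
    and "c \<in> A \<Longrightarrow> B \<in> sets borel \<Longrightarrow> B \<subseteq> chart_dom c \<Longrightarrow>
      emeasure \<mu> B = (\<integral>\<^sup>+ u\<in>coord c ` B. ennreal (sqrt (det (g c (coord_inv c u)))) \<partial>lborel)"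
  using assms unfolding riemannian_measure_def by blast+

lemma cube_subset_cball: "0 < e \<Longrightarrow> cube u (e / DIM('a)) \<subseteq> cball (u :: 'a::euclidean_space) e"
proof
  fix x assume e: "0 < e" and x: "x \<in> cube u (e / DIM('a))"
  have "norm (x - u) \<le> (\<Sum>b\<in>Basis. \<bar>(x - u) \<bullet> b\<bar>)" by (rule norm_le_l1)
  also have "\<dots> \<le> (\<Sum>b\<in>(Basis::'a set). e / DIM('a))"
    using x by (intro sum_mono) (auto simp: mem_cube less_imp_le)
  also have "\<dots> = e" by simp
  finally show "x \<in> cball u e" by (simp add: dist_norm norm_minus_commute)
qed

lemma matrix_form_le:
  fixes G :: "real ^ 'n::finite ^ 'n"
  shows "v \<bullet> (G *v v) \<le> (\<Sum>i\<in>UNIV. \<Sum>j\<in>UNIV. \<bar>G $ i $ j\<bar>) * (norm v)\<^sup>2"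
proof -
  have "v \<bullet> (G *v v) = (\<Sum>i\<in>UNIV. \<Sum>j\<in>UNIV. v $ i * (G $ i $ j * v $ j))"
    by (simp add: inner_vec_def matrix_vector_mult_def sum_distrib_left)
  also have "\<dots> \<le> (\<Sum>i\<in>UNIV. \<Sum>j\<in>UNIV. \<bar>G $ i $ j\<bar> * (norm v)\<^sup>2)"
  proof (intro sum_mono)
    fix i j
    have "v $ i * (G $ i $ j * v $ j) \<le> \<bar>G $ i $ j\<bar> * (\<bar>v $ i\<bar> * \<bar>v $ j\<bar>)"
      using abs_ge_self[of "v $ i * (G $ i $ j * v $ j)"] by (simp add: abs_mult mult_ac)
    also have "\<dots> \<le> \<bar>G $ i $ j\<bar> * (norm v * norm v)"
      by (intro mult_left_mono mult_mono component_le_norm_cart) auto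
    finally show "v $ i * (G $ i $ j * v $ j) \<le> \<bar>G $ i $ j\<bar> * (norm v)\<^sup>2" by (simp add: power2_eq_square)
  qed
  also have "\<dots> = (\<Sum>i\<in>UNIV. \<Sum>j\<in>UNIV. \<bar>G $ i $ j\<bar>) * (norm v)\<^sup>2" by (simp add: sum_distrib_right)
  finally show ?thesis .
qed

lemma metric_bounded_on_compact:
  fixes A :: "('m::{t2_space, second_countable_topology}, 'n::finite) chart set"
  assumes A: "smooth_manifold A" and g: "riemannian_metric A g" and c: "c \<in> A"
    and Z: "compact Z" "Z \<subseteq> coord c ` chart_dom c"
  obtains L where "1 \<le> L" "\<And>u v. u \<in> Z \<Longrightarrow> v \<bullet> ((g c \<circ> coord_inv c) u *v v) \<le> L\<^sup>2 * (norm v)\<^sup>2"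
proof -
  let ?G = "g c \<circ> coord_inv c"
  define S where "S u = (\<Sum>i\<in>UNIV. \<Sum>j\<in>UNIV. \<bar>?G u $ i $ j\<bar>)" for u
  have "continuous_on Z ?G"
    using smooth_on_continuous[OF riemannian_metricD(1)[OF g c]] Z(2) by (rule continuous_on_subset)
  then have "continuous_on Z S" unfolding S_def
    by (intro continuous_on_sum continuous_on_rabs continuous_on_component)
  then have "bounded (S ` Z)" by (intro compact_imp_bounded compact_continuous_image Z)
  then obtain b where b: "\<And>u. u \<in> Z \<Longrightarrow> S u \<le> b" unfolding bounded_real by (metis abs_le_D1 imageI)
  define L where "L = max 1 b"
  have L: "1 \<le> L" "b \<le> L\<^sup>2"
  proof -
    show 1: "1 \<le> L" by (simp add: L_def)
    then have "L \<le> L\<^sup>2" by (simp add: power2_eq_square mult_le_cancel_right1)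
    then show "b \<le> L\<^sup>2" by (simp add: L_def)
  qed
  have "v \<bullet> (?G u *v v) \<le> L\<^sup>2 * (norm v)\<^sup>2" if "u \<in> Z" for u v
  proof -
    have "v \<bullet> (?G u *v v) \<le> S u * (norm v)\<^sup>2" unfolding S_def by (rule matrix_form_le)
    also have "\<dots> \<le> L\<^sup>2 * (norm v)\<^sup>2" by (intro mult_right_mono order_trans[OF b[OF that] L(2)]) simp
    finally show ?thesis .
  qed
  with L(1) show ?thesis by (rule that)
qed

text \<open>On a closed ball in the chart the metric coefficients and the positive function \<open>det g\<close> are
  bounded, and the latter also away from zero.\<close>
lemma comparable_chart_local:
  fixes A :: "('m::{t2_space, second_countable_topology}, 'n::finite) chart set"
  assumes A: "smooth_manifold A" and g: "riemannian_metric A g" and \<mu>: "riemannian_measure A g \<mu>"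
    and c: "c \<in> A" and x: "x \<in> chart_dom c" and W: "open W" "x \<in> W"
  obtains U L r where "x \<in> U" "U \<subseteq> W" "comparable_chart A g \<mu> c U L" "0 < r" "coord c ` U = cube (coord c x) r"
proof -
  have ch: "is_chart c" using A c unfolding smooth_manifold_def by blast
  let ?V = "coord c ` chart_dom c" and ?G = "g c \<circ> coord_inv c"
  have "open (coord c ` (chart_dom c \<inter> W))"
    using is_chartD(1)[OF ch] W(1) by (intro open_chart_image ch) auto
  then obtain e where e0: "0 < e" "cball (coord c x) e \<subseteq> coord c ` (chart_dom c \<inter> W)"
    using x W(2) unfolding open_contains_cball by blast
  then have e: "0 < e" "cball (coord c x) e \<subseteq> ?V" by blast+
  let ?Z = "cball (coord c x) e" and ?r = "e / DIM(real ^ 'n)"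
  have G: "continuous_on ?Z ?G"
    using smooth_on_continuous[OF riemannian_metricD(1)[OF g c]] e(2) by (rule continuous_on_subset)
  have Zne: "?Z \<noteq> {}" using e by auto
  have pd: "pos_def (?G u)" if u: "u \<in> ?V" for u
  proof -
    obtain y where "y \<in> chart_dom c" "u = coord c y" using u by blast
    then show ?thesis using riemannian_metricD(2)[OF g c] by (simp add: is_chartD(5)[OF ch])
  qed
  have cd: "continuous_on ?Z (\<lambda>u. sqrt (det (?G u)))" by (intro continuous_on_real_sqrt continuous_on_det G)
  obtain u1 where u1: "u1 \<in> ?Z" "\<And>u. u \<in> ?Z \<Longrightarrow> sqrt (det (?G u1)) \<le> sqrt (det (?G u))"
    using continuous_attains_inf[OF compact_cball Zne cd] by blast
  obtain u2 where u2: "u2 \<in> ?Z" "\<And>u. u \<in> ?Z \<Longrightarrow> sqrt (det (?G u)) \<le> sqrt (det (?G u2))"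
    using continuous_attains_sup[OF compact_cball Zne cd] by blast
  obtain L0 where L0: "1 \<le> L0" "\<And>u v. u \<in> ?Z \<Longrightarrow> v \<bullet> (?G u *v v) \<le> L0\<^sup>2 * (norm v)\<^sup>2"
    using metric_bounded_on_compact[OF A g c compact_cball e(2)] by blast
  define \<delta> where "\<delta> = sqrt (det (?G u1))"
  have \<delta>: "0 < \<delta>" using pos_def_det_pos[OF pd, of u1] u1 e(2) by (auto simp: \<delta>_def)
  define L where "L = Max {L0, sqrt (det (?G u2)), 1 / \<delta>}"
  have L: "L0 \<le> L" "sqrt (det (?G u2)) \<le> L" "1 / \<delta> \<le> L"
    unfolding L_def by (auto intro!: Max_ge)
  have L1: "1 \<le> L" using L0(1) L(1) by simp
  define U where "U = chart_dom c \<inter> coord c -` cube (coord c x) ?r"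
  have r: "0 < ?r" using e by simp
  have QZ: "cube (coord c x) ?r \<subseteq> ?Z" by (rule cube_subset_cball[OF e(1)])
  have Uo: "open U" unfolding U_def
    by (rule continuous_open_preimage[OF is_chartD(3,1)[OF ch] open_cube])
  have Uc: "U \<subseteq> chart_dom c" by (auto simp: U_def)
  have UO: "U \<subseteq> W"
  proof
    fix y assume y: "y \<in> U"
    then have "coord c y \<in> coord c ` (chart_dom c \<inter> W)" using QZ e0(2) unfolding U_def by blast
    then obtain z where "z \<in> chart_dom c" "z \<in> W" "coord c y = coord c z" by blast
    then show "y \<in> W" using y Uc is_chartD(5)[OF ch] by (metis subsetD)
  qed
  have im: "coord c ` U = cube (coord c x) ?r" using QZ e(2) unfolding U_def by blast
  have xU: "x \<in> U" using x r by (simp add: U_def mem_cube)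
  have inZ: "coord c y \<in> ?Z" if "y \<in> U" for y using that QZ by (auto simp: U_def)
  have "comparable_chart A g \<mu> c U L"
    unfolding comparable_chart_def
  proof (intro conjI allI impI ballI ch Uo Uc)
    show "0 < L" using L1 by simp
    fix f assume f: "smooth_compactly_supported A f"
    show "upper_gradient (coord c ` U) (f \<circ> coord_inv c) (\<lambda>u. L * gradient_norm A g f (coord_inv c u))"
    proof (rule upper_gradient_in_chart[OF A g admissible_of_atlas[OF A c] f Uc])
      show "metric_matrix_at A g c y (g c y)" if "y \<in> U" for y
        using that Uc by (intro metric_matrix_at_atlas[OF g c]) auto
      show "0 \<le> L" using L1 by simp
      fix y :: 'm and v :: "real ^ 'n" assume y: "y \<in> U"
      have "v \<bullet> (g c y *v v) \<le> L0\<^sup>2 * (norm v)\<^sup>2"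
        using L0(2)[OF inZ[OF y], of v] y Uc by (simp add: is_chartD(5)[OF ch] subsetD)
      also have "\<dots> \<le> L\<^sup>2 * (norm v)\<^sup>2"
        using L0(1) L(1) by (intro mult_right_mono power_mono) auto
      finally show "v \<bullet> (g c y *v v) \<le> L\<^sup>2 * (norm v)\<^sup>2" .
    qed
  next
    fix B assume B: "B \<in> sets borel" "B \<subseteq> U"
    have Bc: "coord c ` B \<in> sets lborel" using borel_chart_image[OF ch B(1)] B Uc by auto
    have muB: "emeasure \<mu> B = (\<integral>\<^sup>+ u\<in>coord c ` B. ennreal (sqrt (det (?G u))) \<partial>lborel)"
      using riemannian_measureD(2)[OF \<mu> c B(1)] B(2) Uc by auto
    have "emeasure \<mu> B \<le> (\<integral>\<^sup>+ u. ennreal L * indicator (coord c ` B) u \<partial>lborel)"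
      unfolding muB
    proof (rule nn_integral_mono)
      fix u
      show "ennreal (sqrt (det (?G u))) * indicator (coord c ` B) u \<le> ennreal L * indicator (coord c ` B) u"
      proof (cases "u \<in> coord c ` B")
        case True
        then have u: "u \<in> ?Z" using B(2) inZ by blast
        show ?thesis by (intro mult_right_mono ennreal_leI order_trans[OF u2(2)[OF u] L(2)]) simp
      qed simp
    qed
    then show "emeasure \<mu> B \<le> ennreal L * emeasure lborel (coord c ` B)"
      using nn_integral_cmult_indicator[OF Bc, of "ennreal L"] by simp
    have "(\<integral>\<^sup>+ u. ennreal (1 / L) * indicator (coord c ` B) u \<partial>lborel) \<le> emeasure \<mu> B"
      unfolding muB
    proof (rule nn_integral_mono)
      fix u
      show "ennreal (1 / L) * indicator (coord c ` B) u \<le> ennreal (sqrt (det (?G u))) * indicator (coord c ` B) u"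
      proof (cases "u \<in> coord c ` B")
        case True
        then have u: "u \<in> ?Z" using B(2) inZ by blast
        have "1 / L \<le> \<delta>" using L1 L(3) \<delta> by (simp add: field_simps)
        then have "1 / L \<le> sqrt (det (?G u))" unfolding \<delta>_def by (rule order_trans[OF _ u1(2)[OF u]])
        then show ?thesis by (intro mult_right_mono ennreal_leI) auto
      qed simp
    qed
    then have "ennreal (1 / L) * emeasure lborel (coord c ` B) \<le> emeasure \<mu> B"
      using nn_integral_cmult_indicator[OF Bc, of "ennreal (1 / L)"] by simp
    then have "ennreal L * (ennreal (1 / L) * emeasure lborel (coord c ` B)) \<le> ennreal L * emeasure \<mu> B"
      by (rule mult_left_mono) simp
    moreover have "ennreal L * ennreal (1 / L) = 1" using L1 by (simp flip: ennreal_mult)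
    ultimately show "emeasure lborel (coord c ` B) \<le> ennreal L * emeasure \<mu> B"
      by (simp add: mult.assoc[symmetric])
  qed
  then show ?thesis using that xU UO r im by blast
qed

section \<open>The Euclidean ends\<close>

text \<open>The metric being \<open>J\<^sup>T J\<close> in a chart of the atlas, its density \<open>\<surd>det g\<close> is the absolute Jacobian determinant of
  the transition to the coordinates \<open>\<phi>\<close>. The change of variables formula settles sets inside one
  chart domain; in general, split into countably many such sets.\<close>
lemma emeasure_end:
  fixes A :: "('m::{t2_space, second_countable_topology}, 'n::finite) chart set"
  assumes A: "smooth_manifold A" and g: "riemannian_metric A g" and \<mu>: "riemannian_measure A g \<mu>"
    and d: "admissible_chart A (E, \<phi>)"
    and J: "\<And>c x. c \<in> A \<Longrightarrow> x \<in> E \<Longrightarrow> x \<in> chart_dom c \<Longrightarrow>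
        g c x = transpose (transition_jacobian c (E, \<phi>) x) ** transition_jacobian c (E, \<phi>) x"
    and B: "B \<in> sets borel" "B \<subseteq> E"
  shows "emeasure \<mu> B = emeasure lborel (\<phi> ` B)"
proof -
  have chd: "is_chart (E, \<phi>)" using d unfolding admissible_chart_def by blast
  have inv: "coord_inv (E, \<phi>) (\<phi> x) = x" if "x \<in> E" for x using is_chartD(5)[OF chd] that by simp
  have inj: "inj_on \<phi> E" by (rule inj_on_inverseI[of E "coord_inv (E, \<phi>)" \<phi>, OF inv])
  have 1: "emeasure \<mu> C = emeasure lborel (\<phi> ` C)"
    if c: "c \<in> A" and C: "C \<in> sets borel" "C \<subseteq> E" "C \<subseteq> chart_dom c" for c C
  proof -
    have ch: "is_chart c" using A c unfolding smooth_manifold_def by blast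
    let ?h = "\<phi> \<circ> coord_inv c" and ?S = "coord c ` C"
    let ?J = "\<lambda>u. transition_jacobian c (E, \<phi>) (coord_inv c u)"
    have im: "?h ` ?S = \<phi> ` C" using C(3) by (force simp: is_chartD(5)[OF ch] image_image)
    have S: "?S \<in> sets borel" by (rule borel_chart_image[OF ch C(1,3)])
    have hS: "?h ` ?S \<in> sets borel" unfolding im using borel_chart_image[OF chd C(1)] C(2) by simp
    have det: "\<bar>det (?J u)\<bar> = sqrt (det (g c (coord_inv c u)))" if u: "u \<in> ?S" for u
    proof -
      obtain x where x: "x \<in> C" "u = coord c x" using u by blast
      have "coord_inv c u = x" using x C(3) by (auto simp: is_chartD(5)[OF ch])
      then show ?thesis using J[OF c, of x] x C by (simp add: det_mul subsetD)
    qed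
    have cd: "continuous_on (coord c ` chart_dom c) (\<lambda>u. sqrt (det ((g c \<circ> coord_inv c) u)))"
      by (intro continuous_on_real_sqrt continuous_on_det smooth_on_continuous[OF riemannian_metricD(1)[OF g c]])
    have "continuous_on ?S (\<lambda>u. sqrt (det (g c (coord_inv c u))))"
      using continuous_on_subset[OF cd image_mono[OF C(3)]] by simp
    from borel_measurable_continuous_on_indicator[OF S this]
    have "(\<lambda>u. indicator ?S u *\<^sub>R sqrt (det (g c (coord_inv c u)))) \<in> borel_measurable borel" .
    also have "(\<lambda>u. indicator ?S u *\<^sub>R sqrt (det (g c (coord_inv c u)))) =
        (\<lambda>u. \<bar>det (matrix (\<lambda>v. ?J u *v v))\<bar> * indicator ?S u)"
      using det by (auto simp: indicator_def fun_eq_iff)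
    finally have m: "(\<lambda>u. \<bar>det (matrix (\<lambda>v. ?J u *v v))\<bar> * indicator ?S u) \<in> borel_measurable borel" .
    have "emeasure lborel (?h ` ?S) = (\<integral>\<^sup>+u\<in>?S. ennreal \<bar>det (matrix (\<lambda>v. ?J u *v v))\<bar> \<partial>lborel)"
    proof (rule emeasure_differentiable_image[OF S hS _ _ m])
      fix u assume "u \<in> ?S"
      then obtain x where x: "x \<in> C" "u = coord c x" by blast
      have xx: "coord_inv c u = x" "x \<in> E" "x \<in> chart_dom c" using x C by (auto simp: is_chartD(5)[OF ch])
      have "(coord (E, \<phi>) \<circ> coord_inv c) differentiable (at (coord c x))"
        using xx by (intro transition_differentiable(1)[OF d c]) auto
      then have "(?h has_derivative (\<lambda>v. ?J u *v v)) (at u)"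
        unfolding xx(1) transition_jacobian_def jacobian_works x(2) by (simp add: is_chartD(5)[OF ch xx(3)])
      then show "(?h has_derivative (\<lambda>v. ?J u *v v)) (at u within ?S)"
        by (rule has_derivative_at_withinI)
    next
      show "inj_on ?h ?S"
      proof (rule inj_onI)
        fix u w assume "u \<in> ?S" "w \<in> ?S" and eq: "?h u = ?h w"
        then obtain x y where "x \<in> C" "u = coord c x" "y \<in> C" "w = coord c y" by blast
        moreover from this have "\<phi> x = \<phi> y" using eq C(3) by (auto simp: is_chartD(5)[OF ch] subsetD)
        ultimately show "u = w" using inj C(2) by (auto dest: inj_onD)
      qed
    qed
    also have "\<dots> = (\<integral>\<^sup>+u\<in>?S. ennreal (sqrt (det (g c (coord_inv c u)))) \<partial>lborel)"
      by (rule nn_integral_cong) (auto simp: indicator_def det)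
    finally show ?thesis
      unfolding im riemannian_measureD(2)[OF \<mu> c C(1,3)] by simp
  qed
  have "\<And>S. S \<in> chart_dom ` A \<Longrightarrow> open S"
    using A is_chartD(1) unfolding smooth_manifold_def by blast
  from Lindelof[OF this] obtain F where F: "F \<subseteq> chart_dom ` A" "countable F" "\<Union>F = \<Union>(chart_dom ` A)" by blast
  have UF: "\<Union>F = UNIV" using F(3) A unfolding smooth_manifold_def by blast
  then have Fne: "F \<noteq> {}" by auto
  define D where "D = from_nat_into F"
  have D: "D i \<in> F" for i unfolding D_def by (rule from_nat_into[OF Fne])
  have rD: "(\<Union>i. D i) = UNIV" using UF range_from_nat_into[OF Fne F(2)] by (simp add: D_def)
  have Dc: "\<exists>c\<in>A. D i = chart_dom c" for i using D F(1) by blast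
  have Do: "open (D i)" for i
  proof -
    obtain c where c: "c \<in> A" "D i = chart_dom c" using Dc by blast
    then have "is_chart c" using A unfolding smooth_manifold_def by blast
    from is_chartD(1)[OF this] show ?thesis by (simp add: c)
  qed
  define C where "C i = B \<inter> disjointed D i" for i
  have Cb: "C i \<in> sets borel" for i
  proof -
    have "range (disjointed D) \<subseteq> sets borel" by (rule sets.range_disjointed_sets) (use Do in auto)
    then show ?thesis using B(1) by (auto simp: C_def)
  qed
  have CE: "C i \<subseteq> E" for i using B by (auto simp: C_def)
  have Cd: "disjoint_family C" unfolding C_def
    using disjoint_family_disjointed[of D] by (auto simp: disjoint_family_on_def)
  have UC: "(\<Union>i. C i) = B" unfolding C_def using UN_disjointed_eq[of D] rD by auto
  have \<phi>C: "disjoint_family (\<lambda>i. \<phi> ` C i)"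
    unfolding disjoint_family_on_def
  proof (intro ballI impI)
    fix i j :: nat assume "i \<noteq> j"
    then have "C i \<inter> C j = {}" using Cd by (auto simp: disjoint_family_on_def)
    then show "\<phi> ` C i \<inter> \<phi> ` C j = {}"
      using inj_on_image_Int[OF inj CE CE, of i j] by simp
  qed
  have eq: "emeasure \<mu> (C i) = emeasure lborel (\<phi> ` C i)" for i
  proof -
    obtain c where "c \<in> A" "D i = chart_dom c" using Dc by blast
    then show ?thesis using disjointed_subset[of D i] by (intro 1[OF _ Cb CE]) (auto simp: C_def)
  qed
  have "emeasure \<mu> B = (\<Sum>i. emeasure \<mu> (C i))"
    unfolding UC[symmetric] by (rule suminf_emeasure[symmetric]) (use Cb Cd riemannian_measureD(1)[OF \<mu>] in auto)
  also have "\<dots> = (\<Sum>i. emeasure lborel (\<phi> ` C i))" by (simp add: eq)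
  also have "\<dots> = emeasure lborel (\<Union>i. \<phi> ` C i)"
    by (rule suminf_emeasure) (use borel_chart_image[OF chd Cb] CE \<phi>C in auto)
  also have "(\<Union>i. \<phi> ` C i) = \<phi> ` B" using UC by blast
  finally show ?thesis .
qed

lemma comparable_chart_end:
  fixes A :: "('m::{t2_space, second_countable_topology}, 'n::finite) chart set"
  assumes A: "smooth_manifold A" and g: "riemannian_metric A g" and \<mu>: "riemannian_measure A g \<mu>"
    and d: "admissible_chart A (E, \<phi>)"
    and J: "\<And>c x. c \<in> A \<Longrightarrow> x \<in> E \<Longrightarrow> x \<in> chart_dom c \<Longrightarrow>
        g c x = transpose (transition_jacobian c (E, \<phi>) x) ** transition_jacobian c (E, \<phi>) x"
  shows "comparable_chart A g \<mu> (E, \<phi>) E 1"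
  unfolding comparable_chart_def
proof (intro conjI allI impI ballI)
  show chd: "is_chart (E, \<phi>)" using d unfolding admissible_chart_def by blast
  show "open E" using is_chartD(1)[OF chd] by simp
  show "upper_gradient (coord (E, \<phi>) ` E) (f \<circ> coord_inv (E, \<phi>)) (\<lambda>u. 1 * gradient_norm A g f (coord_inv (E, \<phi>) u))"
    if f: "smooth_compactly_supported A f" for f
  proof (rule upper_gradient_in_chart[OF A g d f])
    show "metric_matrix_at A g (E, \<phi>) x (mat 1)" if "x \<in> E" for x
      unfolding metric_matrix_at_def using that J pos_def_mat_1 by simp
  qed (auto simp: power2_norm_eq_inner)
  show "emeasure \<mu> B \<le> ennreal 1 * emeasure lborel (coord (E, \<phi>) ` B)"
    "emeasure lborel (coord (E, \<phi>) ` B) \<le> ennreal 1 * emeasure \<mu> B" if "B \<in> sets borel" "B \<subseteq> E" for B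
    using emeasure_end[OF A g \<mu> d J that] by simp_all
qed auto

section \<open>Compact sets stay away from infinity in the ends\<close>

text \<open>The coordinates \<open>\<phi>\<close> of an end are locally Lipschitz with respect to those of any chart \<open>c\<close>, since
  \<open>J\<^sup>T J\<close> is the metric. Let \<open>m\<close> be outside \<open>E\<close> and \<open>y\<close> a point of \<open>E\<close> close to \<open>m\<close> with \<open>\<phi> y\<close> far from the
  unit ball. Follow the segment from \<open>y\<close> to \<open>m\<close> in the chart \<open>c\<close>. As long as it stays in \<open>E\<close>, its image
  under \<open>\<phi>\<close> stays in a fixed closed ball around \<open>\<phi> y\<close> which avoids the unit ball. The preimage of
  this ball is a compact subset of \<open>E\<close>, so the segment cannot leave \<open>E\<close>, and \<open>m\<close> would be in \<open>E\<close>.\<close>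
lemma end_bounded_near:
  fixes A :: "('m::{t2_space, second_countable_topology}, 'n::finite) chart set"
  assumes A: "smooth_manifold A" and g: "riemannian_metric A g"
    and d: "admissible_chart A (E, \<phi>)" and im: "\<phi> ` E = - cball 0 1"
    and J: "\<And>c x. c \<in> A \<Longrightarrow> x \<in> E \<Longrightarrow> x \<in> chart_dom c \<Longrightarrow>
        g c x = transpose (transition_jacobian c (E, \<phi>) x) ** transition_jacobian c (E, \<phi>) x"
  shows "\<exists>W R. open W \<and> m \<in> W \<and> (\<forall>y\<in>E \<inter> W. norm (\<phi> y) \<le> R)"
proof -
  have chd: "is_chart (E, \<phi>)" using d unfolding admissible_chart_def by blast
  have Eo: "open E" and \<phi>c: "continuous_on E \<phi>" and ic: "continuous_on (- cball 0 1) (coord_inv (E, \<phi>))"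
    and inv: "\<And>x. x \<in> E \<Longrightarrow> coord_inv (E, \<phi>) (\<phi> x) = x"
    using is_chartD[OF chd] im by simp_all
  show ?thesis
  proof (cases "m \<in> E")
    case True
    let ?W = "E \<inter> \<phi> -` ball (\<phi> m) 1"
    have "open ?W" by (rule continuous_open_preimage[OF \<phi>c Eo open_ball])
    moreover have "norm (\<phi> y) \<le> norm (\<phi> m) + 1" if "y \<in> E \<inter> ?W" for y
      using that norm_triangle_sub[of "\<phi> y" "\<phi> m"] by (auto simp: dist_norm norm_minus_commute)
    ultimately show ?thesis using True by (intro exI[of _ ?W] exI[of _ "norm (\<phi> m) + 1"]) auto
  next
    case mE: False
    define c where "c = chart_at A m"
    have c: "c \<in> A" "m \<in> chart_dom c" using chart_at[OF A] by (auto simp: c_def)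
    have ch: "is_chart c" using A c unfolding smooth_manifold_def by blast
    let ?V = "coord c ` chart_dom c" and ?G = "g c \<circ> coord_inv c"
    obtain e where e: "0 < e" "cball (coord c m) e \<subseteq> ?V"
      using is_chartD(2)[OF ch] c unfolding open_contains_cball by blast
    let ?Z = "cball (coord c m) e"
    obtain L where L: "1 \<le> L" "\<And>u v. u \<in> ?Z \<Longrightarrow> v \<bullet> (?G u *v v) \<le> L\<^sup>2 * (norm v)\<^sup>2"
      using metric_bounded_on_compact[OF A g c(1) compact_cball e(2)] by blast
    let ?W = "chart_dom c \<inter> coord c -` ball (coord c m) e"
    have Wo: "open ?W" by (rule continuous_open_preimage[OF is_chartD(3,1)[OF ch] open_ball])
    let ?h = "\<phi> \<circ> coord_inv c" and ?J = "\<lambda>u. transition_jacobian c (E, \<phi>) (coord_inv c u)"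
    have "norm (\<phi> y) \<le> 2 + L * e" if y: "y \<in> E" "y \<in> ?W" for y
    proof (rule ccontr)
      assume far: "\<not> norm (\<phi> y) \<le> 2 + L * e"
      define u0 where "u0 = coord c y"
      have u0: "u0 \<in> ball (coord c m) e" "coord_inv c u0 = y" using y by (auto simp: u0_def is_chartD(5)[OF ch])
      define \<sigma> where "\<sigma> t = u0 + t *\<^sub>R (coord c m - u0)" for t
      have \<sigma>Z: "\<sigma> t \<in> ball (coord c m) e" if "t \<in> {0..1}" for t
      proof -
        have "(1 - t) *\<^sub>R u0 + t *\<^sub>R coord c m \<in> ball (coord c m) e"
          using that u0 e by (intro convexD[OF convex_ball]) auto
        then show ?thesis by (simp add: \<sigma>_def algebra_simps)
      qed
      have \<sigma>V: "\<sigma> t \<in> ?V" if "t \<in> {0..1}" for t using \<sigma>Z[OF that] e(2) ball_subset_cball by blast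
      define \<gamma> where "\<gamma> t = coord_inv c (\<sigma> t)" for t
      have \<gamma>dom: "\<gamma> t \<in> chart_dom c" "coord c (\<gamma> t) = \<sigma> t" if t: "t \<in> {0..1}" for t
      proof -
        obtain z where "z \<in> chart_dom c" "\<sigma> t = coord c z" using \<sigma>V[OF t] by blast
        then show "\<gamma> t \<in> chart_dom c" "coord c (\<gamma> t) = \<sigma> t" by (simp_all add: \<gamma>_def is_chartD(5)[OF ch])
      qed
      have "continuous_on {0..1} \<sigma>" unfolding \<sigma>_def by (intro continuous_intros)
      then have \<gamma>c: "continuous_on {0..1} \<gamma>" unfolding \<gamma>_def
        by (rule continuous_on_compose2[OF is_chartD(4)[OF ch]]) (use \<sigma>V in blast)
      have \<gamma>0: "\<gamma> 0 = y" and \<gamma>1: "\<gamma> 1 = m"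
        using u0 c by (simp_all add: \<gamma>_def \<sigma>_def is_chartD(5)[OF ch])
      define Q where "Q = coord_inv (E, \<phi>) ` cball (\<phi> y) (L * e)"
      have sub: "cball (\<phi> y) (L * e) \<subseteq> - cball 0 1"
      proof
        fix z assume "z \<in> cball (\<phi> y) (L * e)"
        then have "norm (\<phi> y) \<le> norm z + L * e"
          using norm_triangle_sub[of "\<phi> y" z] by (simp add: dist_norm)
        then show "z \<in> - cball 0 1" using far by simp
      qed
      have Qc: "closed Q" unfolding Q_def
        by (intro compact_imp_closed compact_continuous_image compact_cball continuous_on_subset[OF ic sub])
      have QE: "Q \<subseteq> E"
      proof
        fix z assume "z \<in> Q"
        then obtain w where "w \<in> \<phi> ` E" "z = coord_inv (E, \<phi>) w" using sub unfolding Q_def im by blast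
        then show "z \<in> E" by (auto simp: inv)
      qed
      have step: "\<gamma> s \<in> Q" if s: "s \<in> {0..1}" and before: "\<And>t. t \<in> {0..s} \<Longrightarrow> \<gamma> t \<in> E" for s
      proof -
        have seg: "\<exists>t\<in>{0..s}. u = \<sigma> t" if u: "u \<in> closed_segment u0 (\<sigma> s)" for u
        proof -
          obtain a where a: "0 \<le> a" "a \<le> 1" "u = (1 - a) *\<^sub>R u0 + a *\<^sub>R \<sigma> s"
            using u unfolding closed_segment_def by blast
          have "u = \<sigma> (a * s)" unfolding a(3) \<sigma>_def by (simp add: algebra_simps)
          moreover have "a * s \<in> {0..s}" using a s by (auto simp: mult_left_le_one_le)
          ultimately show ?thesis by blast
        qed
        have "norm (?h (\<sigma> s) - ?h u0) \<le> L * norm (\<sigma> s - u0)"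
        proof (rule differentiable_bound[of "closed_segment u0 (\<sigma> s)" ?h "\<lambda>u. (*v) (?J u)"])
          fix u assume u: "u \<in> closed_segment u0 (\<sigma> s)"
          then obtain t where t: "t \<in> {0..s}" "u = \<sigma> t" using seg by blast
          have t1: "t \<in> {0..1}" using t s by auto
          let ?x = "\<gamma> t"
          have x: "?x \<in> E" "?x \<in> chart_dom c" "coord c ?x = u" "coord_inv c u = ?x"
            using before[OF t(1)] \<gamma>dom[OF t1] t(2) by (auto simp: \<gamma>_def)
          have "(coord (E, \<phi>) \<circ> coord_inv c) differentiable (at (coord c ?x))"
            using x by (intro transition_differentiable(1)[OF d c(1)]) auto
          then have "(?h has_derivative (\<lambda>v. ?J u *v v)) (at u)"
            unfolding transition_jacobian_def jacobian_works x(4) by (simp add: x(3))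
          then show "(?h has_derivative (*v) (?J u)) (at u within closed_segment u0 (\<sigma> s))"
            by (rule has_derivative_at_withinI)
          show "onorm ((*v) (?J u)) \<le> L"
          proof (rule onorm_le)
            fix v :: "real ^ 'n"
            have "(norm (?J u *v v))\<^sup>2 = v \<bullet> (g c ?x *v v)"
              unfolding J[OF c(1) x(1,2)] x(4) power2_norm_eq_inner matrix_vector_mul_assoc[symmetric]
              by (metis dot_lmul_matrix inner_commute transpose_matrix_vector)
            also have "\<dots> \<le> L\<^sup>2 * (norm v)\<^sup>2"
              using L(2)[of u v] \<sigma>Z[OF t1] t(2) by (simp add: \<gamma>_def)
            finally have "(norm (?J u *v v))\<^sup>2 \<le> (L * norm v)\<^sup>2" by (simp add: power_mult_distrib)
            then show "norm (?J u *v v) \<le> L * norm v" by (rule power2_le_imp_le) (use L in simp)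
          qed
        qed auto
        also have "\<dots> \<le> L * e"
        proof (rule mult_left_mono)
          have "norm (\<sigma> s - u0) = s * norm (coord c m - u0)" using s by (simp add: \<sigma>_def)
          also have "\<dots> \<le> 1 * e" using s u0(1) by (intro mult_mono) (auto simp: dist_norm)
          finally show "norm (\<sigma> s - u0) \<le> e" by simp
        qed (use L in simp)
        finally have "\<phi> (\<gamma> s) \<in> cball (\<phi> y) (L * e)"
          by (simp add: \<gamma>_def u0(2) dist_norm norm_minus_commute)
        moreover have "\<gamma> s \<in> E" using before[of s] s by simp
        ultimately show ?thesis unfolding Q_def by (metis image_eqI inv)
      qed
      have cl: "closed ({0..1} \<inter> \<gamma> -` Q)" by (rule continuous_closed_preimage[OF \<gamma>c closed_real_atLeastAtMost Qc])
      define B where "B = {t \<in> {0..1}. \<gamma> t \<notin> E}"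
      have "B = {0..1} \<inter> \<gamma> -` (- E)" by (auto simp: B_def)
      then have Bc: "closed B"
        using continuous_closed_preimage[OF \<gamma>c closed_real_atLeastAtMost, of "- E"] Eo by (simp add: closed_Compl)
      have B1: "1 \<in> B" using \<gamma>1 mE by (simp add: B_def)
      have Bb: "bdd_below B" by (rule bdd_belowI[of _ 0]) (auto simp: B_def)
      \<comment> \<open>The time at which the segment leaves \<open>E\<close> for the first time.\<close>
      define t where "t = Inf B"
      have tB: "t \<in> B" unfolding t_def by (rule closed_contains_Inf[OF _ Bb Bc]) (use B1 in blast)
      have tb: "\<gamma> s \<in> E" if "0 \<le> s" "s < t" for s
      proof (rule ccontr)
        assume "\<gamma> s \<notin> E"
        then have "s \<in> B" using that tB by (auto simp: B_def)
        then show False using cInf_lower[OF _ Bb, of s] that by (simp add: t_def)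
      qed
      have t0: "0 < t" using tB \<gamma>0 y(1) by (cases "t = 0") (auto simp: B_def)
      have t1: "t \<le> 1" using tB by (simp add: B_def)
      have "{0..<t} \<subseteq> {0..1} \<inter> \<gamma> -` Q"
      proof
        fix s assume s: "s \<in> {0..<t}"
        then show "s \<in> {0..1} \<inter> \<gamma> -` Q" using t1 tb by (auto intro!: step)
      qed
      then have "closure {0..<t} \<subseteq> {0..1} \<inter> \<gamma> -` Q" using cl by (rule closure_minimal)
      moreover have "t \<in> closure {0..<t}" using t0 by simp
      ultimately have "\<gamma> t \<in> Q" by blast
      then show False using QE tB by (auto simp: B_def)
    qed
    then show ?thesis using Wo c e by (intro exI[of _ ?W] exI[of _ "2 + L * e"]) auto
  qed
qed

lemma end_bounded_on_compact:
  fixes A :: "('m::{t2_space, second_countable_topology}, 'n::finite) chart set"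
  assumes A: "smooth_manifold A" and g: "riemannian_metric A g"
    and d: "admissible_chart A (E, \<phi>)" and im: "\<phi> ` E = - cball 0 1"
    and J: "\<And>c x. c \<in> A \<Longrightarrow> x \<in> E \<Longrightarrow> x \<in> chart_dom c \<Longrightarrow>
        g c x = transpose (transition_jacobian c (E, \<phi>) x) ** transition_jacobian c (E, \<phi>) x"
    and S: "compact S"
  obtains R where "\<And>y. y \<in> E \<Longrightarrow> y \<in> S \<Longrightarrow> norm (\<phi> y) < R"
proof -
  obtain W R where WR: "\<And>m. open (W m)" "\<And>m. m \<in> W m" "\<And>m y. y \<in> E \<Longrightarrow> y \<in> W m \<Longrightarrow> norm (\<phi> y) \<le> R m"
    using end_bounded_near[OF A g d im J] by (metis IntI)
  have "S \<subseteq> (\<Union>m\<in>UNIV. W m)" using WR(2) by blast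
  with S obtain C where C: "finite C" "S \<subseteq> (\<Union>m\<in>C. W m)"
    using WR(1) by (metis compactE_image)
  have "norm (\<phi> y) < (\<Sum>m\<in>C. \<bar>R m\<bar>) + 1" if y: "y \<in> E" "y \<in> S" for y
  proof -
    obtain m where m: "m \<in> C" "y \<in> W m" using C y by blast
    have "norm (\<phi> y) \<le> \<bar>R m\<bar>" using WR(3)[OF y(1) m(2)] by simp
    also have "\<dots> \<le> (\<Sum>m\<in>C. \<bar>R m\<bar>)" using C(1) m(1) by (intro member_le_sum) auto
    finally show ?thesis by simp
  qed
  then show ?thesis using that by blast
qed

section \<open>From local to global\<close>

locale riemannian_sobolev =
  fixes A :: "('m::{t2_space, second_countable_topology}, 'n::finite) chart set"
    and g :: "('m, 'n) metric_coeffs" and \<mu> :: "'m measure" and n p :: real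
  assumes A: "smooth_manifold A" and g: "riemannian_metric A g" and \<mu>: "riemannian_measure A g \<mu>"
    and n: "n = real CARD('n)" and dim: "2 \<le> CARD('n)" and p: "1 \<le> p" "p < n"
begin

abbreviation "test \<equiv> smooth_compactly_supported A"
abbreviation "q \<equiv> n * p / (n - p)"
abbreviation "\<gamma> \<equiv> p * (n - 1) / (n - p)"

definition mass :: "real \<Rightarrow> 'm set \<Rightarrow> ('m \<Rightarrow> real) \<Rightarrow> ennreal" where
  "mass s U f = (\<integral>\<^sup>+x\<in>U. ennreal (\<bar>f x\<bar> powr s) \<partial>\<mu>)"

definition energy :: "('m \<Rightarrow> real) \<Rightarrow> ennreal" where
  "energy f = (\<integral>\<^sup>+x. ennreal (gradient_norm A g f x powr p) \<partial>\<mu>)"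

lemma q_pos: "0 < q" and p_le_q: "p < q"
proof -
  show "0 < q" using p by simp
  have "p * (n - p) < n * p" using p by (simp add: algebra_simps)
  then show "p < q" using p by (simp add: pos_less_divide_eq)
qed

lemma sets_\<mu> [simp]: "sets \<mu> = sets borel" by (rule riemannian_measureD(1)[OF \<mu>])

lemma measurable_\<mu>: "h \<in> borel_measurable borel \<Longrightarrow> h \<in> borel_measurable \<mu>"
  by (subst measurable_cong_sets[OF sets_\<mu> refl])

lemma borel_test: "test f \<Longrightarrow> f \<in> borel_measurable borel"
  by (rule borel_measurable_continuous_onI[OF smooth_compactly_supported_continuous[OF A]])

lemma borel_gradient: "test f \<Longrightarrow> gradient_norm A g f \<in> borel_measurable borel"
  by (rule borel_measurable_continuous_onI[OF continuous_gradient_norm[OF A g]])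

lemma borel_mass:
  assumes "test f" shows "(\<lambda>x. ennreal (\<bar>f x\<bar> powr s)) \<in> borel_measurable borel"
proof -
  have [measurable]: "f \<in> borel_measurable borel" by (rule borel_test[OF assms])
  show ?thesis by measurable
qed

lemma borel_mass_on:
  assumes "test f" "W \<in> sets borel"
  shows "(\<lambda>x. ennreal (\<bar>f x\<bar> powr s) * indicator W x) \<in> borel_measurable borel"
proof -
  have [measurable]: "f \<in> borel_measurable borel" by (rule borel_test[OF assms(1)])
  show ?thesis using assms(2) by measurable
qed

lemma mass_mono: "U \<subseteq> V \<Longrightarrow> mass s U f \<le> mass s V f"
  unfolding mass_def by (intro nn_integral_mono mult_left_mono) (auto simp: indicator_def)

lemma comparable_nbhd:
  assumes "open W" "x \<in> W"
  obtains c U L r where "x \<in> U" "U \<subseteq> W" "comparable_chart A g \<mu> c U L" "0 < r" "coord c ` U = cube (coord c x) r"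
  by (rule comparable_chart_local[OF A g \<mu> chart_at[OF A] assms])

lemma comparable_chartD:
  assumes "comparable_chart A g \<mu> c U L"
  shows "is_chart c" "open U" "U \<subseteq> chart_dom c" "0 < L"
    "test f \<Longrightarrow> upper_gradient (coord c ` U) (f \<circ> coord_inv c) (\<lambda>u. L * gradient_norm A g f (coord_inv c u))"
    "B \<in> sets borel \<Longrightarrow> B \<subseteq> U \<Longrightarrow> emeasure \<mu> B \<le> ennreal L * emeasure lborel (coord c ` B)"
    "B \<in> sets borel \<Longrightarrow> B \<subseteq> U \<Longrightarrow> emeasure lborel (coord c ` B) \<le> ennreal L * emeasure \<mu> B"
  using assms unfolding comparable_chart_def by blast+

lemma comparable_integrals:
  assumes c: "comparable_chart A g \<mu> c U L" and h: "h \<in> borel_measurable borel"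
  shows "(\<integral>\<^sup>+x\<in>U. h x \<partial>\<mu>) \<le> ennreal L * (\<integral>\<^sup>+u\<in>coord c ` U. h (coord_inv c u) \<partial>lborel)"
    and "(\<integral>\<^sup>+u\<in>coord c ` U. h (coord_inv c u) \<partial>lborel) \<le> ennreal L * (\<integral>\<^sup>+x\<in>U. h x \<partial>\<mu>)"
  by (rule nn_integral_in_chart(1)[OF sets_\<mu> comparable_chartD(1-3)[OF c] h], erule (1) comparable_chartD(6)[OF c])
    (rule nn_integral_in_chart(2)[OF sets_\<mu> comparable_chartD(1-3)[OF c] h], erule (1) comparable_chartD(7)[OF c])

lemma emeasure_cube_finite: "emeasure lborel (cube u r :: (real ^ 'n) set) < \<infinity>"
  unfolding cube_def by (rule emeasure_bounded_finite[OF bounded_box])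

lemma finite_measure_nbhd:
  assumes "open W" "x \<in> W"
  obtains U where "open U" "x \<in> U" "U \<subseteq> W" "emeasure \<mu> U < \<infinity>"
proof -
  obtain c U L r where U: "x \<in> U" "U \<subseteq> W" "comparable_chart A g \<mu> c U L" "0 < r" "coord c ` U = cube (coord c x) r"
    using comparable_nbhd[OF assms] .
  have "emeasure \<mu> U \<le> ennreal L * emeasure lborel (coord c ` U)"
    using comparable_chartD(2,6)[OF U(3)] by simp
  also have "\<dots> < \<infinity>"
    unfolding U(5) using emeasure_cube_finite[of "coord c x" r] by (simp add: ennreal_mult_less_top)
  finally show ?thesis using that comparable_chartD(2)[OF U(3)] U by blast
qed

lemma compact_finite_measure:
  assumes "compact S" shows "emeasure \<mu> S < \<infinity>"
proof -
  have "\<exists>U. open U \<and> x \<in> U \<and> emeasure \<mu> U < \<infinity>" for x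
    by (rule finite_measure_nbhd[OF open_UNIV UNIV_I[of x]]) blast
  then obtain U where U: "\<And>x. open (U x)" "\<And>x. x \<in> U x" "\<And>x. emeasure \<mu> (U x) < \<infinity>" by metis
  have "S \<subseteq> (\<Union>x\<in>UNIV. U x)" using U(2) by blast
  with assms obtain C where C: "finite C" "S \<subseteq> (\<Union>x\<in>C. U x)" using U(1) by (metis compactE_image)
  have "emeasure \<mu> S \<le> emeasure \<mu> (\<Union>x\<in>C. U x)" using C U(1) by (intro emeasure_mono) auto
  also have "\<dots> \<le> (\<Sum>x\<in>C. emeasure \<mu> (U x))" using C U(1) by (intro emeasure_subadditive_finite) auto
  also have "\<dots> < \<infinity>" using U(3) C(1) by (simp add: ennreal_sum_less_top)
  finally show ?thesis .
qed

text \<open>The measure \<open>\<mu>\<close> is finite on compact sets and \<open>h\<close> is bounded.\<close>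
lemma finite_power_integral:
  assumes h: "continuous_on UNIV h" and S: "compact S" "\<And>x. x \<notin> S \<Longrightarrow> h x = 0" and s: "0 < s"
  shows "(\<integral>\<^sup>+x. ennreal (\<bar>h x\<bar> powr s) \<partial>\<mu>) < \<infinity>"
proof -
  have "bounded (h ` S)"
    by (intro compact_imp_bounded compact_continuous_image continuous_on_subset[OF h] S) auto
  then obtain b where b: "\<And>x. x \<in> S \<Longrightarrow> \<bar>h x\<bar> \<le> b" unfolding bounded_real by blast
  have "(\<integral>\<^sup>+x. ennreal (\<bar>h x\<bar> powr s) \<partial>\<mu>) \<le> (\<integral>\<^sup>+x. ennreal (b powr s) * indicator S x \<partial>\<mu>)"
  proof (rule nn_integral_mono)
    fix x show "ennreal (\<bar>h x\<bar> powr s) \<le> ennreal (b powr s) * indicator S x"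
      using S(2)[of x] b[of x] s by (cases "x \<in> S") (auto intro!: ennreal_leI powr_mono2)
  qed
  also have "\<dots> = ennreal (b powr s) * emeasure \<mu> S"
    using compact_imp_closed[OF S(1)] by (intro nn_integral_cmult_indicator) auto
  also have "\<dots> < \<infinity>" using compact_finite_measure[OF S(1)] by (simp add: ennreal_mult_less_top)
  finally show ?thesis .
qed

lemma compact_support: "test f \<Longrightarrow> compact (closure {x. f x \<noteq> 0})"
  unfolding smooth_compactly_supported_def by (rule conjunct2)

lemma mass_finite:
  assumes f: "test f" and s: "0 < s" shows "mass s UNIV f < \<infinity>"
proof -
  have "f x = 0" if "x \<notin> closure {x. f x \<noteq> 0}" for x
    using that closure_subset[of "{x. f x \<noteq> 0}"] by blast
  from finite_power_integral[OF smooth_compactly_supported_continuous[OF A f] compact_support[OF f] this s]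
  show ?thesis by (simp add: mass_def)
qed

lemma energy_finite:
  assumes f: "test f" shows "energy f < \<infinity>"
proof -
  have "0 < p" using p by simp
  from finite_power_integral[OF continuous_gradient_norm[OF A g f] compact_support[OF f] gradient_norm_outside_support[OF A] this]
  show ?thesis using gradient_norm_nonneg[OF A g, of f] by (simp add: energy_def)
qed

lemma gradient_mass_le_energy:
  assumes "test f" "comparable_chart A g \<mu> c U L"
  shows "(\<integral>\<^sup>+u\<in>coord c ` U. ennreal ((L * gradient_norm A g f (coord_inv c u)) powr p) \<partial>lborel)
    \<le> ennreal (L * L powr p) * energy f"
proof -
  note L = comparable_chartD(4)[OF assms(2)]
  have [measurable]: "gradient_norm A g f \<in> borel_measurable borel" by (rule borel_gradient[OF assms(1)])
  have "(\<integral>\<^sup>+u\<in>coord c ` U. ennreal ((L * gradient_norm A g f (coord_inv c u)) powr p) \<partial>lborel)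
      \<le> ennreal L * (\<integral>\<^sup>+x\<in>U. ennreal ((L * gradient_norm A g f x) powr p) \<partial>\<mu>)"
    by (rule comparable_integrals(2)[OF assms(2), of "\<lambda>x. ennreal ((L * gradient_norm A g f x) powr p)"]) measurable
  also have "\<dots> \<le> ennreal L * (\<integral>\<^sup>+x. ennreal (L powr p) * ennreal (gradient_norm A g f x powr p) \<partial>\<mu>)"
    using gradient_norm_nonneg[OF A g, of f] L
    by (intro mult_left_mono nn_integral_mono) (auto simp: indicator_def powr_mult ennreal_mult)
  also have "(\<integral>\<^sup>+x. ennreal (L powr p) * ennreal (gradient_norm A g f x powr p) \<partial>\<mu>) = ennreal (L powr p) * energy f"
    unfolding energy_def by (rule nn_integral_cmult) (rule measurable_\<mu>, measurable)
  finally show ?thesis using L by (simp add: ennreal_mult mult.assoc)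
qed

lemma chart_mass_le:
  assumes f: "test f" and c: "comparable_chart A g \<mu> c U L"
  shows "(\<integral>\<^sup>+u\<in>coord c ` U. ennreal (\<bar>(f \<circ> coord_inv c) u\<bar> powr s) \<partial>lborel) \<le> ennreal L * mass s U f"
  using comparable_integrals(2)[OF c borel_mass[OF f, of s]] by (simp add: mass_def)

lemma chart_q_mass_finite:
  assumes f: "test f" and c: "comparable_chart A g \<mu> c U L"
  shows "(\<integral>\<^sup>+u\<in>coord c ` U. ennreal (\<bar>(f \<circ> coord_inv c) u\<bar> powr q) \<partial>lborel) < \<infinity>"
proof (rule le_less_trans[OF chart_mass_le[OF f c]])
  have "mass q U f < \<infinity>"
    by (rule le_less_trans[OF mass_mono[OF subset_UNIV] mass_finite[OF f q_pos]])
  then show "ennreal L * mass q U f < \<infinity>" by (simp add: ennreal_mult_less_top)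
qed

lemma chart_gradient_le:
  assumes f: "test f" and c: "comparable_chart A g \<mu> c U L" and B: "0 \<le> B" "energy f \<le> ennreal B"
  shows "(\<integral>\<^sup>+u\<in>coord c ` U. ennreal ((L * gradient_norm A g f (coord_inv c u)) powr p) \<partial>lborel)
    \<le> ennreal (L * L powr p * B)"
proof -
  have "(\<integral>\<^sup>+u\<in>coord c ` U. ennreal ((L * gradient_norm A g f (coord_inv c u)) powr p) \<partial>lborel)
    \<le> ennreal (L * L powr p) * energy f" by (rule gradient_mass_le_energy[OF f c])
  also have "\<dots> \<le> ennreal (L * L powr p) * ennreal B" by (intro mult_left_mono B) simp
  finally show ?thesis using comparable_chartD(4)[OF c] B by (simp add: ennreal_mult)
qed

lemma q_mass_le_of_chart:
  assumes f: "test f" and c: "comparable_chart A g \<mu> c U L" and k: "0 \<le> k" and B: "0 \<le> B"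
    and le: "(\<integral>\<^sup>+u\<in>coord c ` U. ennreal (\<bar>(f \<circ> coord_inv c) u\<bar> powr q) \<partial>lborel) \<le> ennreal (\<gamma> powr q * (k * B) powr (q / p))"
  shows "mass q U f \<le> ennreal (L * (\<gamma> powr q * k powr (q / p)) * B powr (q / p))"
proof -
  have "mass q U f \<le> ennreal L * (\<integral>\<^sup>+u\<in>coord c ` U. ennreal (\<bar>(f \<circ> coord_inv c) u\<bar> powr q) \<partial>lborel)"
    using comparable_integrals(1)[OF c borel_mass[OF f, of q]] by (simp add: mass_def)
  also have "\<dots> \<le> ennreal L * ennreal (\<gamma> powr q * (k * B) powr (q / p))" by (intro mult_left_mono le) simp
  also have "\<dots> = ennreal (L * (\<gamma> powr q * k powr (q / p)) * B powr (q / p))"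
    using comparable_chartD(4)[OF c] k B by (simp add: ennreal_mult[symmetric] powr_mult mult.assoc)
  finally show ?thesis .
qed

text \<open>The cube inequality, with its \<open>L\<^sup>p\<close> term absorbed by the assumed bound. The energy
  enters through a real bound \<open>B\<close>, because it is raised to a real power.\<close>
lemma sobolev_in_chart:
  assumes c: "comparable_chart A g \<mu> c U L" and im: "coord c ` U = cube u r" and r: "0 < r"
    and C: "0 \<le> C" "\<And>f. test f \<Longrightarrow> mass p U f \<le> ennreal C * energy f"
  obtains C' where "0 \<le> C'" "\<And>f B. test f \<Longrightarrow> 0 \<le> B \<Longrightarrow> energy f \<le> ennreal B \<Longrightarrow>
    mass q U f \<le> ennreal (C' * B powr (q / p))"
proof
  note L = comparable_chartD(4)[OF c]
  define k where "k = 2 powr p * (L * C / (2 * r) powr p + L * L powr p)"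
  have k: "0 \<le> k" using L C by (simp add: k_def)
  show "0 \<le> L * (\<gamma> powr q * k powr (q / p))" using L by simp
  fix f B assume f: "test f" and B: "0 \<le> B" "energy f \<le> ennreal B"
  let ?F = "f \<circ> coord_inv c" and ?N = "\<lambda>u. L * gradient_norm A g f (coord_inv c u)"
  have Fp: "(\<integral>\<^sup>+x\<in>cube u r. ennreal (\<bar>?F x\<bar> powr p) \<partial>lborel) \<le> ennreal (L * C * B)"
  proof -
    have "(\<integral>\<^sup>+x\<in>cube u r. ennreal (\<bar>?F x\<bar> powr p) \<partial>lborel) \<le> ennreal L * mass p U f"
      using chart_mass_le[OF f c, of p] by (simp add: im)
    also have "\<dots> \<le> ennreal L * (ennreal C * ennreal B)"
      using C(2)[OF f] B by (intro mult_left_mono order_trans[OF C(2)[OF f]]) auto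
    finally show ?thesis using L C B by (simp add: ennreal_mult mult.assoc)
  qed
  have ug: "upper_gradient (cube u r) ?F ?N" using comparable_chartD(5)[OF c f] by (simp add: im)
  have "(\<integral>\<^sup>+x\<in>cube u r. ennreal (\<bar>?F x\<bar> powr q) \<partial>lborel) \<le>
      ennreal (\<gamma> powr q * (2 powr p * (L * C * B / (2 * r) powr p + L * L powr p * B)) powr (q / p))"
    using sobolev_cube[where 'a="real ^ 'n" and p=p and f="?F" and N="?N" and c=u and r=r and A="L * C * B" and B="L * L powr p * B"]
      dim p r ug chart_q_mass_finite[OF f c] Fp chart_gradient_le[OF f c B] L C B by (simp add: n im)
  also have "2 powr p * (L * C * B / (2 * r) powr p + L * L powr p * B) = k * B"
    by (simp add: k_def algebra_simps)
  finally show "mass q U f \<le> ennreal (L * (\<gamma> powr q * k powr (q / p)) * B powr (q / p))"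
    by (intro q_mass_le_of_chart[OF f c k B(1)]) (simp only: im)
qed

lemma sobolev_in_end:
  assumes c: "comparable_chart A g \<mu> c U L" and im: "coord c ` U = - cball 0 1"
    and bd: "\<And>f. test f \<Longrightarrow> \<exists>R. \<forall>x\<in>U. R \<le> norm (coord c x) \<longrightarrow> f x = 0"
  obtains C' where "0 \<le> C'" "\<And>f B. test f \<Longrightarrow> 0 \<le> B \<Longrightarrow> energy f \<le> ennreal B \<Longrightarrow>
    mass q U f \<le> ennreal (C' * B powr (q / p))"
proof
  note L = comparable_chartD(4)[OF c] and U = comparable_chartD(1,3)[OF c]
  define k where "k = L * L powr p"
  have k: "0 \<le> k" using L by (simp add: k_def)
  show "0 \<le> L * (\<gamma> powr q * k powr (q / p))" using L by simp
  fix f B assume f: "test f" and B: "0 \<le> B" "energy f \<le> ennreal B"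
  let ?F = "f \<circ> coord_inv c" and ?N = "\<lambda>u. L * gradient_norm A g f (coord_inv c u)" and ?S = "- cball 0 1 :: (real ^ 'n) set"
  obtain R where R: "\<And>x. x \<in> U \<Longrightarrow> R \<le> norm (coord c x) \<Longrightarrow> f x = 0" using bd[OF f] by blast
  have R': "?F u = 0" if "R \<le> norm u" "1 < norm u" for u
  proof -
    have "u \<in> coord c ` U" using that by (simp add: im)
    then obtain x where "x \<in> U" "u = coord c x" by blast
    then show ?thesis using R[of x] that U(2) by (simp add: is_chartD(5)[OF U(1)] subsetD)
  qed
  have ug: "upper_gradient ?S ?F ?N" using comparable_chartD(5)[OF c f] by (simp add: im)
  have "(\<integral>\<^sup>+x\<in>?S. ennreal (\<bar>?F x\<bar> powr q) \<partial>lborel) \<le> ennreal (\<gamma> powr q * (k * B) powr (q / p))"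
    using sobolev_exterior[where 'a="real ^ 'n" and p=p and f="?F" and N="?N" and R=R and B="k * B"]
      dim p ug chart_q_mass_finite[OF f c] chart_gradient_le[OF f c B] k B R' by (simp add: n im k_def)
  then show "mass q U f \<le> ennreal (L * (\<gamma> powr q * k powr (q / p)) * B powr (q / p))"
    by (intro q_mass_le_of_chart[OF f c k B(1)]) (simp only: im)
qed

text \<open>The \<open>L\<^sup>p\<close> norm near \<open>x\<close> is bounded by the energy, with a constant which does not depend on the test
  function. Since a constant has no energy near \<open>x\<close>, such a bound cannot come from local reasons: it
  expresses that test functions vanish far out in the ends.\<close>
definition controlled :: "'m \<Rightarrow> bool" where
  "controlled x \<longleftrightarrow> (\<exists>U C. open U \<and> x \<in> U \<and> 0 \<le> C \<and> (\<forall>f. test f \<longrightarrow> mass p U f \<le> ennreal C * energy f))"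

text \<open>Hoelder's inequality on a neighbourhood of finite measure.\<close>
lemma controlled_of_sobolev:
  assumes E: "open E" "x \<in> E" and C: "0 \<le> C"
    and sob: "\<And>f B. test f \<Longrightarrow> 0 \<le> B \<Longrightarrow> energy f \<le> ennreal B \<Longrightarrow> mass q E f \<le> ennreal (C * B powr (q / p))"
  shows "controlled x"
proof -
  obtain U where U: "open U" "x \<in> U" "U \<subseteq> E" "emeasure \<mu> U < \<infinity>" using finite_measure_nbhd[OF E] .
  obtain m where m: "emeasure \<mu> U = ennreal m" "0 \<le> m" using U(4) by (cases "emeasure \<mu> U") auto
  let ?\<theta> = "p / q"
  have \<theta>: "0 < ?\<theta>" "?\<theta> < 1" using p q_pos p_le_q by (auto simp: field_simps)
  have "mass p U f \<le> ennreal (C powr ?\<theta> * m powr (1 - ?\<theta>)) * energy f" if f: "test f" for f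
  proof -
    obtain B where B: "energy f = ennreal B" "0 \<le> B" using energy_finite[OF f] by (cases "energy f") auto
    let ?X = "\<lambda>x. \<bar>f x\<bar> powr q * indicator U x" and ?Y = "\<lambda>x. indicator U x :: real"
    have [measurable]: "f \<in> borel_measurable borel" "U \<in> sets borel" using borel_test[OF f] U(1) by auto
    have "mass p U f = (\<integral>\<^sup>+x. ?X x powr ?\<theta> * ?Y x powr (1 - ?\<theta>) \<partial>\<mu>)"
      unfolding mass_def using q_pos \<theta> by (intro nn_integral_cong) (auto simp: indicator_def powr_powr)
    also have "\<dots> \<le> ennreal ((C * B powr (q / p)) powr ?\<theta> * m powr (1 - ?\<theta>))"
    proof (rule nn_integral_powr_Holder[OF _ _ _ _ \<theta>])
      have "(\<integral>\<^sup>+x. ?X x \<partial>\<mu>) = mass q U f"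
        unfolding mass_def by (intro nn_integral_cong) (auto simp: indicator_def)
      also have "\<dots> \<le> mass q E f" by (rule mass_mono[OF U(3)])
      also have "\<dots> \<le> ennreal (C * B powr (q / p))" using sob[OF f B(2)] B(1) by simp
      finally show "(\<integral>\<^sup>+x. ?X x \<partial>\<mu>) \<le> ennreal (C * B powr (q / p))" .
      show "(\<integral>\<^sup>+x. ?Y x \<partial>\<mu>) \<le> ennreal m" using U(1) m by (simp add: ennreal_indicator)
      show "?X \<in> borel_measurable \<mu>" "?Y \<in> borel_measurable \<mu>" by (rule measurable_\<mu>, measurable)+
    qed (use C m in auto)
    also have "(C * B powr (q / p)) powr ?\<theta> = C powr ?\<theta> * B"
      using C B p q_pos by (simp add: powr_mult powr_powr)
    also have "ennreal (C powr ?\<theta> * B * m powr (1 - ?\<theta>)) = ennreal (C powr ?\<theta> * m powr (1 - ?\<theta>)) * energy f"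
      unfolding B(1) using B(2) by (simp add: ennreal_mult[symmetric] mult_ac)
    finally show ?thesis .
  qed
  then show ?thesis unfolding controlled_def using U by (intro exI[of _ U] exI[of _ "C powr ?\<theta> * m powr (1 - ?\<theta>)"]) auto
qed

text \<open>The Poincare inequality in the chart, contracting the cube towards the coordinates of \<open>y\<close>.\<close>
lemma mass_spreads:
  assumes c: "comparable_chart A g \<mu> c U L" and im: "coord c ` U = cube u r" and r: "0 < r"
    and V: "open V" "y \<in> U" "y \<in> V"
  obtains C\<^sub>1 C\<^sub>2 where "0 \<le> C\<^sub>1" "0 \<le> C\<^sub>2" "\<And>f. test f \<Longrightarrow> mass p U f \<le> ennreal C\<^sub>1 * mass p V f + ennreal C\<^sub>2 * energy f"
proof -
  note L = comparable_chartD(4)[OF c] and U = comparable_chartD(1-3)[OF c]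
  let ?n = "DIM(real ^ 'n)"
  define V' where "V' = coord c ` (U \<inter> V)"
  have V'o: "open V'" unfolding V'_def using U V by (intro open_chart_image) auto
  have V's: "V' \<subseteq> cube u r" using im by (auto simp: V'_def)
  let ?c = "coord c y"
  have yV: "?c \<in> V'" using V by (auto simp: V'_def)
  then obtain e where e: "0 < e" "ball ?c e \<subseteq> V'" using V'o unfolding open_contains_ball by blast
  define D where "D = 2 * r * ?n"
  have D: "0 < D" using r by (simp add: D_def)
  have Db: "norm (x - ?c) \<le> D" if x: "x \<in> cube u r" for x
  proof -
    have "norm (x - ?c) \<le> (\<Sum>b\<in>Basis. \<bar>(x - ?c) \<bullet> b\<bar>)" by (rule norm_le_l1)
    also have "\<dots> \<le> (\<Sum>b\<in>(Basis :: (real ^ 'n) set). 2 * r)"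
    proof (rule sum_mono)
      fix b :: "real ^ 'n" assume b: "b \<in> Basis"
      have "\<bar>(x - u) \<bullet> b\<bar> < r" "\<bar>(?c - u) \<bullet> b\<bar> < r" using x yV V's b by (auto simp: mem_cube)
      moreover have "(x - ?c) \<bullet> b = (x - u) \<bullet> b - (?c - u) \<bullet> b" by (simp add: inner_diff_left)
      ultimately show "\<bar>(x - ?c) \<bullet> b\<bar> \<le> 2 * r" by linarith
    qed
    finally show ?thesis by (simp add: D_def mult_ac)
  qed
  \<comment> \<open>Small enough for the contracted cube to lie in the ball of radius \<open>e\<close> around \<open>?c\<close>.\<close>
  define s where "s = min 1 (e / (2 * D))"
  have s: "0 < s" "s \<le> 1" using e D by (auto simp: s_def)
  have into: "?c + s *\<^sub>R (x - ?c) \<in> V'" if x: "x \<in> cube u r" for x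
  proof -
    have "s * norm (x - ?c) \<le> (e / (2 * D)) * D" using s Db[OF x] D e by (intro mult_mono) (auto simp: s_def)
    also have "\<dots> < e" using D e by simp
    finally have "?c + s *\<^sub>R (x - ?c) \<in> ball ?c e" using s by (simp add: dist_norm)
    then show ?thesis using e by blast
  qed
  define K\<^sub>1 K\<^sub>2 where "K\<^sub>1 = 2 powr p / s ^ ?n" and "K\<^sub>2 = 2 powr p * D powr p / s ^ ?n"
  have K: "0 \<le> K\<^sub>1" "0 \<le> K\<^sub>2" using s by (auto simp: K\<^sub>1_def K\<^sub>2_def)
  have "mass p U f \<le> ennreal (L * K\<^sub>1 * L) * mass p V f + ennreal (L * K\<^sub>2 * (L * L powr p)) * energy f" if f: "test f" for f
  proof -
    let ?F = "f \<circ> coord_inv c" and ?N = "\<lambda>u. L * gradient_norm A g f (coord_inv c u)"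
    have ug: "upper_gradient (cube u r) ?F ?N" using comparable_chartD(5)[OF c f] by (simp add: im)
    have "(\<integral>\<^sup>+x\<in>cube u r. ennreal (\<bar>?F x\<bar> powr p) \<partial>lborel) \<le>
        ennreal K\<^sub>1 * (\<integral>\<^sup>+x\<in>V'. ennreal (\<bar>?F x\<bar> powr p) \<partial>lborel) +
        ennreal K\<^sub>2 * (\<integral>\<^sup>+x\<in>cube u r. ennreal (?N x powr p) \<partial>lborel)"
      unfolding K\<^sub>1_def K\<^sub>2_def
      by (rule poincare_contraction[OF open_cube convex_cube subsetD[OF V's yV] Db ug p(1) s V'o V's into])
    also have "\<dots> \<le> ennreal K\<^sub>1 * (ennreal L * mass p V f) + ennreal K\<^sub>2 * (ennreal (L * L powr p) * energy f)"
    proof (intro add_mono mult_left_mono)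
      show "(\<integral>\<^sup>+x\<in>cube u r. ennreal (?N x powr p) \<partial>lborel) \<le> ennreal (L * L powr p) * energy f"
        using gradient_mass_le_energy[OF f c] by (simp add: im)
      have Vb: "V \<in> sets borel" using V by simp
      have "(\<integral>\<^sup>+x\<in>V'. ennreal (\<bar>?F x\<bar> powr p) \<partial>lborel) =
          (\<integral>\<^sup>+x\<in>coord c ` U. ennreal (\<bar>?F x\<bar> powr p) * indicator V (coord_inv c x) \<partial>lborel)"
      proof (rule nn_integral_cong)
        fix w
        have "w \<in> V' \<longleftrightarrow> w \<in> coord c ` U \<and> coord_inv c w \<in> V"
          unfolding V'_def using U(3) by (force simp: is_chartD(5)[OF U(1)] subsetD)
        then show "ennreal (\<bar>?F w\<bar> powr p) * indicator V' w =
          ennreal (\<bar>?F w\<bar> powr p) * indicator V (coord_inv c w) * indicator (coord c ` U) w"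
          by (simp add: indicator_def)
      qed
      also have "\<dots> \<le> ennreal L * (\<integral>\<^sup>+x\<in>U. ennreal (\<bar>f x\<bar> powr p) * indicator V x \<partial>\<mu>)"
        using comparable_integrals(2)[OF c borel_mass_on[OF f Vb, of p]] by simp
      also have "\<dots> \<le> ennreal L * mass p V f"
        unfolding mass_def by (intro mult_left_mono nn_integral_mono) (auto simp: indicator_def)
      finally show "(\<integral>\<^sup>+x\<in>V'. ennreal (\<bar>?F x\<bar> powr p) \<partial>lborel) \<le> ennreal L * mass p V f" .
    qed auto
    finally have *: "(\<integral>\<^sup>+x\<in>cube u r. ennreal (\<bar>?F x\<bar> powr p) \<partial>lborel) \<le>
      ennreal K\<^sub>1 * (ennreal L * mass p V f) + ennreal K\<^sub>2 * (ennreal (L * L powr p) * energy f)" .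
    have "mass p U f \<le> ennreal L * (\<integral>\<^sup>+x\<in>cube u r. ennreal (\<bar>?F x\<bar> powr p) \<partial>lborel)"
      using comparable_integrals(1)[OF c borel_mass[OF f, of p]] by (simp add: im mass_def)
    also have "\<dots> \<le> ennreal L * (ennreal K\<^sub>1 * (ennreal L * mass p V f) + ennreal K\<^sub>2 * (ennreal (L * L powr p) * energy f))"
      by (intro mult_left_mono *) simp
    also have "\<dots> = ennreal (L * K\<^sub>1 * L) * mass p V f + ennreal (L * K\<^sub>2 * (L * L powr p)) * energy f"
      using L K by (simp add: ennreal_mult distrib_left mult.assoc)
    finally show ?thesis .
  qed
  then show ?thesis using that[of "L * K\<^sub>1 * L" "L * K\<^sub>2 * (L * L powr p)"] L K by simp
qed

text \<open>The controlled points form an open set by definition. A chart cube around any point of the closure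
  contains a controlled point \<open>y\<close>, and the bound near \<open>y\<close> spreads over the cube.\<close>
lemma controlled_everywhere:
  assumes conn: "connected (UNIV :: 'm set)" and x: "controlled x"
  shows "controlled y"
proof -
  let ?S = "Collect controlled"
  have op: "open ?S"
  proof (subst open_subopen, intro ballI)
    fix z assume "z \<in> ?S"
    then obtain U C where U: "open U" "z \<in> U" "0 \<le> C" "\<And>f. test f \<Longrightarrow> mass p U f \<le> ennreal C * energy f"
      unfolding controlled_def by blast
    then have "U \<subseteq> ?S" unfolding controlled_def by blast
    then show "\<exists>T. open T \<and> z \<in> T \<and> T \<subseteq> ?S" using U by blast
  qed
  have "open (- ?S)"
  proof (subst open_subopen, intro ballI)
    fix z assume z: "z \<in> - ?S"
    obtain c U L r where U: "z \<in> U" "U \<subseteq> UNIV" "comparable_chart A g \<mu> c U L" "0 < r" "coord c ` U = cube (coord c z) r"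
      using comparable_nbhd[OF open_UNIV UNIV_I] .
    have "U \<inter> ?S = {}"
    proof (rule ccontr)
      assume "U \<inter> ?S \<noteq> {}"
      then obtain y where y: "y \<in> U" "controlled y" by blast
      then obtain V C where V: "open V" "y \<in> V" "0 \<le> C" "\<And>f. test f \<Longrightarrow> mass p V f \<le> ennreal C * energy f"
        unfolding controlled_def by blast
      obtain C1 C2 where C12: "0 \<le> C1" "0 \<le> C2"
          "\<And>f. test f \<Longrightarrow> mass p U f \<le> ennreal C1 * mass p V f + ennreal C2 * energy f"
        by (rule mass_spreads[OF U(3,5,4) V(1) y(1) V(2)]) (rule that)
      have "mass p U f \<le> ennreal (C1 * C + C2) * energy f" if f: "test f" for f
      proof -
        have "mass p U f \<le> ennreal C1 * (ennreal C * energy f) + ennreal C2 * energy f"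
          by (rule order_trans[OF C12(3)[OF f]]) (intro add_right_mono mult_left_mono V(4)[OF f], simp)
        also have "\<dots> = ennreal (C1 * C + C2) * energy f"
          using C12 V by (simp add: ennreal_mult distrib_right mult.assoc)
        finally show ?thesis .
      qed
      moreover have "0 \<le> C1 * C + C2" using C12 V by simp
      ultimately have "controlled z" unfolding controlled_def using U(1) comparable_chartD(2)[OF U(3)] by blast
      then show False using z by simp
    qed
    then show "\<exists>T. open T \<and> z \<in> T \<and> T \<subseteq> - ?S" using U(1) comparable_chartD(2)[OF U(3)] by blast
  qed
  then have cl: "closed ?S" by (simp add: closed_def)
  have "\<forall>T :: 'm set. open T \<and> closed T \<longrightarrow> T = {} \<or> T = UNIV"
    using conn by (simp add: connected_clopen)
  then have "?S = {} \<or> ?S = UNIV" using op cl by blast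
  then show ?thesis using x by blast
qed

lemma sobolev_near_controlled:
  assumes "controlled x"
  obtains U C where "open U" "x \<in> U" "0 \<le> C" "\<And>f B. test f \<Longrightarrow> 0 \<le> B \<Longrightarrow> energy f \<le> ennreal B \<Longrightarrow>
    mass q U f \<le> ennreal (C * B powr (q / p))"
proof -
  obtain W C where W: "open W" "x \<in> W" "0 \<le> C" "\<And>f. test f \<Longrightarrow> mass p W f \<le> ennreal C * energy f"
    using assms unfolding controlled_def by blast
  obtain c U L r where U: "x \<in> U" "U \<subseteq> W" "comparable_chart A g \<mu> c U L" "0 < r" "coord c ` U = cube (coord c x) r"
    using comparable_nbhd[OF W(1,2)] .
  have "mass p U f \<le> ennreal C * energy f" if "test f" for f
    using order_trans[OF mass_mono[OF U(2)] W(4)[OF that]] .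
  then obtain C' where "0 \<le> C'" "\<And>f B. test f \<Longrightarrow> 0 \<le> B \<Longrightarrow> energy f \<le> ennreal B \<Longrightarrow>
    mass q U f \<le> ennreal (C' * B powr (q / p))"
    using sobolev_in_chart[OF U(3,5,4) W(3)] by metis
  then show ?thesis using that[of U C'] U(1) comparable_chartD(2)[OF U(3)] by blast
qed

lemma mass_Un_le:
  assumes "test f" "U \<in> sets borel" "V \<in> sets borel"
  shows "mass s (U \<union> V) f \<le> mass s U f + mass s V f"
proof -
  have m: "(\<lambda>x. ennreal (\<bar>f x\<bar> powr s) * indicator W x) \<in> borel_measurable \<mu>" if "W \<in> sets borel" for W
    using that by (intro measurable_\<mu> borel_mass_on assms(1))
  have "mass s (U \<union> V) f \<le> (\<integral>\<^sup>+x. ennreal (\<bar>f x\<bar> powr s) * indicator U x + ennreal (\<bar>f x\<bar> powr s) * indicator V x \<partial>\<mu>)"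
    unfolding mass_def by (intro nn_integral_mono) (auto simp: indicator_def)
  also have "\<dots> = mass s U f + mass s V f"
    unfolding mass_def using assms(2,3) by (intro nn_integral_add m)
  finally show ?thesis .
qed

lemma sobolev_Un:
  assumes U: "open U" "0 \<le> C" "\<And>f B. test f \<Longrightarrow> 0 \<le> B \<Longrightarrow> energy f \<le> ennreal B \<Longrightarrow> mass q U f \<le> ennreal (C * B powr (q / p))"
    and V: "open V" "0 \<le> D" "\<And>f B. test f \<Longrightarrow> 0 \<le> B \<Longrightarrow> energy f \<le> ennreal B \<Longrightarrow> mass q V f \<le> ennreal (D * B powr (q / p))"
    and f: "test f" and B: "0 \<le> B" "energy f \<le> ennreal B"
  shows "mass q (U \<union> V) f \<le> ennreal ((C + D) * B powr (q / p))"
proof -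
  have "mass q (U \<union> V) f \<le> mass q U f + mass q V f" using U V by (intro mass_Un_le f) auto
  also have "\<dots> \<le> ennreal (C * B powr (q / p)) + ennreal (D * B powr (q / p))"
    by (intro add_mono U(3) V(3) f B)
  also have "\<dots> = ennreal ((C + D) * B powr (q / p))"
    using U V by (simp add: distrib_right)
  finally show ?thesis .
qed

lemma sobolev_compact:
  assumes K: "compact K" and ctrl: "\<And>x. controlled x"
  obtains U C where "open U" "K \<subseteq> U" "0 \<le> C" "\<And>f B. test f \<Longrightarrow> 0 \<le> B \<Longrightarrow> energy f \<le> ennreal B \<Longrightarrow>
    mass q U f \<le> ennreal (C * B powr (q / p))"
proof -
  let ?P = "\<lambda>U C. open U \<and> 0 \<le> C \<and> (\<forall>f B. test f \<longrightarrow> 0 \<le> B \<longrightarrow> energy f \<le> ennreal B \<longrightarrow>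
    mass q U f \<le> ennreal (C * B powr (q / p)))"
  have "\<exists>U C. x \<in> U \<and> ?P U C" for x using sobolev_near_controlled[OF ctrl[of x]] by metis
  then obtain U C where UC: "\<And>x. x \<in> U x" "\<And>x. ?P (U x) (C x)" by metis
  have "K \<subseteq> (\<Union>x\<in>UNIV. U x)" using UC(1) by blast
  with K obtain F where F: "finite F" "K \<subseteq> (\<Union>x\<in>F. U x)" using UC(2) by (metis compactE_image)
  have "?P (\<Union>x\<in>F. U x) (\<Sum>x\<in>F. C x)" using F(1)
  proof (induction F rule: finite_induct)
    case empty
    show ?case by (simp add: mass_def)
  next
    case (insert x F)
    have "mass q (U x \<union> (\<Union>x\<in>F. U x)) f \<le> ennreal ((C x + (\<Sum>x\<in>F. C x)) * B powr (q / p))"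
      if "test f" "0 \<le> B" "energy f \<le> ennreal B" for f B
      by (rule sobolev_Un[OF _ _ _ _ _ _ that]) (use UC(2)[of x] insert.IH in auto)
    then show ?case using insert UC(2)[of x] by auto
  qed
  then show ?thesis using that F(2) by blast
qed

lemma LINT_energy: "test f \<Longrightarrow> ennreal (LINT x|\<mu>. gradient_norm A g f x powr p) = energy f"
proof -
  assume f: "test f"
  have "(LINT x|\<mu>. gradient_norm A g f x powr p) = enn2real (energy f)"
    unfolding energy_def using borel_gradient[OF f] by (intro integral_eq_nn_integral measurable_\<mu>) auto
  then show ?thesis using energy_finite[OF f] by simp
qed

lemma LINT_mass: "test f \<Longrightarrow> ennreal (LINT x|\<mu>. \<bar>f x\<bar> powr q) = mass q UNIV f"
proof -
  assume f: "test f"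
  have "(LINT x|\<mu>. \<bar>f x\<bar> powr q) = enn2real (mass q UNIV f)"
    unfolding mass_def using borel_test[OF f] by (simp, intro integral_eq_nn_integral measurable_\<mu>) auto
  then show ?thesis using mass_finite[OF f q_pos] by simp
qed

lemma sobolev_of_mass_bound:
  assumes C: "0 \<le> C" "\<And>f B. test f \<Longrightarrow> 0 \<le> B \<Longrightarrow> energy f \<le> ennreal B \<Longrightarrow> mass q UNIV f \<le> ennreal (C * B powr (q / p))"
    and f: "test f"
  shows "(LINT x|\<mu>. \<bar>f x\<bar> powr q) powr (1 / q) \<le> C powr (1 / q) * (LINT x|\<mu>. gradient_norm A g f x powr p) powr (1 / p)"
proof -
  define a b where "a = (LINT x|\<mu>. \<bar>f x\<bar> powr q)" and "b = (LINT x|\<mu>. gradient_norm A g f x powr p)"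
  have ab: "0 \<le> a" "0 \<le> b" unfolding a_def b_def by (rule integral_nonneg_AE, simp)+
  have "ennreal a \<le> ennreal (C * b powr (q / p))"
    using C(2)[OF f ab(2)] LINT_energy[OF f] LINT_mass[OF f] by (simp add: a_def b_def)
  then have "a \<le> C * b powr (q / p)" using C(1) by simp
  then have "a powr (1 / q) \<le> (C * b powr (q / p)) powr (1 / q)" 
    using ab q_pos less_imp_le[OF divide_pos_pos[OF zero_less_one q_pos]] by (intro powr_mono2)
  also have "\<dots> = C powr (1 / q) * (b powr (q / p)) powr (1 / q)" using C(1) by (simp add: powr_mult)
  also have "(b powr (q / p)) powr (1 / q) = b powr (1 / p)"
  proof -
    have "x / p * (1 / x) = 1 / p" if "x \<noteq> 0" for x :: real using that by simp
    from this[of q] have "q / p * (1 / q) = 1 / p" using q_pos by (metis less_irrefl)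
    then show ?thesis by (simp only: powr_powr)
  qed
  finally show ?thesis by (simp only: a_def b_def)
qed

text \<open>The exterior domain inequality in the isometric coordinates, in which the part of the support of
  a test function inside the end is bounded.\<close>
lemma end_properties:
  assumes E: "isometric_to_euclidean A g E (- cball 0 1)"
  obtains C where "E \<noteq> {}" "0 \<le> C"
    "\<And>f B. test f \<Longrightarrow> 0 \<le> B \<Longrightarrow> energy f \<le> ennreal B \<Longrightarrow> mass q E f \<le> ennreal (C * B powr (q / p))"
proof -
  obtain \<phi> where d: "admissible_chart A (E, \<phi>)" and im: "\<phi> ` E = - cball 0 1"
    and J: "\<And>c x. c \<in> A \<Longrightarrow> x \<in> E \<Longrightarrow> x \<in> chart_dom c \<Longrightarrow>
        g c x = transpose (transition_jacobian c (E, \<phi>) x) ** transition_jacobian c (E, \<phi>) x"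
    using E unfolding isometric_to_euclidean_def by blast
  have bd: "\<exists>R. \<forall>x\<in>E. R \<le> norm (coord (E, \<phi>) x) \<longrightarrow> f x = 0" if f: "test f" for f
  proof -
    obtain R where R: "\<And>y. y \<in> E \<Longrightarrow> y \<in> closure {x. f x \<noteq> 0} \<Longrightarrow> norm (\<phi> y) < R"
      by (rule end_bounded_on_compact[OF A g d im _ compact_support[OF f]], rule J, assumption+) (rule that)
    have "f x = 0" if "x \<in> E" "R \<le> norm (\<phi> x)" for x
      using R[OF that(1)] that(2) closure_subset[of "{x. f x \<noteq> 0}"] by force
    then show ?thesis by auto
  qed
  have cc: "comparable_chart A g \<mu> (E, \<phi>) E 1" by (rule comparable_chart_end[OF A g \<mu> d]) (rule J)
  have im': "coord (E, \<phi>) ` E = - cball 0 1" using im by simp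
  obtain C where C: "0 \<le> C" "\<And>f B. test f \<Longrightarrow> 0 \<le> B \<Longrightarrow> energy f \<le> ennreal B \<Longrightarrow>
    mass q E f \<le> ennreal (C * B powr (q / p))"
    by (rule sobolev_in_end[OF cc im'], erule bd) (rule that)
  have "E \<noteq> {}"
  proof
    assume "E = {}"
    then have "cball 0 1 = (UNIV :: (real ^ 'n) set)" using im by auto
    then show False using bounded_cball[of "0 :: real ^ 'n" 1] not_bounded_UNIV by metis
  qed
  then show ?thesis using C by (rule that)
qed

theorem sobolev_connected_sum:
  assumes M: "euclidean_connected_sum A g"
  shows "\<exists>C. \<forall>f. test f \<longrightarrow> (LINT x|\<mu>. \<bar>f x\<bar> powr q) powr (1 / q) \<le>
    C * (LINT x|\<mu>. gradient_norm A g f x powr p) powr (1 / p)"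
proof -
  obtain K E1 E2 where conn: "connected (UNIV :: 'm set)" and K: "compact K" and cover: "- K = E1 \<union> E2"
    and E: "open E1" "open E2" and iso: "isometric_to_euclidean A g E1 (- cball 0 1)" "isometric_to_euclidean A g E2 (- cball 0 1)"
    using M unfolding euclidean_connected_sum_def by blast
  obtain C1 where C1: "E1 \<noteq> {}" "0 \<le> C1"
    "\<And>f B. test f \<Longrightarrow> 0 \<le> B \<Longrightarrow> energy f \<le> ennreal B \<Longrightarrow> mass q E1 f \<le> ennreal (C1 * B powr (q / p))"
    by (rule end_properties[OF iso(1)]) (rule that)
  obtain C2 where C2: "0 \<le> C2"
    "\<And>f B. test f \<Longrightarrow> 0 \<le> B \<Longrightarrow> energy f \<le> ennreal B \<Longrightarrow> mass q E2 f \<le> ennreal (C2 * B powr (q / p))"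
    by (rule end_properties[OF iso(2)]) (rule that)
  obtain x where "x \<in> E1" using C1(1) by blast
  then have "controlled x" by (rule controlled_of_sobolev[OF E(1) _ C1(2,3)])
  then have ctrl: "controlled y" for y by (rule controlled_everywhere[OF conn])
  obtain U C0 where U: "open U" "K \<subseteq> U" "0 \<le> C0"
    "\<And>f B. test f \<Longrightarrow> 0 \<le> B \<Longrightarrow> energy f \<le> ennreal B \<Longrightarrow> mass q U f \<le> ennreal (C0 * B powr (q / p))"
    by (rule sobolev_compact[OF K ctrl]) (rule that)
  have E12: "mass q (E1 \<union> E2) f \<le> ennreal ((C1 + C2) * B powr (q / p))"
    if "test f" "0 \<le> B" "energy f \<le> ennreal B" for f B
    by (rule sobolev_Un[OF E(1) C1(2,3) E(2) C2 that])
  have all: "mass q (U \<union> (E1 \<union> E2)) f \<le> ennreal ((C0 + (C1 + C2)) * B powr (q / p))"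
    if "test f" "0 \<le> B" "energy f \<le> ennreal B" for f B
    by (rule sobolev_Un[OF U(1,3,4) open_Un[OF E] _ E12 that]) (use C1 C2 in auto)
  have UNIV: "U \<union> (E1 \<union> E2) = UNIV" using cover U(2) by blast
  have "0 \<le> C0 + (C1 + C2)" using U C1 C2 by simp
  from sobolev_of_mass_bound[OF this all[unfolded UNIV]] show ?thesis by blast
qed

end

theorem corollary4p7:
  fixes A :: "('m::{t2_space, second_countable_topology}, 'n::finite) chart set"
    and g :: "('m, 'n) metric_coeffs"
    and \<mu> :: "'m measure"
    and n :: nat and p :: real
  assumes "CARD('n) = n" and "n \<ge> 2"
    and "euclidean_connected_sum A g"
    and "riemannian_measure A g \<mu>"
    and "1 \<le> p" and "p < real n"
  shows "\<exists>C::real. \<forall>f. smooth_compactly_supported A f \<longrightarrow>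
           (LINT x|\<mu>. \<bar>f x\<bar> powr (real n * p / (real n - p))) powr ((real n - p) / (real n * p))
           \<le> C * (LINT x|\<mu>. gradient_norm A g f x powr p) powr (1 / p)"
proof -
  interpret riemannian_sobolev A g \<mu> "real n" p
    using assms unfolding euclidean_connected_sum_def by unfold_locales auto
  show ?thesis using sobolev_connected_sum[OF assms(3)] by simp
qed

end
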